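(* (i) Let $I = (\eta)$ be a principal ideal such that $r(\eta_a)$ is equivalent to a monotone sequence, and let $J$ be an arbitrary ideal. Then $J_{a^2} \subset I_{a^2}$ implies $J_a \subset I_a$. (ii) Let $I$ be a general ideal such that every $\mu \in \Sigma(I)$ is dominated by some $\eta \in \Sigma(I)$ (i.e., $\mu \le \eta$ termwise) for which $r(\eta_a)$ is equivalent to a monotone sequence. Then for every ideal $J$, $J_{a^2} \subset I_{a^2}$ implies $J_a \subset I_a$.
   Context: $H$ is an infinite-dimensional separable complex Hilbert space and $B(H)$ is the algebra of bounded operators on it. $\text{c}_{\text{o}}^*$ is the set of nonnegative real sequences $\xi = (\xi_n)_{n\ge 1}$ that are nonincreasing and converge to $0$. For $m \in \mathbb N$, the ampliation $D_m\xi$ is the sequence in which each entry of $\xi$ is repeated $m$ times. A characteristic set is a positive cone $\Sigma \subset \text{c}_{\text{o}}^*$ (closed under sums and nonnegative scalar multiples) that is hereditary ($0\le\eta \le \xi\in\Sigma$, $\eta\in \text{c}_{\text{o}}^*$, implies $\eta \in \Sigma$) and invariant under all $D_m$. By Calkin's theorem, $I \mapsto \Sigma(I) := \{s(X) \mid X \in I\}$, with $s(X)$ the sequence of $s$-numbers (singular values) of $X$ in decreasing order with multiplicity, completed by zeros if $X$ has finite rank, is an order-preserving bijection from the (proper, two-sided) ideals of $B(H)$ onto the characteristic sets; "ideal" means such an ideal. For $\xi\in \text{c}_{\text{o}}^*$, $(\xi_a)_n := \frac1n\sum_{j=1}^n \xi_j$ and $\xi_{a^2} := (\xi_a)_a$.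 The arithmetic mean ideal $I_a$ of an ideal $I$ is the ideal with $\Sigma(I_a) = \{\xi \in \text{c}_{\text{o}}^* \mid \xi = O(\eta_a) \text{ for some } \eta\in\Sigma(I)\}$, and $I_{a^2} := (I_a)_a$. A principal ideal is an ideal $(\xi)$ with $\xi \in \text{c}_{\text{o}}^*$ and $\Sigma((\xi)) = \{\eta\in\text{c}_{\text{o}}^* \mid \eta = O(D_m\xi)\text{ for some } m \in \mathbb N\}$ (the ideal generated by the diagonal operator with entries $\xi_n$). For $\xi \in \text{c}_{\text{o}}^*$ with all $\xi_n>0$, the ratio of regularity is the sequence $r(\xi) := \xi_a/\xi$ (termwise). For $0\neq\eta\in\text{c}_{\text{o}}^*$, $r(\eta_a) = \eta_{a^2}/\eta_a$ is always defined. A positive sequence $\rho$ is equivalent to a positive sequence $\phi$, written $\rho\asymp\phi$, if $\alpha\phi_n \le \rho_n \le \beta\phi_n$ for some constants $\alpha,\beta>0$ and all $n$. *)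

theory Defs
  imports "HOL-Analysis.Analysis" "HOL-Algebra.Ideal"
begin

section \<open>Complex Hilbert spaces\<close>

text \<open>
  The library has real Hilbert spaces only. A complex Hilbert space is a complete
  real inner product space carrying a complex scalar multiplication that extends the real one
  and a sesquilinear form, linear in the first argument, whose real part is the real inner product.
  Definiteness and the norm \<open>\<parallel>x\<parallel>\<^sup>2 = \<langle>x, x\<rangle>\<close> are thus inherited from \<^class>\<open>real_inner\<close>.
\<close>

class complex_hilbert = real_inner + complete_space +
  fixes scaleC :: "complex \<Rightarrow> 'a \<Rightarrow> 'a" (infixr "*\<^sub>C" 75)
    and cinner :: "'a \<Rightarrow> 'a \<Rightarrow> complex"
  assumes scaleC_add_right: "a *\<^sub>C (x + y) = a *\<^sub>C x + a *\<^sub>C y"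
    and scaleC_add_left: "(a + b) *\<^sub>C x = a *\<^sub>C x + b *\<^sub>C x"
    and scaleC_scaleC: "a *\<^sub>C b *\<^sub>C x = (a * b) *\<^sub>C x"
    and scaleC_one: "1 *\<^sub>C x = x"
    and scaleC_of_real: "complex_of_real r *\<^sub>C x = r *\<^sub>R x"
    and cinner_commute: "cinner x y = cnj (cinner y x)"
    and cinner_add_left: "cinner (x + y) z = cinner x z + cinner y z"
    and cinner_scaleC_left: "cinner (a *\<^sub>C x) y = a * cinner x y"
    and Re_cinner: "Re (cinner x y) = inner x y"

interpretation cvec: vector_space "scaleC :: complex \<Rightarrow> 'h \<Rightarrow> 'h::complex_hilbert"
  by standard (simp_all add: scaleC_add_right scaleC_add_left scaleC_scaleC scaleC_one)

definition infinite_dimensional :: "'h::complex_hilbert set \<Rightarrow> bool" where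
  "infinite_dimensional V \<longleftrightarrow> \<not> (\<exists>B. finite B \<and> V \<subseteq> cvec.span B)"


section \<open>Bounded operators, their ideals and their singular values\<close>

definition bounded_operators :: "('h::complex_hilbert \<Rightarrow> 'h) set" where
  "bounded_operators = {X. bounded_linear X \<and> (\<forall>c v. X (c *\<^sub>C v) = c *\<^sub>C X v)}"

definition BH :: "('h::complex_hilbert \<Rightarrow> 'h) ring" where
  "BH = \<lparr>carrier = bounded_operators, monoid.mult = (\<circ>), one = id,
         ring.zero = (\<lambda>v. 0), add = (\<lambda>X Y v. X v + Y v)\<rparr>"

text \<open>
  Two-sided ring ideals of \<open>B(H)\<close> are automatically closed under complex scalars, because
  \<open>B(H)\<close> contains the scalar multiples of the identity.
\<close>

definition operator_ideal :: "('h::complex_hilbert \<Rightarrow> 'h) set \<Rightarrow> bool" where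
  "operator_ideal I \<longleftrightarrow> ideal I BH \<and> I \<noteq> bounded_operators"

definition cadjoint :: "('h::complex_hilbert \<Rightarrow> 'h) \<Rightarrow> 'h \<Rightarrow> 'h" where
  "cadjoint X = (THE Y. \<forall>v w. cinner (X v) w = cinner v (Y w))"

text \<open>
  All sequences are indexed from 0, so \<open>\<xi> n\<close> stands for the entry \<open>\<xi>\<^sub>n\<^sub>+\<^sub>1\<close> of a sequence
  indexed from 1.
\<close>

definition c0_star :: "(nat \<Rightarrow> real) set" where
  "c0_star = {\<xi>. (\<forall>n. 0 \<le> \<xi> n) \<and> decseq \<xi> \<and> \<xi> \<longlonglongrightarrow> 0}"

text \<open>
  The positive singular values of \<open>X\<close> are the square roots of the positive eigenvalues of \<open>X\<^sup>*X\<close>.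
  A sequence in \<^const>\<open>c0_star\<close> is determined by the number of times it takes each positive value;
  if there are only finitely many positive singular values (\<open>X\<close> of finite rank), the remaining entries
  are therefore 0. The definition is meaningful for compact \<open>X\<close>, hence for every
  member of a proper ideal.
\<close>

definition singular_eigenspace :: "('h::complex_hilbert \<Rightarrow> 'h) \<Rightarrow> real \<Rightarrow> 'h set" where
  "singular_eigenspace X \<sigma> = {v. cadjoint X (X v) = complex_of_real (\<sigma>\<^sup>2) *\<^sub>C v}"

definition s_numbers :: "('h::complex_hilbert \<Rightarrow> 'h) \<Rightarrow> nat \<Rightarrow> real" where
  "s_numbers X = (THE \<xi>. \<xi> \<in> c0_star \<and>
     (\<forall>\<sigma>>0. card {n. \<xi> n = \<sigma>} = cvec.dim (singular_eigenspace X \<sigma>)))"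

definition char_set :: "('h::complex_hilbert \<Rightarrow> 'h) set \<Rightarrow> (nat \<Rightarrow> real) set" where
  "char_set I = s_numbers ` I"

text \<open>The inverse of Calkin's bijection from ideals to characteristic sets.\<close>

definition ideal_of :: "(nat \<Rightarrow> real) set \<Rightarrow> ('h::complex_hilbert \<Rightarrow> 'h) set" where
  "ideal_of S = (THE I. operator_ideal I \<and> char_set I = S)"


section \<open>Arithmetic means and ampliations\<close>

definition am :: "(nat \<Rightarrow> real) \<Rightarrow> nat \<Rightarrow> real" where
  "am \<xi> n = (\<Sum>j\<le>n. \<xi> j) / real (Suc n)"

definition ampliation :: "nat \<Rightarrow> (nat \<Rightarrow> real) \<Rightarrow> nat \<Rightarrow> real" where
  "ampliation m \<xi> n = \<xi> (n div m)"

text \<open>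
  \<open>\<xi> = O(\<eta>)\<close> for nonnegative sequences, with the bound required for all \<open>n\<close> and not just eventually.
  The two readings differ when \<open>\<eta>\<close> has zeros: in particular \<open>\<xi> = O(0)\<close> here means \<open>\<xi> = 0\<close>, so that
  the zero ideal is the principal ideal generated by 0 and is its own arithmetic mean.
\<close>

definition big_O :: "(nat \<Rightarrow> real) \<Rightarrow> (nat \<Rightarrow> real) \<Rightarrow> bool" where
  "big_O \<xi> \<eta> \<longleftrightarrow> (\<exists>C. \<forall>n. \<xi> n \<le> C * \<eta> n)"

definition am_ideal :: "('h::complex_hilbert \<Rightarrow> 'h) set \<Rightarrow> ('h \<Rightarrow> 'h) set" where
  "am_ideal I = ideal_of {\<xi> \<in> c0_star. \<exists>\<eta> \<in> char_set I. big_O \<xi> (am \<eta>)}"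

definition principal_ideal :: "(nat \<Rightarrow> real) \<Rightarrow> ('h::complex_hilbert \<Rightarrow> 'h) set" where
  "principal_ideal \<xi> = ideal_of {\<eta> \<in> c0_star. \<exists>m\<ge>1. big_O \<eta> (ampliation m \<xi>)}"

definition regularity_ratio :: "(nat \<Rightarrow> real) \<Rightarrow> nat \<Rightarrow> real" where
  "regularity_ratio \<xi> n = am \<xi> n / \<xi> n"

definition seq_equiv :: "(nat \<Rightarrow> real) \<Rightarrow> (nat \<Rightarrow> real) \<Rightarrow> bool" where
  "seq_equiv \<rho> \<phi> \<longleftrightarrow>
     (\<exists>\<alpha> \<beta>. 0 < \<alpha> \<and> 0 < \<beta> \<and> (\<forall>n. \<alpha> * \<phi> n \<le> \<rho> n \<and> \<rho> n \<le> \<beta> * \<phi> n))"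

definition equiv_to_monotone :: "(nat \<Rightarrow> real) \<Rightarrow> bool" where
  "equiv_to_monotone \<rho> \<longleftrightarrow> (\<exists>\<phi>. (\<forall>n. 0 < \<phi> n) \<and> monoseq \<phi> \<and> seq_equiv \<rho> \<phi>)"

end

theory Submission
  imports Defs
begin

text \<open>
  By Calkin's theorem an inclusion of ideals is an inclusion of their characteristic sets, so the
  theorem reduces to a statement about two sequences (\<open>first_order_cancellation\<close>):
  if \<open>\<mu>\<^sub>a\<^sub>a = O(\<eta>\<^sub>a\<^sub>a)\<close> and the ratio \<open>r = \<eta>\<^sub>a\<^sub>a / \<eta>\<^sub>a\<close> is equivalent to a monotone sequence, then
  \<open>\<mu>\<^sub>a = O(\<eta>\<^sub>a)\<close>.

  When \<open>r\<close> is essentially nonincreasing, it is bounded, \<open>\<eta>\<^sub>a\<^sub>a\<close> and \<open>\<eta>\<^sub>a\<close> are equivalent, and \<open>\<mu>\<^sub>a \<le> \<mu>\<^sub>a\<^sub>a\<close>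
  gives the claim. When \<open>r\<close> is essentially nondecreasing, compare the sums \<open>F\<close> of \<open>\<eta>\<^sub>a\<close> and \<open>G\<close> of \<open>\<mu>\<^sub>a\<close>
  between an index \<open>n\<close> and the index \<open>m\<close> of the order \<open>n exp (r(n))\<close>. In continuous terms the logarithmic
  derivative of \<open>F\<close> at \<open>x\<close> is \<open>1 / (x r(x))\<close>, at most a multiple of \<open>1 / (x r(n))\<close>, so \<open>F\<close> grows only by a constant
  factor from \<open>n r(n) \<eta>\<^sub>a(n)\<close>. But \<open>x \<mu>\<^sub>a(x)\<close> is nondecreasing, so \<open>G\<close> gains at least
  \<open>n \<mu>\<^sub>a(n) ln (m / n) = n \<mu>\<^sub>a(n) r(n)\<close>. Comparing the two at \<open>m\<close> cancels \<open>n r(n)\<close>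
  (\<open>am_am_growth_upper\<close>, \<open>am_am_growth_lower\<close>).

  The larger part of the development is Calkin's correspondence for a separable infinite-dimensional
  space with an orthonormal basis \<open>e\<close>. A noncompact operator \<open>X\<close> factors the identity as \<open>A X B\<close>, so proper
  ideals consist of compact operators (\<open>id_factors_through_noncompact\<close>). A compact operator
  has a singular value decomposition, obtained by maximizing \<open>\<parallel>X x\<parallel>\<close> successively
  (\<open>compact_op_has_singular_value_decomposition\<close>), and its coefficients are the singular values
  defined through the eigenspaces of \<open>X\<^sup>* X\<close> (\<open>s_numbers_eq\<close>). So \<open>X\<close> generates the same ideal as
  the diagonal operator of its singular values, and the characteristic set of an ideal \<open>I\<close> consists of the
  sequences whose diagonal operator is in \<open>I\<close>. Conversely, the min-max
  description of singular values shows that the operators with singular values in a given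
  characteristic set form an ideal (\<open>Calkin\<close>). Hence \<^const>\<open>ideal_of\<close>
  inverts \<^const>\<open>char_set\<close>, and the characteristic sets of arithmetic mean and principal ideals
  are the ones by which these ideals are defined.
\<close>

section \<open>Characteristic sets and arithmetic means\<close>

text \<open>
  Hereditariness and closure under nonnegative multiples are merged into one clause: a sequence of
  \<^const>\<open>c0_star\<close> that is big-O of a member is a member.
\<close>

definition characteristic_set :: "(nat \<Rightarrow> real) set \<Rightarrow> bool" where
  "characteristic_set S \<longleftrightarrow> S \<subseteq> c0_star \<and> (\<lambda>n. 0) \<in> S \<and>
     (\<forall>\<xi>\<in>S. \<forall>\<eta>\<in>S. (\<lambda>n. \<xi> n + \<eta> n) \<in> S) \<and>
     (\<forall>\<xi>\<in>S. \<forall>\<eta>\<in>c0_star. big_O \<eta> \<xi> \<longrightarrow> \<eta> \<in> S) \<and>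
     (\<forall>\<xi>\<in>S. \<forall>m\<ge>1. ampliation m \<xi> \<in> S)"

lemma c0_starI:
  assumes "\<And>n. 0 \<le> \<xi> n" "\<And>n. \<xi> (Suc n) \<le> \<xi> n" "\<xi> \<longlonglongrightarrow> 0"
  shows "\<xi> \<in> c0_star"
  using assms by (simp add: c0_star_def decseq_Suc_iff)

lemma c0_star_nonneg: "\<xi> \<in> c0_star \<Longrightarrow> 0 \<le> \<xi> n"
  by (simp add: c0_star_def)

lemma c0_star_antimono: "\<xi> \<in> c0_star \<Longrightarrow> m \<le> n \<Longrightarrow> \<xi> n \<le> \<xi> m"
  by (simp add: c0_star_def decseq_def)

lemma c0_star_tendsto: "\<xi> \<in> c0_star \<Longrightarrow> \<xi> \<longlonglongrightarrow> 0"
  by (simp add: c0_star_def)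

lemma c0_star_zero: "(\<lambda>n. 0) \<in> c0_star"
  by (simp add: c0_star_def decseq_def)

lemma c0_star_add: "\<xi> \<in> c0_star \<Longrightarrow> \<eta> \<in> c0_star \<Longrightarrow> (\<lambda>n. \<xi> n + \<eta> n) \<in> c0_star"
  by (auto simp: c0_star_def decseq_def intro: add_mono tendsto_add_zero)

lemma ampliation_c0_star:
  assumes "\<xi> \<in> c0_star" "m \<ge> 1"
  shows "ampliation m \<xi> \<in> c0_star"
proof -
  have "filterlim (\<lambda>n. n div m) sequentially sequentially"
    unfolding filterlim_at_top eventually_sequentially
  proof
    fix Z
    have "Z \<le> n div m" if "n \<ge> Z * m" for n
      using that \<open>m \<ge> 1\<close> by (simp add: less_eq_div_iff_mult_less_eq)
    then show "\<exists>N. \<forall>n\<ge>N. Z \<le> n div m" by blast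
  qed
  then have "(\<lambda>n. \<xi> (n div m)) \<longlonglongrightarrow> 0"
    using assms(1) c0_star_tendsto filterlim_compose by blast
  then show ?thesis
    using assms unfolding c0_star_def decseq_def ampliation_def by (auto simp: div_le_mono)
qed

lemma ampliation_ampliation: "ampliation k (ampliation m \<xi>) = ampliation (k * m) \<xi>"
  by (simp add: ampliation_def fun_eq_iff div_mult2_eq)

lemma ampliation_mono_index:
  assumes "\<xi> \<in> c0_star" "1 \<le> m" "m \<le> k"
  shows "ampliation m \<xi> n \<le> ampliation k \<xi> n"
  using assms by (auto simp: ampliation_def intro!: c0_star_antimono div_le_mono2)

text \<open>
  The constant in \<^const>\<open>big_O\<close> may be any real number; against a nonnegative sequence it can be
  enlarged to a positive one.
\<close>

lemma big_OE_pos: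
  assumes "big_O \<xi> \<eta>" "\<And>n. 0 \<le> \<eta> n"
  obtains C where "0 < C" "\<And>n. \<xi> n \<le> C * \<eta> n"
proof -
  obtain C where C: "\<And>n. \<xi> n \<le> C * \<eta> n"
    using assms(1) unfolding big_O_def by blast
  have "\<xi> n \<le> (\<bar>C\<bar> + 1) * \<eta> n" for n
  proof -
    have "C * \<eta> n \<le> (\<bar>C\<bar> + 1) * \<eta> n"
      using assms(2) by (intro mult_right_mono) auto
    then show ?thesis using C[of n] by linarith
  qed
  then show thesis by (intro that[of "\<bar>C\<bar> + 1"]) auto
qed

lemma big_O_trans:
  assumes "big_O \<xi> \<eta>" "big_O \<eta> \<zeta>" "\<And>n. 0 \<le> \<eta> n"
  shows "big_O \<xi> \<zeta>"
proof -
  obtain C where C: "0 < C" "\<And>n. \<xi> n \<le> C * \<eta> n"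
    using big_OE_pos[OF assms(1,3)] by blast
  obtain D where D: "\<And>n. \<eta> n \<le> D * \<zeta> n"
    using assms(2) unfolding big_O_def by blast
  have "\<xi> n \<le> (C * D) * \<zeta> n" for n
  proof -
    have "C * \<eta> n \<le> C * (D * \<zeta> n)" using C(1) D by (intro mult_left_mono) auto
    then show ?thesis using C(2)[of n] by (simp add: mult.assoc)
  qed
  then show ?thesis unfolding big_O_def by blast
qed

lemma big_O_le: "(\<And>n. \<xi> n \<le> \<eta> n) \<Longrightarrow> big_O \<xi> \<eta>"
  unfolding big_O_def by (rule exI[of _ 1]) simp

lemma big_O_add:
  assumes "big_O \<xi> \<zeta>" "big_O \<eta> \<zeta>"
  shows "big_O (\<lambda>n. \<xi> n + \<eta> n) \<zeta>"
proof -
  obtain C D where "\<And>n. \<xi> n \<le> C * \<zeta> n" "\<And>n. \<eta> n \<le> D * \<zeta> n"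
    using assms unfolding big_O_def by blast
  then have "\<xi> n + \<eta> n \<le> (C + D) * \<zeta> n" for n
    by (simp add: distrib_right add_mono)
  then show ?thesis unfolding big_O_def by blast
qed

lemma big_O_ampliation: "big_O \<xi> \<eta> \<Longrightarrow> big_O (ampliation m \<xi>) (ampliation m \<eta>)"
  unfolding big_O_def ampliation_def by blast

lemma am_add: "am (\<lambda>n. \<xi> n + \<eta> n) = (\<lambda>n. am \<xi> n + am \<eta> n)"
  by (simp add: am_def fun_eq_iff sum.distrib add_divide_distrib)

lemma am_mono_scaled:
  assumes "\<And>n. \<xi> n \<le> C * \<eta> n"
  shows "am \<xi> n \<le> C * am \<eta> n"
proof -
  have "(\<Sum>j\<le>n. \<xi> j) \<le> C * (\<Sum>j\<le>n. \<eta> j)"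
    unfolding sum_distrib_left by (intro sum_mono assms)
  then show ?thesis by (simp add: am_def divide_right_mono)
qed

lemma am_big_O: "big_O \<xi> \<eta> \<Longrightarrow> big_O (am \<xi>) (am \<eta>)"
  unfolding big_O_def using am_mono_scaled by blast

lemma am_nonneg: "(\<And>n. 0 \<le> \<xi> n) \<Longrightarrow> 0 \<le> am \<xi> n"
  by (simp add: am_def sum_nonneg)

lemma sum_eq_Suc_am: "(\<Sum>j\<le>n. \<xi> j) = real (Suc n) * am \<xi> n"
  by (simp add: am_def del: of_nat_Suc)

lemma am_ge_self:
  assumes "\<xi> \<in> c0_star"
  shows "\<xi> n \<le> am \<xi> n"
proof -
  have "real (Suc n) * \<xi> n = (\<Sum>j\<le>n. \<xi> n)" by simp
  also have "\<dots> \<le> (\<Sum>j\<le>n. \<xi> j)"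
    using assms by (intro sum_mono c0_star_antimono) auto
  finally show ?thesis
    by (simp add: sum_eq_Suc_am del: of_nat_Suc)
qed

text \<open>
  The mean decreases because the next entry is at most the mean of the earlier ones; its
  convergence to 0 is Cesaro's theorem.
\<close>

lemma am_c0_star:
  assumes "\<xi> \<in> c0_star"
  shows "am \<xi> \<in> c0_star"
proof (rule c0_starI)
  show "0 \<le> am \<xi> n" for n using assms by (simp add: am_nonneg c0_star_nonneg)
  show "am \<xi> (Suc n) \<le> am \<xi> n" for n
  proof -
    have "\<xi> (Suc n) \<le> am \<xi> n"
      using am_ge_self[OF assms, of n] c0_star_antimono[OF assms, of n "Suc n"] by linarith
    have "real (Suc (Suc n)) * am \<xi> (Suc n) = real (Suc n) * am \<xi> n + \<xi> (Suc n)"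
      by (simp only: sum_eq_Suc_am[symmetric] sum.atMost_Suc)
    also have "\<dots> \<le> real (Suc (Suc n)) * am \<xi> n"
      using \<open>\<xi> (Suc n) \<le> am \<xi> n\<close> by (simp add: algebra_simps)
    finally show ?thesis by (simp del: of_nat_Suc)
  qed
  show "am \<xi> \<longlonglongrightarrow> 0"
  proof (rule LIMSEQ_I)
    fix r :: real assume "r > 0"
    then obtain N where N: "\<And>n. n \<ge> N \<Longrightarrow> \<xi> n < r / 2"
      using LIMSEQ_D[OF c0_star_tendsto[OF assms], of "r/2"] c0_star_nonneg[OF assms] by fastforce
    define S where "S = (\<Sum>j<N. \<xi> j)"
    obtain M where M: "real M > 2 * S / r" using reals_Archimedean2 by blast
    have "norm (am \<xi> n - 0) < r" if "n \<ge> max N M" for n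
    proof -
      have "{..n} = {..<N} \<union> {N..n}" using that by auto
      then have "(\<Sum>j\<le>n. \<xi> j) = S + (\<Sum>j=N..n. \<xi> j)"
        unfolding S_def by (simp add: sum.union_disjoint ivl_disj_int)
      also have "(\<Sum>j=N..n. \<xi> j) \<le> (\<Sum>j=N..n. r/2)"
        using N by (intro sum_mono) (auto intro: less_imp_le)
      also have "\<dots> \<le> real (Suc n) * (r/2)"
        using \<open>r > 0\<close> by (simp add: mult_right_mono)
      finally have "real (Suc n) * am \<xi> n \<le> S + real (Suc n) * (r/2)"
        by (simp add: sum_eq_Suc_am del: of_nat_Suc)
      moreover have "S < real (Suc n) * (r/2)"
      proof -
        have "2 * S / r < real (Suc n)" using M that by simp
        then show ?thesis using \<open>r > 0\<close> by (simp add: field_simps)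
      qed
      moreover have "real (Suc n) * (r/2) + real (Suc n) * (r/2) = real (Suc n) * r"
        by (simp only: distrib_left[symmetric]) simp
      ultimately have "real (Suc n) * am \<xi> n < real (Suc n) * r"
        by linarith
      then have "am \<xi> n < r" by (simp del: of_nat_Suc)
      then show ?thesis using am_nonneg[of \<xi> n] c0_star_nonneg[OF assms] by simp
    qed
    then show "\<exists>no. \<forall>n\<ge>no. norm (am \<xi> n - 0) < r" by blast
  qed
qed

text \<open>
  Among the first \<open>n + 1\<close> entries of \<open>D\<^sub>m \<xi>\<close> only values \<open>\<xi> q\<close> with \<open>q \<le> n\<close> occur, each at most
  \<open>m\<close> times.
\<close>

lemma am_ampliation_le:
  assumes "\<xi> \<in> c0_star" "m \<ge> 1"
  shows "am (ampliation m \<xi>) n \<le> real m * am \<xi> n"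
proof -
  have "(\<Sum>j\<le>n. ampliation m \<xi> j) = (\<Sum>q\<in>{..n}. \<Sum>j\<in>{j\<in>{..n}. j div m = q}. \<xi> (j div m))"
    unfolding ampliation_def by (rule sum.group[symmetric]) (auto intro: le_trans[OF div_le_dividend])
  also have "\<dots> = (\<Sum>q\<le>n. real (card {j\<in>{..n}. j div m = q}) * \<xi> q)"
    by (rule sum.cong) auto
  also have "\<dots> \<le> (\<Sum>q\<le>n. real m * \<xi> q)"
  proof (intro sum_mono mult_right_mono)
    fix q
    have "{j\<in>{..n}. j div m = q} \<subseteq> {q * m..<q * m + m}"
      using \<open>m \<ge> 1\<close> by (auto simp: div_nat_eqI)
         (metis add.commute assms(2) dividend_less_div_times less_eq_Suc_le One_nat_def)
    then have "card {j\<in>{..n}. j div m = q} \<le> card {q * m..<q * m + m}"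
      by (intro card_mono) auto
    then show "real (card {j\<in>{..n}. j div m = q}) \<le> real m" by simp
  qed (use assms in \<open>simp add: c0_star_nonneg\<close>)
  finally show ?thesis
    by (simp add: am_def divide_right_mono flip: sum_distrib_left)
qed

text \<open>
  The partial sums of \<open>\<xi>\<close> increase, and from \<open>n div m\<close> to \<open>n\<close> the number of averaged entries grows
  by a factor of at most \<open>m\<close>.
\<close>

lemma ampliation_am_le:
  assumes "\<xi> \<in> c0_star" "m \<ge> 1"
  shows "ampliation m (am \<xi>) n \<le> real m * am \<xi> n"
proof -
  define q where "q = n div m"
  have "q \<le> n" by (simp add: q_def)
  have n: "n < m * Suc q"
    using dividend_less_times_div[of m n] assms(2) by (simp add: q_def mult.commute)
  have "real (Suc q) * am \<xi> q \<le> real (Suc n) * am \<xi> n"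
    unfolding sum_eq_Suc_am[symmetric] using \<open>q \<le> n\<close> assms
    by (intro sum_mono2) (auto simp: c0_star_nonneg)
  also have "\<dots> \<le> (real m * real (Suc q)) * am \<xi> n"
  proof (rule mult_right_mono)
    show "real (Suc n) \<le> real m * real (Suc q)"
      using n by (metis Suc_leI of_nat_le_iff of_nat_mult)
  qed (use assms in \<open>simp add: am_nonneg c0_star_nonneg\<close>)
  finally have "real (Suc q) * am \<xi> q \<le> real (Suc q) * (real m * am \<xi> n)"
    by (simp only: mult_ac)
  then have "am \<xi> q \<le> real m * am \<xi> n" by (simp del: of_nat_Suc)
  then show ?thesis by (simp add: ampliation_def q_def)
qed

lemma big_O_am_ampliation:
  assumes "\<xi> \<in> c0_star" "m \<ge> 1"
  shows "big_O (am (ampliation m \<xi>)) (am \<xi>)"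
  using am_ampliation_le[OF assms] unfolding big_O_def by blast

lemma big_O_ampliation_am:
  assumes "\<xi> \<in> c0_star" "m \<ge> 1"
  shows "big_O (ampliation m (am \<xi>)) (am \<xi>)"
  using ampliation_am_le[OF assms] unfolding big_O_def by blast

text \<open>
  Sums reduce to additivity of the mean. Ampliations are absorbed because
  \<open>D\<^sub>m \<eta>\<^sub>a \<le> m \<eta>\<^sub>a\<close>.
\<close>

lemma characteristic_set_am:
  assumes "characteristic_set S"
  shows "characteristic_set {\<xi> \<in> c0_star. \<exists>\<eta>\<in>S. big_O \<xi> (am \<eta>)}" (is "characteristic_set ?T")
proof -
  have nn: "0 \<le> am \<eta> n" if "\<eta> \<in> S" for \<eta> n
    using assms that unfolding characteristic_set_def by (meson am_nonneg c0_star_nonneg subsetD)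
  have "(\<lambda>n. 0) \<in> ?T"
    using assms by (auto simp: characteristic_set_def c0_star_zero am_def intro!: bexI[of _ "\<lambda>n. 0"] big_O_le)
  moreover have "(\<lambda>n. \<xi> n + \<eta> n) \<in> ?T" if mem: "\<xi> \<in> ?T" "\<eta> \<in> ?T" for \<xi> \<eta>
  proof -
    obtain \<mu> \<nu> where *: "\<mu> \<in> S" "\<nu> \<in> S" "big_O \<xi> (am \<mu>)" "big_O \<eta> (am \<nu>)"
      using mem by blast
    have "big_O (am \<mu>) (am (\<lambda>n. \<mu> n + \<nu> n))" "big_O (am \<nu>) (am (\<lambda>n. \<mu> n + \<nu> n))"
      using nn *(1,2) by (auto simp: am_add intro!: big_O_le)
    then have "big_O (\<lambda>n. \<xi> n + \<eta> n) (am (\<lambda>n. \<mu> n + \<nu> n))"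
      using * nn by (blast intro: big_O_add big_O_trans)
    moreover have "(\<lambda>n. \<mu> n + \<nu> n) \<in> S"
      using assms *(1,2) by (auto simp: characteristic_set_def)
    ultimately show ?thesis using mem c0_star_add by auto
  qed
  moreover have "\<eta> \<in> ?T" if "\<xi> \<in> ?T" "\<eta> \<in> c0_star" "big_O \<eta> \<xi>" for \<xi> \<eta>
    using that big_O_trans c0_star_nonneg by blast
  moreover have "ampliation m \<xi> \<in> ?T" if mem: "\<xi> \<in> ?T" "m \<ge> 1" for \<xi> m
  proof -
    obtain \<mu> where *: "\<mu> \<in> S" "big_O \<xi> (am \<mu>)"
      using mem by blast
    have "\<mu> \<in> c0_star" using * assms by (auto simp: characteristic_set_def)
    then have "big_O (ampliation m \<xi>) (am \<mu>)"
      using big_O_trans[OF big_O_ampliation[OF *(2)] big_O_ampliation_am] mem(2)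
      by (simp add: ampliation_def am_nonneg c0_star_nonneg)
    then show ?thesis using * mem ampliation_c0_star by auto
  qed
  ultimately show ?thesis
    unfolding characteristic_set_def by (intro conjI ballI allI impI) auto
qed

text \<open>
  Two generators \<open>D\<^sub>k \<xi>\<close> and \<open>D\<^sub>m \<xi>\<close> are both dominated by \<open>D\<^sub>m\<^sub>a\<^sub>x \<xi>\<close>, the ampliation with the
  larger index, since \<open>\<xi>\<close> is nonincreasing; iterated ampliations multiply their indices.
\<close>

lemma characteristic_set_principal:
  assumes "\<xi> \<in> c0_star"
  shows "characteristic_set {\<eta> \<in> c0_star. \<exists>m\<ge>1. big_O \<eta> (ampliation m \<xi>)}" (is "characteristic_set ?T")
proof -
  have nn: "0 \<le> ampliation m \<xi> n" for m n
    using assms by (simp add: ampliation_def c0_star_nonneg)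
  have "(\<lambda>n. 0) \<in> ?T"
    using nn by (auto simp: c0_star_zero intro!: exI[of _ 1] big_O_le)
  moreover have "(\<lambda>n. \<mu> n + \<nu> n) \<in> ?T" if mem: "\<mu> \<in> ?T" "\<nu> \<in> ?T" for \<mu> \<nu>
  proof -
    obtain k m where *: "k \<ge> 1" "m \<ge> 1" "big_O \<mu> (ampliation k \<xi>)" "big_O \<nu> (ampliation m \<xi>)"
      using mem by blast
    have "big_O (ampliation k \<xi>) (ampliation (max k m) \<xi>)" "big_O (ampliation m \<xi>) (ampliation (max k m) \<xi>)"
      using *(1,2) assms by (auto intro!: big_O_le ampliation_mono_index)
    then have "big_O (\<lambda>n. \<mu> n + \<nu> n) (ampliation (max k m) \<xi>)"
      using * nn by (blast intro: big_O_add big_O_trans)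
    then show ?thesis using mem c0_star_add *(1) by (auto intro!: exI[of _ "max k m"])
  qed
  moreover have "\<eta> \<in> ?T" if "\<mu> \<in> ?T" "\<eta> \<in> c0_star" "big_O \<eta> \<mu>" for \<mu> \<eta>
    using that big_O_trans c0_star_nonneg by blast
  moreover have "ampliation m \<mu> \<in> ?T" if mem: "\<mu> \<in> ?T" "m \<ge> 1" for \<mu> m
  proof -
    obtain k where *: "k \<ge> 1" "big_O \<mu> (ampliation k \<xi>)"
      using mem by blast
    have "big_O (ampliation m \<mu>) (ampliation (m * k) \<xi>)"
      using big_O_ampliation[OF *(2), of m] by (simp add: ampliation_ampliation)
    then show ?thesis using * mem ampliation_c0_star by (auto intro!: exI[of _ "m * k"])
  qed
  ultimately show ?thesis
    unfolding characteristic_set_def by (intro conjI ballI allI impI) auto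
qed

text \<open>
  The second arithmetic mean of an ideal can be described by the sequences of the ideal itself:
  a bound \<open>\<zeta> = O(\<eta>\<^sub>a)\<close> passes to the means, and conversely \<open>\<eta>\<^sub>a\<close> is itself an admissible \<open>\<zeta>\<close>.
\<close>

lemma am_am_set_eq:
  assumes "S \<subseteq> c0_star"
  shows "{\<xi> \<in> c0_star. \<exists>\<eta>\<in>{\<xi> \<in> c0_star. \<exists>\<eta>\<in>S. big_O \<xi> (am \<eta>)}. big_O \<xi> (am \<eta>)}
     = {\<xi> \<in> c0_star. \<exists>\<eta>\<in>S. big_O \<xi> (am (am \<eta>))}" (is "?L = ?R")
proof
  show "?L \<subseteq> ?R"
  proof
    fix \<xi> assume "\<xi> \<in> ?L"
    then obtain \<zeta> \<eta> where *: "\<xi> \<in> c0_star" "\<zeta> \<in> c0_star" "\<eta> \<in> S" "big_O \<zeta> (am \<eta>)" "big_O \<xi> (am \<zeta>)"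
      by blast
    have "big_O \<xi> (am (am \<eta>))"
      using big_O_trans[OF *(5) am_big_O[OF *(4)]] *(2) by (simp add: am_nonneg c0_star_nonneg)
    then show "\<xi> \<in> ?R" using * by blast
  qed
  show "?R \<subseteq> ?L"
  proof
    fix \<xi> assume "\<xi> \<in> ?R"
    then obtain \<eta> where *: "\<xi> \<in> c0_star" "\<eta> \<in> S" "big_O \<xi> (am (am \<eta>))"
      by blast
    moreover have "big_O (am \<eta>) (am \<eta>)" by (simp add: big_O_le)
    moreover have "am \<eta> \<in> c0_star" using * assms am_c0_star by blast
    ultimately show "\<xi> \<in> ?L" by blast
  qed
qed

section \<open>Cancelling one arithmetic mean\<close>

lemma am_pos:
  assumes "\<eta> \<in> c0_star" "\<eta> \<noteq> (\<lambda>n. 0)"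
  shows "0 < am \<eta> n"
proof -
  obtain k where "\<eta> k \<noteq> 0" using assms(2) by (auto simp: fun_eq_iff)
  then have "0 < \<eta> k" using c0_star_nonneg[OF assms(1), of k] by linarith
  also have "\<eta> k \<le> \<eta> 0" using assms(1) by (simp add: c0_star_antimono)
  also have "\<eta> 0 \<le> (\<Sum>j\<le>n. \<eta> j)"
    using assms(1) by (intro member_le_sum) (auto simp: c0_star_nonneg)
  finally show ?thesis by (simp add: am_def)
qed

text \<open>
  The harmonic series diverges in steps of size at most 1, so its sums starting after \<open>n\<close> cannot jump
  over an interval of length 1. The index \<open>m\<close> found here is of the order \<open>n e\<^sup>R\<close>.
\<close>

lemma harmonic_stopping_index:
  fixes R :: real
  assumes "R > 0"
  obtains m :: nat where "m > n" "R \<le> (\<Sum>j\<in>{n<..m}. 1 / real j)" "(\<Sum>j\<in>{n<..m}. 1 / real j) \<le> R + 1"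
proof -
  define H where "H m = (\<Sum>j\<in>{n<..m}. 1 / real j)" for m
  have H_Suc: "H (Suc m) = H m + 1 / real (Suc m)" if "m \<ge> n" for m
  proof -
    have "{n<..Suc m} = insert (Suc m) {n<..m}" using that by auto
    then show ?thesis by (simp add: H_def)
  qed
  have ex: "\<exists>m. R \<le> H m"
  proof (rule ccontr)
    assume "\<not> (\<exists>m. R \<le> H m)"
    then have b: "H m \<le> R" for m by (meson linear)
    have "summable (\<lambda>k. 1 / real (k + Suc n))"
    proof (rule bounded_imp_summable)
      show "0 \<le> 1 / real (k + Suc n)" for k by simp
      show "(\<Sum>k\<le>N. 1 / real (k + Suc n)) \<le> R" for N
      proof -
        have "(\<Sum>k\<le>N. 1 / real (k + Suc n)) = H (N + Suc n)"
          unfolding H_def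
          by (rule sum.reindex_bij_witness[of _ "\<lambda>j. j - Suc n" "\<lambda>k. k + Suc n"]) auto
        then show ?thesis using b by simp
      qed
    qed
    then have "summable (\<lambda>k. 1 / real k)" by (subst (asm) summable_iff_shift)
    then show False
      using not_summable_harmonic[where 'a = real] by (simp add: inverse_eq_divide)
  qed
  define m where "m = (LEAST m. R \<le> H m)"
  have m: "R \<le> H m" unfolding m_def using ex by (rule LeastI_ex)
  have "H k = 0" if "k \<le> n" for k using that by (simp add: H_def)
  then have "m > n" using m assms by (metis not_le)
  then have "H (m - 1) < R"
    unfolding m_def using not_less_Least[of "m - 1" "\<lambda>m. R \<le> H m"] m_def by fastforce
  moreover have "H m = H (m - 1) + 1 / real m"
    using H_Suc[of "m - 1"] \<open>m > n\<close> by simp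
  moreover have "1 / real m \<le> 1" using \<open>m > n\<close> by simp
  ultimately have "H m \<le> R + 1" by linarith
  with m \<open>m > n\<close> that show thesis unfolding H_def by blast
qed

text \<open>
  Let \<open>F k = (k + 1) \<eta>\<^sub>a\<^sub>a(k)\<close>, the sum of \<open>\<eta>\<^sub>a\<close> up to \<open>k\<close>. A ratio of at least \<open>K\<close> at \<open>k\<close> means
  \<open>\<eta>\<^sub>a(k) \<le> F k / ((k + 1) K)\<close>, and \<open>\<eta>\<^sub>a(k + 1)\<close> is no larger. Hence \<open>F\<close> is multiplied by at most
  \<open>1 + 1 / ((k + 1) K)\<close> in each step: the larger the ratio, the slower the growth, roughly like
  the power \<open>1 / K\<close> of the index.
\<close>

lemma am_am_growth_upper:
  assumes "\<eta> \<in> c0_star" "\<eta> \<noteq> (\<lambda>n. 0)" "0 < K"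
    and lb: "\<And>j. j \<ge> n \<Longrightarrow> K \<le> regularity_ratio (am \<eta>) j"
    and "m \<ge> n"
  shows "real (Suc m) * am (am \<eta>) m
    \<le> real (Suc n) * am (am \<eta>) n * exp ((\<Sum>j\<in>{n<..m}. 1 / real j) / K)"
  using \<open>m \<ge> n\<close>
proof (induction m rule: dec_induct)
  case base
  then show ?case by simp
next
  case (step m)
  define F where "F k = real (Suc k) * am (am \<eta>) k" for k
  have pos: "0 < am \<eta> k" for k using assms(1,2) by (rule am_pos)
  have "K * am \<eta> m \<le> am (am \<eta>) m"
    using lb[of m] step pos[of m] by (simp add: regularity_ratio_def field_simps)
  then have "real (Suc m) * (K * am \<eta> m) \<le> F m"
    unfolding F_def by (intro mult_left_mono) auto
  then have "am \<eta> m \<le> F m * (1 / real (Suc m) / K)"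
    using assms(3) by (simp add: field_simps del: of_nat_Suc)
  moreover have "am \<eta> (Suc m) \<le> am \<eta> m"
    using am_c0_star[OF assms(1)] by (simp add: c0_star_antimono)
  moreover have "F (Suc m) = F m + am \<eta> (Suc m)"
    unfolding F_def by (simp only: sum_eq_Suc_am[symmetric] sum.atMost_Suc)
  ultimately have "F (Suc m) \<le> F m * (1 + 1 / real (Suc m) / K)"
    by (simp add: distrib_left del: of_nat_Suc)
  also have "\<dots> \<le> F m * exp (1 / real (Suc m) / K)"
  proof (rule mult_left_mono)
    show "0 \<le> F m" unfolding F_def
      by (intro mult_nonneg_nonneg am_nonneg less_imp_le[OF pos]) simp
  qed (rule exp_ge_add_one_self)
  also have "\<dots> \<le> F n * exp ((\<Sum>j\<in>{n<..m}. 1 / real j) / K) * exp (1 / real (Suc m) / K)"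
    using step.IH unfolding F_def by (intro mult_right_mono) auto
  also have "\<dots> = F n * exp ((\<Sum>j\<in>{n<..Suc m}. 1 / real j) / K)"
  proof -
    have "{n<..Suc m} = insert (Suc m) {n<..m}" using step by auto
    then show ?thesis
      by (simp add: exp_add[symmetric] add_divide_distrib add.commute mult.assoc del: of_nat_Suc)
  qed
  finally show ?case unfolding F_def .
qed

text \<open>
  The products \<open>(j + 1) \<mu>\<^sub>a(j)\<close> are partial sums of \<open>\<mu>\<close>, hence nondecreasing. So \<open>\<mu>\<^sub>a\<close> decays no faster
  than \<open>1 / j\<close>, and its sums grow at least logarithmically. The factor \<open>1/2\<close> pays for replacing
  \<open>1 / (j + 1)\<close> by \<open>1 / j\<close>, which makes the harmonic sum the same as in the upper estimate.
\<close>

lemma am_am_growth_lower: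
  assumes "\<mu> \<in> c0_star" "m \<ge> n"
  shows "real (Suc n) * am \<mu> n * (1 + (\<Sum>j\<in>{n<..m}. 1 / real j)) / 2 \<le> real (Suc m) * am (am \<mu>) m"
proof -
  have nn: "0 \<le> am \<mu> k" for k using assms(1) by (simp add: am_nonneg c0_star_nonneg)
  define A where "A = real (Suc n) * am \<mu> n"
  have "A \<ge> 0" using nn by (simp add: A_def)
  have j: "A * (1 / real j) / 2 \<le> am \<mu> j" if "j \<in> {n<..m}" for j
  proof -
    have "A \<le> real (Suc j) * am \<mu> j"
      unfolding A_def sum_eq_Suc_am[symmetric] using that assms(1)
      by (intro sum_mono2) (auto simp: c0_star_nonneg)
    also have "\<dots> \<le> (2 * real j) * am \<mu> j"
      using that nn by (intro mult_right_mono) auto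
    finally show ?thesis using that by (simp add: field_simps)
  qed
  have A_le: "A \<le> (\<Sum>j\<le>n. am \<mu> j)"
    using am_ge_self[OF am_c0_star[OF assms(1)], of n] unfolding A_def sum_eq_Suc_am
    by (simp add: mult_left_mono del: of_nat_Suc)
  have "{..m} = {..n} \<union> {n<..m}" using assms(2) by auto
  then have "(\<Sum>j\<le>m. am \<mu> j) = (\<Sum>j\<le>n. am \<mu> j) + (\<Sum>j\<in>{n<..m}. am \<mu> j)"
    by (simp add: sum.union_disjoint Int_def)
  also have "\<dots> \<ge> A / 2 + (\<Sum>j\<in>{n<..m}. A * (1 / real j) / 2)"
    using A_le j \<open>A \<ge> 0\<close> by (intro add_mono sum_mono) auto
  also have "A / 2 + (\<Sum>j\<in>{n<..m}. A * (1 / real j) / 2) = A * (1 + (\<Sum>j\<in>{n<..m}. 1 / real j)) / 2"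
    by (simp add: sum_distrib_left sum_divide_distrib algebra_simps add_divide_distrib)
  finally show ?thesis by (simp add: A_def sum_eq_Suc_am del: of_nat_Suc)
qed

lemma regularity_ratio_ge_1:
  assumes "\<eta> \<in> c0_star" "\<eta> \<noteq> (\<lambda>n. 0)"
  shows "1 \<le> regularity_ratio (am \<eta>) n"
  using am_pos[OF assms, of n] am_ge_self[OF am_c0_star[OF assms(1)], of n]
  by (simp add: regularity_ratio_def)

text \<open>
  Write \<open>r\<close> for the ratio \<open>\<eta>\<^sub>a\<^sub>a / \<eta>\<^sub>a\<close>.
  
  If \<open>r\<close> is equivalent to a nonincreasing sequence, it is bounded, so \<open>\<mu>\<^sub>a \<le> \<mu>\<^sub>a\<^sub>a = O(\<eta>\<^sub>a\<^sub>a) = O(\<eta>\<^sub>a)\<close>.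
  
  If \<open>r\<close> is equivalent to a nondecreasing sequence, then \<open>r j \<ge> \<kappa> r n\<close> for all \<open>j \<ge> n\<close>, with one
  constant \<open>\<kappa> > 0\<close>. Fix \<open>n\<close>, put \<open>R = r n\<close>, and let \<open>m\<close> be so far out that the harmonic sum between
  \<open>n\<close> and \<open>m\<close> is about \<open>R\<close>. Up to \<open>m\<close> the sums of \<open>\<eta>\<^sub>a\<close> grow at most by the factor \<open>exp (2 / \<kappa>)\<close>
  from their value \<open>(n + 1) R \<eta>\<^sub>a(n)\<close> at \<open>n\<close>, whereas the sum of \<open>\<mu>\<^sub>a\<close> reaches at least
  \<open>(n + 1) \<mu>\<^sub>a(n) R / 2\<close>. The hypothesis compares the two sums at \<open>m\<close>, and \<open>R\<close> cancels.
\<close>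

lemma first_order_cancellation:
  assumes \<eta>: "\<eta> \<in> c0_star" "\<eta> \<noteq> (\<lambda>n. 0)" and \<mu>: "\<mu> \<in> c0_star"
    and ratio: "equiv_to_monotone (regularity_ratio (am \<eta>))"
    and O: "big_O (am (am \<mu>)) (am (am \<eta>))"
  shows "big_O (am \<mu>) (am \<eta>)"
proof -
  define r where "r = regularity_ratio (am \<eta>)"
  have pos: "0 < am \<eta> n" for n using \<eta> by (rule am_pos)
  have am2: "am (am \<eta>) n = r n * am \<eta> n" for n
    using pos[of n] by (simp add: r_def regularity_ratio_def)
  have r1: "1 \<le> r n" for n using regularity_ratio_ge_1[OF \<eta>] by (simp add: r_def)
  obtain C where C: "0 < C" "\<And>n. am (am \<mu>) n \<le> C * am (am \<eta>) n"
    using big_OE_pos[OF O am_nonneg[OF less_imp_le[OF pos]]] by blast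
  obtain \<phi> \<alpha> \<beta> where \<phi>: "\<And>n. 0 < \<phi> n" "monoseq \<phi>" and \<alpha>\<beta>: "0 < \<alpha>" "0 < \<beta>"
    "\<And>n. \<alpha> * \<phi> n \<le> r n" "\<And>n. r n \<le> \<beta> * \<phi> n"
    using ratio unfolding equiv_to_monotone_def seq_equiv_def r_def by blast
  from \<phi>(2) consider "decseq \<phi>" | "incseq \<phi>" by (auto simp: monoseq_iff)
  then show ?thesis
  proof cases
    case 1
    have "am \<mu> n \<le> (C * (\<beta> * \<phi> 0)) * am \<eta> n" for n
    proof -
      have "\<phi> n \<le> \<phi> 0" using 1 by (simp add: decseq_def)
      then have "\<beta> * \<phi> n \<le> \<beta> * \<phi> 0" using \<alpha>\<beta>(2) by simp
      then have "r n \<le> \<beta> * \<phi> 0" using \<alpha>\<beta>(4)[of n] by linarith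
      then have "C * (r n * am \<eta> n) \<le> C * (\<beta> * \<phi> 0 * am \<eta> n)"
        using C(1) pos[of n] by (intro mult_left_mono mult_right_mono) auto
      moreover have "am \<mu> n \<le> C * (r n * am \<eta> n)"
        using am_ge_self[OF am_c0_star[OF \<mu>], of n] C(2)[of n] by (simp add: am2)
      ultimately show ?thesis by (simp add: mult_ac)
    qed
    then show ?thesis unfolding big_O_def by blast
  next
    case 2
    define \<kappa> where "\<kappa> = \<alpha> / \<beta>"
    have \<kappa>: "\<kappa> > 0" using \<alpha>\<beta> by (simp add: \<kappa>_def)
    have "am \<mu> n \<le> (2 * C * exp (2 / \<kappa>)) * am \<eta> n" for n
    proof -
      define R where "R = r n"
      have R: "1 \<le> R" using r1 by (simp add: R_def)
      have lb: "\<kappa> * R \<le> r j" if "j \<ge> n" for j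
      proof -
        have "\<kappa> * R \<le> \<kappa> * (\<beta> * \<phi> n)"
          using \<alpha>\<beta>(4) \<kappa> unfolding R_def by (intro mult_left_mono) auto
        also have "\<dots> = \<alpha> * \<phi> n" using \<alpha>\<beta> by (simp add: \<kappa>_def)
        also have "\<dots> \<le> \<alpha> * \<phi> j" using 2 that \<alpha>\<beta> by (simp add: incseq_def)
        also have "\<dots> \<le> r j" by (rule \<alpha>\<beta>)
        finally show ?thesis .
      qed
      obtain m where m: "m > n" "R \<le> (\<Sum>j\<in>{n<..m}. 1 / real j)" "(\<Sum>j\<in>{n<..m}. 1 / real j) \<le> R + 1"
        using harmonic_stopping_index[of R n] R by auto
      define H where "H = (\<Sum>j\<in>{n<..m}. 1 / real j)"
      define N where "N = real (Suc n)"
      have "N > 0" by (simp add: N_def)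
      \<comment> \<open>The ratio is at least 1, so the excess of the harmonic sum over \<open>R\<close> is at most \<open>R\<close>.\<close>
      have "H / (\<kappa> * R) \<le> 2 / \<kappa>"
        using m(3) R \<kappa> unfolding H_def[symmetric] by (simp add: field_simps)
      have "N * am \<mu> n * R / 2 \<le> N * am \<mu> n * (1 + H) / 2"
        using m(2) \<mu> \<open>N > 0\<close> unfolding H_def[symmetric]
        by (intro divide_right_mono mult_left_mono) (auto simp: am_nonneg c0_star_nonneg)
      also have "\<dots> \<le> real (Suc m) * am (am \<mu>) m"
        using am_am_growth_lower[OF \<mu>, of n m] m(1) by (simp add: H_def N_def)
      also have "\<dots> \<le> C * (real (Suc m) * am (am \<eta>) m)"
        using mult_left_mono[OF C(2)[of m], of "real (Suc m)"] by (simp add: mult_ac del: of_nat_Suc)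
      also have "\<dots> \<le> C * (N * am (am \<eta>) n * exp (H / (\<kappa> * R)))"
        unfolding H_def N_def using am_am_growth_upper[OF \<eta>, of "\<kappa> * R" n m] lb m(1) \<kappa> R C(1)
        by (intro mult_left_mono) (auto simp: r_def)
      also have "\<dots> \<le> C * (N * am (am \<eta>) n * exp (2 / \<kappa>))"
        using \<open>H / (\<kappa> * R) \<le> 2 / \<kappa>\<close> \<open>N > 0\<close> C(1) \<eta>(1)
        by (intro mult_left_mono) (auto simp: am_nonneg c0_star_nonneg)
      also have "\<dots> = N * R * (C * exp (2 / \<kappa>) * am \<eta> n)"
        by (simp add: am2 R_def)
      finally have "N * R * (am \<mu> n / 2) \<le> N * R * (C * exp (2 / \<kappa>) * am \<eta> n)"
        by (simp add: mult_ac)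
      then have "am \<mu> n / 2 \<le> C * exp (2 / \<kappa>) * am \<eta> n"
        using R \<open>N > 0\<close> by simp
      then show ?thesis by simp
    qed
    then show ?thesis unfolding big_O_def by blast
  qed
qed

section \<open>Complex inner products and orthogonal systems\<close>

instance complex_hilbert \<subseteq> banach ..

lemma cinner_zero_left [simp]: "cinner 0 (y::'h::complex_hilbert) = 0"
  using cinner_add_left[of 0 0 y] by simp

lemma cinner_zero_right [simp]: "cinner (y::'h::complex_hilbert) 0 = 0"
  using cinner_commute[of y 0] by simp

lemma cinner_add_right: "cinner (x::'h::complex_hilbert) (y + z) = cinner x y + cinner x z"
  by (metis cinner_add_left cinner_commute complex_cnj_add)

lemma cinner_scaleC_right: "cinner (x::'h::complex_hilbert) (a *\<^sub>C y) = cnj a * cinner x y"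
  by (metis cinner_commute cinner_scaleC_left complex_cnj_mult)

lemma cinner_self: "cinner (x::'h::complex_hilbert) x = complex_of_real ((norm x)\<^sup>2)"
proof (rule complex_eqI)
  show "Re (cinner x x) = Re (complex_of_real ((norm x)\<^sup>2))"
    by (simp add: Re_cinner power2_norm_eq_inner)
  show "Im (cinner x x) = Im (complex_of_real ((norm x)\<^sup>2))"
    using arg_cong[OF cinner_commute[of x x], of Im] by simp
qed

lemma norm_scaleC: "norm (a *\<^sub>C (x::'h::complex_hilbert)) = norm a * norm x"
proof -
  have "complex_of_real ((norm (a *\<^sub>C x))\<^sup>2) = a * cnj a * complex_of_real ((norm x)\<^sup>2)"
    by (simp only: cinner_self[symmetric] cinner_scaleC_left cinner_scaleC_right mult_ac)
  also have "\<dots> = complex_of_real ((norm a * norm x)\<^sup>2)"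
    by (simp add: complex_norm_square[symmetric] power_mult_distrib)
  finally have "(norm (a *\<^sub>C x))\<^sup>2 = (norm a * norm x)\<^sup>2"
    by (simp only: of_real_eq_iff)
  then show ?thesis by simp
qed

text \<open>
  Multiplying \<open>x\<close> by a unimodular \<open>c\<close> makes the complex inner product real and nonnegative, so that it
  becomes a real inner product.
\<close>

lemma Cauchy_Schwarz_cinner: "norm (cinner (x::'h::complex_hilbert) y) \<le> norm x * norm y"
proof (cases "cinner x y = 0")
  case False
  define c where "c = cnj (sgn (cinner x y))"
  have "norm c = 1" using False by (simp add: c_def norm_sgn)
  have "c * cinner x y = complex_of_real (norm (cinner x y))"
    using False complex_norm_square[of "cinner x y"]
    by (simp add: c_def sgn_div_norm scaleR_conv_of_real field_simps power2_eq_square)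
  then have "norm (cinner x y) = Re (cinner (c *\<^sub>C x) y)"
    by (simp add: cinner_scaleC_left)
  also have "\<dots> \<le> norm (c *\<^sub>C x) * norm y"
    by (simp add: Re_cinner norm_cauchy_schwarz)
  finally show ?thesis by (simp add: norm_scaleC \<open>norm c = 1\<close>)
qed simp

lemma cinner_scaleR_left: "cinner (r *\<^sub>R (x::'h::complex_hilbert)) y = r *\<^sub>R cinner x y"
  by (simp add: cinner_scaleC_left scaleR_conv_of_real flip: scaleC_of_real)

lemma cinner_scaleR_right: "cinner (x::'h::complex_hilbert) (r *\<^sub>R y) = r *\<^sub>R cinner x y"
  by (simp add: cinner_scaleC_right scaleR_conv_of_real flip: scaleC_of_real)

lemma bounded_bilinear_cinner: "bounded_bilinear (cinner :: 'h::complex_hilbert \<Rightarrow> 'h \<Rightarrow> complex)"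
  by (rule bounded_bilinear.intro)
    (auto simp: cinner_add_left cinner_add_right cinner_scaleR_left cinner_scaleR_right
      intro!: exI[of _ 1] Cauchy_Schwarz_cinner)

lemmas cinner_diff_left = bounded_bilinear.diff_left[OF bounded_bilinear_cinner]
lemmas cinner_diff_right = bounded_bilinear.diff_right[OF bounded_bilinear_cinner]
lemmas cinner_sum_left = bounded_bilinear.sum_left[OF bounded_bilinear_cinner]
lemmas cinner_sum_right = bounded_bilinear.sum_right[OF bounded_bilinear_cinner]
lemmas bounded_linear_cinner_left = bounded_bilinear.bounded_linear_left[OF bounded_bilinear_cinner]
lemmas bounded_linear_cinner_right = bounded_bilinear.bounded_linear_right[OF bounded_bilinear_cinner]

lemma bounded_linear_scaleC: "bounded_linear ((*\<^sub>C) a :: 'h::complex_hilbert \<Rightarrow> 'h)"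
proof (rule bounded_linear_intro)
  show "a *\<^sub>C (r *\<^sub>R x) = r *\<^sub>R (a *\<^sub>C x)" for r and x :: 'h
    by (simp add: scaleC_scaleC mult.commute flip: scaleC_of_real)
  show "norm (a *\<^sub>C x) \<le> norm x * norm a" for x :: 'h by (simp add: norm_scaleC)
qed (rule scaleC_add_right)

lemma cinner_ext:
  assumes "\<And>w. cinner w (x::'h::complex_hilbert) = cinner w y"
  shows "x = y"
proof -
  have "cinner (x - y) (x - y) = 0" using assms by (simp add: cinner_diff_right)
  then show ?thesis by (simp add: cinner_self)
qed

lemma cinner_eq_0_commute: "cinner (x::'h::complex_hilbert) y = 0 \<longleftrightarrow> cinner y x = 0"
  by (metis cinner_commute complex_cnj_zero)

text \<open>
  Vectors shorter than 1 are admitted so that a left singular vector belonging to the singular value 0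
  may be the zero vector; for operators of finite rank there are infinitely many of these.
\<close>

definition contractive_orthogonal :: "('i \<Rightarrow> 'h::complex_hilbert) \<Rightarrow> bool" where
  "contractive_orthogonal u \<longleftrightarrow> (\<forall>i j. i \<noteq> j \<longrightarrow> cinner (u i) (u j) = 0) \<and> (\<forall>i. norm (u i) \<le> 1)"

definition orthonormal :: "('i \<Rightarrow> 'h::complex_hilbert) \<Rightarrow> bool" where
  "orthonormal u \<longleftrightarrow> (\<forall>i j. cinner (u i) (u j) = (if i = j then 1 else 0))"

lemma orthonormal_norm: "orthonormal u \<Longrightarrow> norm (u i) = 1"
proof -
  assume "orthonormal u"
  then have "complex_of_real ((norm (u i))\<^sup>2) = 1"
    by (simp only: cinner_self[symmetric]) (simp add: orthonormal_def)
  then have "(norm (u i))\<^sup>2 = 1" using of_real_eq_1_iff by blast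
  then show ?thesis using norm_ge_zero[of "u i"] by (simp add: power2_eq_1_iff)
qed

lemma orthonormal_contractive: "orthonormal u \<Longrightarrow> contractive_orthogonal u"
  by (simp add: contractive_orthogonal_def orthonormal_norm) (simp add: orthonormal_def)

lemma orthonormal_compose: "orthonormal u \<Longrightarrow> inj f \<Longrightarrow> orthonormal (\<lambda>i. u (f i))"
  by (simp add: orthonormal_def inj_eq)

lemma norm_sum_orthogonal:
  assumes "contractive_orthogonal u" "finite A"
  shows "(norm (\<Sum>i\<in>A. c i *\<^sub>C u i))\<^sup>2 = (\<Sum>i\<in>A. (norm (c i))\<^sup>2 * (norm (u i))\<^sup>2)"
proof -
  have "pairwise (\<lambda>i j. orthogonal (c i *\<^sub>C u i) (c j *\<^sub>C u j)) A"
    using assms(1)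
    by (auto simp: pairwise_def orthogonal_def contractive_orthogonal_def cinner_scaleC_left cinner_scaleC_right
      simp flip: Re_cinner)
  then show ?thesis
    using norm_sum_Pythagorean[OF assms(2), of "\<lambda>i. c i *\<^sub>C u i"]
    by (simp add: norm_scaleC power_mult_distrib)
qed

lemma norm_sum_orthogonal_le:
  assumes "contractive_orthogonal u" "finite A"
  shows "(norm (\<Sum>i\<in>A. c i *\<^sub>C u i))\<^sup>2 \<le> (\<Sum>i\<in>A. (norm (c i))\<^sup>2)"
proof -
  have "(norm (c i))\<^sup>2 * (norm (u i))\<^sup>2 \<le> (norm (c i))\<^sup>2" for i
    using assms(1) by (intro mult_left_le power_le_one) (auto simp: contractive_orthogonal_def)
  then show ?thesis
    unfolding norm_sum_orthogonal[OF assms] by (rule sum_mono)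
qed

lemma le_square_of_le_mult_sqrt:
  fixes S a :: real
  assumes "S \<le> a * sqrt S" "0 \<le> S" "0 \<le> a"
  shows "S \<le> a\<^sup>2"
proof (cases "S = 0")
  case False
  then have "sqrt S > 0" using assms by simp
  moreover have "sqrt S * sqrt S \<le> a * sqrt S" using assms by simp
  ultimately have "sqrt S \<le> a" by (rule mult_right_le_imp_le[rotated])
  then show ?thesis using assms(2,3) by (metis real_sqrt_pow2 power_mono real_sqrt_ge_zero)
qed simp

text \<open>
  Let \<open>p = \<Sum>\<langle>x, u\<^sub>i\<rangle> u\<^sub>i\<close> and let \<open>S\<close> be the left-hand side. Then \<open>\<langle>x, p\<rangle> = S\<close> and \<open>\<parallel>p\<parallel>\<^sup>2 \<le> S\<close>, so
  the Cauchy-Schwarz inequality gives \<open>S \<le> \<parallel>x\<parallel> sqrt S\<close>.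
\<close>

lemma Bessel_finite:
  assumes "contractive_orthogonal u" "finite A"
  shows "(\<Sum>i\<in>A. (norm (cinner x (u i)))\<^sup>2) \<le> (norm x)\<^sup>2" (is "?S \<le> _")
proof (rule le_square_of_le_mult_sqrt)
  define p where "p = (\<Sum>i\<in>A. cinner x (u i) *\<^sub>C u i)"
  have "norm p \<le> sqrt ?S"
    using norm_sum_orthogonal_le[OF assms, of "\<lambda>i. cinner x (u i)"] by (intro real_le_rsqrt) (simp add: p_def)
  have "cinner x p = complex_of_real ?S"
    by (simp add: p_def cinner_sum_right cinner_scaleC_right mult.commute flip: complex_norm_square)
  moreover have "0 \<le> ?S" by (simp add: sum_nonneg)
  ultimately have "?S = norm (cinner x p)" by (simp only: norm_of_real abs_of_nonneg)
  also have "\<dots> \<le> norm x * norm p" by (rule Cauchy_Schwarz_cinner)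
  also have "\<dots> \<le> norm x * sqrt ?S" using \<open>norm p \<le> sqrt ?S\<close> by (intro mult_left_mono) auto
  finally show "?S \<le> norm x * sqrt ?S" .
qed (auto simp: sum_nonneg)

lemma Bessel:
  fixes u :: "nat \<Rightarrow> 'h::complex_hilbert"
  assumes "contractive_orthogonal u"
  shows "summable (\<lambda>n. (norm (cinner x (u n)))\<^sup>2)"
    and "(\<Sum>n. (norm (cinner x (u n)))\<^sup>2) \<le> (norm x)\<^sup>2"
proof -
  show 1: "summable (\<lambda>n. (norm (cinner x (u n)))\<^sup>2)"
    by (rule bounded_imp_summable[where B = "(norm x)\<^sup>2"]) (auto intro: Bessel_finite assms)
  show "(\<Sum>n. (norm (cinner x (u n)))\<^sup>2) \<le> (norm x)\<^sup>2"
    by (rule suminf_le_const[OF 1]) (auto intro: Bessel_finite assms)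
qed

text \<open>
  By orthogonality the squared norm of a block of the vector series is at most the same block of the
  numerical series; completeness does the rest.
\<close>

lemma Riesz_Fischer:
  fixes u :: "nat \<Rightarrow> 'h::complex_hilbert"
  assumes "contractive_orthogonal u" "summable (\<lambda>n. (norm (c n))\<^sup>2)"
  shows "summable (\<lambda>n. c n *\<^sub>C u n)"
    and "(norm (\<Sum>n. c n *\<^sub>C u n))\<^sup>2 \<le> (\<Sum>n. (norm (c n))\<^sup>2)"
proof -
  show 1: "summable (\<lambda>n. c n *\<^sub>C u n)"
    unfolding summable_Cauchy
  proof (intro allI impI)
    fix e :: real assume "e > 0"
    then have "e\<^sup>2 > 0" by simp
    then obtain N where N: "\<And>m n. m \<ge> N \<Longrightarrow> norm (\<Sum>i\<in>{m..<n}. (norm (c i))\<^sup>2) < e\<^sup>2"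
      using assms(2) unfolding summable_Cauchy by blast
    have "norm (\<Sum>i\<in>{m..<n}. c i *\<^sub>C u i) < e" if "m \<ge> N" for m n
    proof (rule power2_less_imp_less)
      show "(norm (\<Sum>i\<in>{m..<n}. c i *\<^sub>C u i))\<^sup>2 < e\<^sup>2"
        using norm_sum_orthogonal_le[OF assms(1), of "{m..<n}" c] N[OF that, of n] by simp
    qed (use \<open>e > 0\<close> in simp)
    then show "\<exists>N. \<forall>m\<ge>N. \<forall>n. norm (\<Sum>i\<in>{m..<n}. c i *\<^sub>C u i) < e" by blast
  qed
  have "(\<lambda>n. (norm (\<Sum>i<n. c i *\<^sub>C u i))\<^sup>2) \<longlonglongrightarrow> (norm (\<Sum>n. c n *\<^sub>C u n))\<^sup>2"
    by (intro tendsto_intros summable_LIMSEQ 1)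
  then show "(norm (\<Sum>n. c n *\<^sub>C u n))\<^sup>2 \<le> (\<Sum>n. (norm (c n))\<^sup>2)"
  proof (rule LIMSEQ_le_const2, intro exI allI impI)
    fix n
    have "(norm (\<Sum>i<n. c i *\<^sub>C u i))\<^sup>2 \<le> (\<Sum>i<n. (norm (c i))\<^sup>2)"
      by (rule norm_sum_orthogonal_le[OF assms(1)]) simp
    also have "\<dots> \<le> (\<Sum>n. (norm (c n))\<^sup>2)"
      by (rule sum_le_suminf[OF assms(2)]) auto
    finally show "(norm (\<Sum>i<n. c i *\<^sub>C u i))\<^sup>2 \<le> (\<Sum>n. (norm (c n))\<^sup>2)" .
  qed
qed

section \<open>Operators given by two orthogonal systems\<close>

text \<open>
  The operator \<open>\<Sum>\<^sub>n s\<^sub>n \<langle>\<cdot>, v\<^sub>n\<rangle> u\<^sub>n\<close>. Singular value decompositions, diagonal operators with respect to a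
  basis (\<open>v = u\<close>) and partial isometries between two orthonormal systems (\<open>s = 1\<close>) are all of
  this form, so that one rule for compositions and one for adjoints serves all of them.
\<close>

definition diag_op :: "(nat \<Rightarrow> real) \<Rightarrow> (nat \<Rightarrow> 'h) \<Rightarrow> (nat \<Rightarrow> 'h) \<Rightarrow> 'h \<Rightarrow> 'h::complex_hilbert" where
  "diag_op s v u x = (\<Sum>n. (complex_of_real (s n) * cinner x (v n)) *\<^sub>C u n)"

lemma summable_diag_op_coeff:
  fixes v :: "nat \<Rightarrow> 'h::complex_hilbert"
  assumes "Bseq s" "contractive_orthogonal v"
  shows "summable (\<lambda>n. (norm (complex_of_real (s n) * cinner x (v n)))\<^sup>2)"
proof -
  obtain K where K: "\<And>n. \<bar>s n\<bar> \<le> K" using assms(1) by (auto simp: Bseq_def)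
  show ?thesis
  proof (rule summable_comparison_test[OF _ summable_mult[OF Bessel(1)[OF assms(2)]]], intro exI allI impI)
    show "norm ((norm (complex_of_real (s n) * cinner x (v n)))\<^sup>2) \<le> K\<^sup>2 * (norm (cinner x (v n)))\<^sup>2" for n
      using K[of n] by (auto simp: norm_mult power_mult_distrib intro!: mult_right_mono)
        (metis abs_ge_zero power2_abs power_mono)
  qed
qed

lemma diag_op_sums:
  fixes v :: "nat \<Rightarrow> 'h::complex_hilbert"
  assumes "Bseq s" "contractive_orthogonal v" "contractive_orthogonal u"
  shows "(\<lambda>n. (complex_of_real (s n) * cinner x (v n)) *\<^sub>C u n) sums diag_op s v u x"
  unfolding diag_op_def
  by (intro summable_sums Riesz_Fischer assms summable_diag_op_coeff)

text \<open>
  The multiplier has to be bounded by \<open>C\<close> only where \<open>x\<close> has a component. Thus the lemma covers the norm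
  of the operator and also its norm on the annihilator of some of the vectors \<open>v\<^sub>n\<close>.
\<close>

lemma norm_diag_op_le:
  fixes v :: "nat \<Rightarrow> 'h::complex_hilbert"
  assumes "Bseq s" "contractive_orthogonal v" "contractive_orthogonal u" "0 \<le> C"
    and "\<And>n. \<bar>s n\<bar> \<le> C \<or> cinner x (v n) = 0"
  shows "norm (diag_op s v u x) \<le> C * norm x"
proof (rule power2_le_imp_le)
  have "(norm (diag_op s v u x))\<^sup>2 \<le> (\<Sum>n. (norm (complex_of_real (s n) * cinner x (v n)))\<^sup>2)"
    unfolding diag_op_def by (intro Riesz_Fischer assms summable_diag_op_coeff)
  also have "\<dots> \<le> (\<Sum>n. C\<^sup>2 * (norm (cinner x (v n)))\<^sup>2)"
  proof (rule suminf_le)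
    show "(norm (complex_of_real (s n) * cinner x (v n)))\<^sup>2 \<le> C\<^sup>2 * (norm (cinner x (v n)))\<^sup>2" for n
    proof (cases "cinner x (v n) = 0")
      case False
      then have "(s n)\<^sup>2 \<le> C\<^sup>2" using assms(5)[of n] by (metis abs_ge_zero power2_abs power_mono)
      then show ?thesis by (simp add: norm_mult power_mult_distrib mult_right_mono)
    qed simp
  qed (intro summable_diag_op_coeff summable_mult Bessel assms)+
  also have "\<dots> = C\<^sup>2 * (\<Sum>n. (norm (cinner x (v n)))\<^sup>2)"
    by (intro suminf_mult Bessel assms)
  also have "\<dots> \<le> C\<^sup>2 * (norm x)\<^sup>2"
    by (intro mult_left_mono Bessel assms) auto
  finally show "(norm (diag_op s v u x))\<^sup>2 \<le> (C * norm x)\<^sup>2" by (simp add: power_mult_distrib)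
qed (use assms in auto)

lemma bounded_operatorsD:
  assumes "X \<in> bounded_operators"
  shows "bounded_linear X" "X (c *\<^sub>C v) = c *\<^sub>C X v"
  using assms by (auto simp: bounded_operators_def)

lemma bounded_operatorsI:
  fixes X :: "'h::complex_hilbert \<Rightarrow> 'h"
  assumes "\<And>x y. X (x + y) = X x + X y" "\<And>c x. X (c *\<^sub>C x) = c *\<^sub>C X x" "\<And>x. norm (X x) \<le> C * norm x"
  shows "X \<in> bounded_operators"
proof -
  have "bounded_linear X"
  proof (rule bounded_linear_intro[where K = C])
    show "X (r *\<^sub>R x) = r *\<^sub>R X x" for r x
      using assms(2) by (simp flip: scaleC_of_real)
  qed (use assms in \<open>auto simp: mult.commute\<close>)
  then show ?thesis using assms(2) by (simp add: bounded_operators_def)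
qed

lemma bounded_operators_norm:
  assumes "X \<in> bounded_operators"
  obtains K where "0 < K" "\<And>x. norm (X x) \<le> K * norm x"
  using bounded_linear.pos_bounded[OF bounded_operatorsD(1)[OF assms]] by (metis mult.commute)

lemma bounded_operators_comp: "X \<in> bounded_operators \<Longrightarrow> Y \<in> bounded_operators \<Longrightarrow> X \<circ> Y \<in> bounded_operators"
  by (auto simp: bounded_operators_def o_def intro: bounded_linear_compose)

lemma bounded_operators_add:
  "X \<in> bounded_operators \<Longrightarrow> Y \<in> bounded_operators \<Longrightarrow> (\<lambda>v. X v + Y v) \<in> bounded_operators"
  by (auto simp: bounded_operators_def scaleC_add_right intro: bounded_linear_add)

lemma bounded_operators_id: "id \<in> bounded_operators"
  by (auto simp: bounded_operators_def id_def bounded_linear_ident)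

lemma bounded_operators_zero: "(\<lambda>v. 0) \<in> bounded_operators"
  by (auto simp: bounded_operators_def)

lemma bounded_operators_uminus:
  "X \<in> bounded_operators \<Longrightarrow> (\<lambda>v. - X v) \<in> bounded_operators"
  by (auto simp: bounded_operators_def intro: bounded_linear_minus)

lemma diag_op_bounded_operators:
  fixes v :: "nat \<Rightarrow> 'h::complex_hilbert"
  assumes "Bseq s" "contractive_orthogonal v" "contractive_orthogonal u"
  shows "diag_op s v u \<in> bounded_operators"
proof -
  note sums = diag_op_sums[OF assms]
  obtain K where K: "\<And>n. \<bar>s n\<bar> \<le> K" "0 < K" using assms(1) by (auto simp: Bseq_def)
  show ?thesis
  proof (rule bounded_operatorsI)
    show "diag_op s v u (x + y) = diag_op s v u x + diag_op s v u y" for x y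
      using sums_unique2[OF sums[of "x + y"]] sums_add[OF sums[of x] sums[of y]]
      by (simp add: cinner_add_left distrib_left scaleC_add_left)
    show "diag_op s v u (c *\<^sub>C x) = c *\<^sub>C diag_op s v u x" for c x
      using sums_unique2[OF sums[of "c *\<^sub>C x"]] bounded_linear.sums[OF bounded_linear_scaleC sums[of x], of c]
      by (simp add: cinner_scaleC_left scaleC_scaleC mult_ac)
    show "norm (diag_op s v u x) \<le> K * norm x" for x
      using K by (intro norm_diag_op_le assms) auto
  qed
qed

lemma cinner_diag_op_sums:
  fixes v :: "nat \<Rightarrow> 'h::complex_hilbert"
  assumes "Bseq s" "contractive_orthogonal v" "contractive_orthogonal u"
  shows "(\<lambda>n. complex_of_real (s n) * cinner x (v n) * cinner (u n) y) sums cinner (diag_op s v u x) y"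
  using bounded_linear.sums[OF bounded_linear_cinner_left diag_op_sums[OF assms, of x], of y]
  by (simp add: cinner_scaleC_left)

lemma diag_op_adjoint:
  fixes v :: "nat \<Rightarrow> 'h::complex_hilbert"
  assumes "Bseq s" "contractive_orthogonal v" "contractive_orthogonal u"
  shows "cinner (diag_op s v u x) y = cinner x (diag_op s u v y)"
proof -
  have "(\<lambda>n. cnj (complex_of_real (s n) * cinner y (u n) * cinner (v n) x)) sums cnj (cinner (diag_op s u v y) x)"
    by (intro iffD2[OF sums_cnj] cinner_diag_op_sums assms)
  moreover have "cnj (complex_of_real (s n) * cinner y (u n) * cinner (v n) x)
      = complex_of_real (s n) * cinner x (v n) * cinner (u n) y" for n
    by (simp add: cinner_commute[of x "v n"] cinner_commute[of "u n" y])
  ultimately have "(\<lambda>n. complex_of_real (s n) * cinner x (v n) * cinner (u n) y) sums cnj (cinner (diag_op s u v y) x)"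
    by (simp only:)
  then have "cinner (diag_op s v u x) y = cnj (cinner (diag_op s u v y) x)"
    by (rule sums_unique2[OF cinner_diag_op_sums[OF assms]])
  then show ?thesis by (simp flip: cinner_commute)
qed

lemma cinner_diag_op_component:
  fixes v :: "nat \<Rightarrow> 'h::complex_hilbert"
  assumes "Bseq s" "contractive_orthogonal v" "contractive_orthogonal u"
  shows "cinner (diag_op s v u x) (u m) = complex_of_real (s m) * cinner x (v m) * complex_of_real ((norm (u m))\<^sup>2)"
proof -
  have "complex_of_real (s n) * cinner x (v n) * cinner (u n) (u m)
    = (if n = m then complex_of_real (s n) * cinner x (v n) * complex_of_real ((norm (u n))\<^sup>2) else 0)" for n
    using assms(3) by (auto simp: contractive_orthogonal_def cinner_self)
  then have "(\<lambda>n. complex_of_real (s n) * cinner x (v n) * cinner (u n) (u m)) sums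
      (complex_of_real (s m) * cinner x (v m) * complex_of_real ((norm (u m))\<^sup>2))"
    using sums_single[of m "\<lambda>n. complex_of_real (s n) * cinner x (v n) * complex_of_real ((norm (u n))\<^sup>2)"]
    by (simp only:)
  then show ?thesis using sums_unique2 cinner_diag_op_sums[OF assms] by blast
qed

text \<open>
  The coefficient of the inner operator along \<open>u\<^sub>n\<close> is \<open>s\<^sub>n \<langle>x, v\<^sub>n\<rangle> \<parallel>u\<^sub>n\<parallel>\<^sup>2\<close>, so \<open>u\<^sub>n\<close> has to be a unit vector
  only for indices that survive in the product.
\<close>

lemma diag_op_comp:
  fixes v :: "nat \<Rightarrow> 'h::complex_hilbert"
  assumes "Bseq s" "contractive_orthogonal v" "contractive_orthogonal u"
    and "\<And>n. t n * s n \<noteq> 0 \<Longrightarrow> norm (u n) = 1"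
  shows "diag_op t u w (diag_op s v u x) = diag_op (\<lambda>n. t n * s n) v w x"
proof -
  have "complex_of_real (t n) * cinner (diag_op s v u x) (u n) = complex_of_real (t n * s n) * cinner x (v n)" for n
    unfolding cinner_diag_op_component[OF assms(1-3)] using assms(4)[of n]
    by (cases "t n * s n = 0") auto
  then show ?thesis by (simp only: diag_op_def[of t] diag_op_def[of "\<lambda>n. t n * s n"])
qed

lemma diag_op_add:
  fixes v :: "nat \<Rightarrow> 'h::complex_hilbert"
  assumes "Bseq s" "Bseq t" "contractive_orthogonal v" "contractive_orthogonal u"
  shows "diag_op (\<lambda>n. s n + t n) v u x = diag_op s v u x + diag_op t v u x"
proof -
  have "(\<lambda>n. (complex_of_real (s n + t n) * cinner x (v n)) *\<^sub>C u n) sums (diag_op s v u x + diag_op t v u x)"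
    using sums_add[OF diag_op_sums[OF assms(1,3,4)] diag_op_sums[OF assms(2,3,4)], of x x]
    by (simp add: scaleC_add_left distrib_right)
  then show ?thesis unfolding diag_op_def by (rule sums_unique[symmetric])
qed

section \<open>Orthonormal bases and adjoints\<close>

definition orthonormal_basis :: "(nat \<Rightarrow> 'h::complex_hilbert) \<Rightarrow> bool" where
  "orthonormal_basis e \<longleftrightarrow> orthonormal e \<and> (\<forall>x. (\<forall>n. cinner x (e n) = 0) \<longrightarrow> x = 0)"

text \<open>
  The difference of the two sides is orthogonal to every basis vector.
\<close>

lemma orthonormal_basis_expansion:
  assumes "orthonormal_basis e"
  shows "diag_op (\<lambda>n. 1) e e x = x"
proof -
  have e: "orthonormal e" using assms by (simp add: orthonormal_basis_def)
  have "cinner (x - diag_op (\<lambda>n. 1) e e x) (e m) = 0" for m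
    unfolding cinner_diff_left using e
    by (subst cinner_diag_op_component) (auto simp: orthonormal_contractive orthonormal_norm)
  then show ?thesis using assms by (metis eq_iff_diff_eq_0 orthonormal_basis_def)
qed

lemma orthogonal_residual:
  assumes "finite B" "\<And>x y. x \<in> B \<Longrightarrow> y \<in> B \<Longrightarrow> cinner x y = (if x = y then 1 else 0)" "b \<in> B"
  shows "cinner (x - (\<Sum>c\<in>B. cinner x c *\<^sub>C c)) b = 0"
proof -
  have "(\<Sum>c\<in>B. cinner x c * cinner c b) = (\<Sum>c\<in>B. if c = b then cinner x b else 0)"
    using assms(2,3) by (intro sum.cong) auto
  then show ?thesis
    using assms(1,3) by (simp add: cinner_diff_left cinner_sum_left cinner_scaleC_left)
qed

text \<open>
  A maximal orthonormal set \<open>M\<close> exists by Zorn's lemma, and maximality means that only 0 is orthogonal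
  to it. If \<open>M\<close> were finite, the residual of every vector would vanish and \<open>M\<close> would span the space. It
  is countable because distinct members have distance \<open>sqrt 2\<close>, so that points of a countable dense set
  at distance less than \<open>1/2\<close> from them are distinct.
\<close>

theorem orthonormal_basis_exists:
  assumes sep: "separable_space (euclidean :: 'h::complex_hilbert topology)"
    and inf: "infinite_dimensional (UNIV :: 'h set)"
  obtains e :: "nat \<Rightarrow> 'h::complex_hilbert" where "orthonormal_basis e"
proof -
  define A where "A = {B :: 'h set. \<forall>x\<in>B. \<forall>y\<in>B. cinner x y = (if x = y then 1 else 0)}"
  have "\<exists>M\<in>A. \<forall>X\<in>A. M \<subseteq> X \<longrightarrow> X = M"
  proof (rule subset_Zorn')
    fix C assume C: "subset.chain A C"
    show "\<Union>C \<in> A"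
      unfolding A_def
    proof (intro CollectI ballI)
      fix x y assume "x \<in> \<Union>C" "y \<in> \<Union>C"
      then obtain X Y where "X \<in> C" "Y \<in> C" "x \<in> X" "y \<in> Y" by blast
      moreover have "X \<subseteq> Y \<or> Y \<subseteq> X" using C \<open>X \<in> C\<close> \<open>Y \<in> C\<close>
        by (auto simp: subset.chain_def)
      ultimately obtain Z where "Z \<in> C" "x \<in> Z" "y \<in> Z" by blast
      moreover have "Z \<in> A" using C \<open>Z \<in> C\<close> by (auto simp: subset.chain_def)
      ultimately show "cinner x y = (if x = y then 1 else 0)" by (simp add: A_def)
    qed
  qed
  then obtain M where M: "M \<in> A" and max: "\<And>X. X \<in> A \<Longrightarrow> M \<subseteq> X \<Longrightarrow> X = M" by blast
  have on: "cinner x y = (if x = y then 1 else 0)" if "x \<in> M" "y \<in> M" for x y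
    using M that by (simp add: A_def)
  have total: "x = 0" if x: "\<And>b. b \<in> M \<Longrightarrow> cinner x b = 0" for x
  proof (rule ccontr)
    assume "x \<noteq> 0"
    define y where "y = complex_of_real (1 / norm x) *\<^sub>C x"
    have y1: "cinner y y = 1" using \<open>x \<noteq> 0\<close>
      by (simp add: cinner_self) (simp add: y_def norm_scaleC norm_divide)
    have yM: "cinner y b = 0" "cinner b y = 0" if "b \<in> M" for b
      using x[OF that] cinner_eq_0_commute[of x b]
      by (auto simp: y_def cinner_scaleC_left cinner_scaleC_right)
    have "insert y M \<in> A"
      unfolding A_def
    proof (intro CollectI ballI)
      fix a b assume "a \<in> insert y M" "b \<in> insert y M"
      moreover have "y \<notin> M" using yM(1)[of y] y1 by auto
      ultimately show "cinner a b = (if a = b then 1 else 0)"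
        using M yM y1 unfolding A_def by (cases "a = y"; cases "b = y") auto
    qed
    then have "y \<in> M" using max[of "insert y M"] by blast
    then show False using yM(1)[of y] y1 by simp
  qed
  have "infinite M"
  proof
    assume fin: "finite M"
    have "x \<in> cvec.span M" for x
    proof -
      have "x - (\<Sum>c\<in>M. cinner x c *\<^sub>C c) = 0"
        by (rule total) (rule orthogonal_residual[OF fin on])
      then have "x = (\<Sum>c\<in>M. cinner x c *\<^sub>C c)" by simp
      also have "\<dots> \<in> cvec.span M"
        by (intro cvec.span_sum cvec.span_scale cvec.span_base)
      finally show ?thesis .
    qed
    then show False using fin inf unfolding infinite_dimensional_def by blast
  qed
  have "countable M"
  proof -
    obtain D :: "'h set" where D: "countable D" "closure D = UNIV"
      using sep by (auto simp: separable_space_def)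
    have "\<forall>b. \<exists>d. d \<in> D \<and> dist d b < 1/2"
    proof
      fix b
      have "b \<in> closure D" using D(2) by simp
      then have "\<forall>e>0. \<exists>y\<in>D. dist y b < e" by (simp only: closure_approachable)
      moreover have "(0::real) < 1/2" by simp
      ultimately show "\<exists>d. d \<in> D \<and> dist d b < 1/2" by blast
    qed
    from choice[OF this] obtain f where f: "\<And>b. f b \<in> D" "\<And>b. dist (f b) b < 1/2" by blast
    have "inj_on f M"
    proof (rule inj_onI, rule ccontr)
      fix b c assume bc: "b \<in> M" "c \<in> M" "f b = f c" "b \<noteq> c"
      have "cinner (b - c) (b - c) = 2"
        using on bc by (simp add: cinner_diff_left cinner_diff_right)
      then have "(norm (b - c))\<^sup>2 = 2"
        by (simp only: cinner_self) (metis of_real_eq_iff of_real_numeral)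
      moreover have "norm (b - c) < 1"
        using f(2)[of b] f(2)[of c] dist_triangle2[of b c "f b"] bc(3)
        by (simp add: dist_norm[symmetric] dist_commute)
      then have "(norm (b - c))\<^sup>2 \<le> 1" by (intro power_le_one) auto
      ultimately show False by simp
    qed
    moreover have "countable (f ` M)"
      by (rule countable_subset[OF _ D(1)]) (use f in auto)
    ultimately show ?thesis by (rule countable_image_inj_on[rotated])
  qed
  then have bij: "bij_betw (from_nat_into M) UNIV M"
    using \<open>infinite M\<close> by (rule bij_betw_from_nat_into)
  have "orthonormal_basis (from_nat_into M)"
    unfolding orthonormal_basis_def orthonormal_def
  proof (intro conjI allI impI)
    have mem: "from_nat_into M i \<in> M" for i using bij bij_betwE by blast
    show "cinner (from_nat_into M i) (from_nat_into M j) = (if i = j then 1 else 0)" for i j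
      using on[OF mem mem, of i j] bij_betw_imp_inj_on[OF bij] by (simp add: inj_eq)
    show "x = 0" if "\<forall>n. cinner x (from_nat_into M n) = 0" for x
      using total that bij_betw_imp_surj_on[OF bij] by (metis imageE)
  qed
  then show thesis by (rule that)
qed

lemma cadjoint_eqI:
  assumes "\<And>v w. cinner (X v) w = cinner v (Y w)"
  shows "cadjoint X = Y"
  unfolding cadjoint_def
proof (rule the_equality)
  fix Z assume "\<forall>v w. cinner (X v) w = cinner v (Z w)"
  then have "cinner v (Z w) = cinner v (Y w)" for v w by (simp flip: assms)
  then show "Z = Y" by (intro ext cinner_ext)
qed (use assms in blast)

lemma adjoint_bounded_operators:
  fixes X :: "'h::complex_hilbert \<Rightarrow> 'h"
  assumes "X \<in> bounded_operators" "\<And>v w. cinner (X v) w = cinner v (Y w)"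
  shows "Y \<in> bounded_operators"
proof -
  obtain K where K: "0 < K" "\<And>x. norm (X x) \<le> K * norm x"
    using bounded_operators_norm[OF assms(1)] by blast
  show ?thesis
  proof (rule bounded_operatorsI)
    show "Y (x + y) = Y x + Y y" for x y
      by (rule cinner_ext) (simp add: cinner_add_right flip: assms(2))
    show "Y (c *\<^sub>C x) = c *\<^sub>C Y x" for c x
      by (rule cinner_ext) (simp add: cinner_scaleC_right flip: assms(2))
    show "norm (Y x) \<le> K * norm x" for x
    proof (cases "Y x = 0")
      case False
      have "complex_of_real ((norm (Y x))\<^sup>2) = cinner (X (Y x)) x"
        by (simp only: assms(2) cinner_self)
      then have "(norm (Y x))\<^sup>2 = norm (cinner (X (Y x)) x)"
        by (metis abs_of_nonneg norm_of_real zero_le_power2)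
      also have "\<dots> \<le> (K * norm (Y x)) * norm x"
        using K(2)[of "Y x"] Cauchy_Schwarz_cinner[of "X (Y x)" x]
        by (meson mult_right_mono norm_ge_zero order_trans)
      finally show ?thesis using False by (simp add: power2_eq_square)
    qed (use K in simp)
  qed
qed

text \<open>
  The adjoint must be \<open>Y w = \<Sum>\<langle>w, X e\<^sub>n\<rangle> e\<^sub>n\<close>. Its coefficients are square summable: if \<open>z\<close> is a partial
  sum and \<open>S\<close> the corresponding sum of squares, then \<open>\<langle>w, X z\<rangle> = S\<close> and \<open>\<parallel>z\<parallel> \<le> sqrt S\<close>, whence
  \<open>S \<le> \<parallel>w\<parallel> K sqrt S\<close>.
\<close>

lemma adjoint_exists:
  fixes X :: "'h::complex_hilbert \<Rightarrow> 'h"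
  assumes "orthonormal_basis (e :: nat \<Rightarrow> 'h)" and X: "X \<in> bounded_operators"
  obtains Y where "Y \<in> bounded_operators" "\<And>v w. cinner (X v) w = cinner v (Y w)"
proof -
  have e: "contractive_orthogonal e"
    using assms(1) by (auto simp: orthonormal_basis_def orthonormal_contractive)
  obtain K where K: "0 < K" "\<And>x. norm (X x) \<le> K * norm x"
    using bounded_operators_norm[OF X] by blast
  note lin = bounded_operatorsD[OF X]
  define Y where "Y w = (\<Sum>n. cinner w (X (e n)) *\<^sub>C e n)" for w
  have summ: "summable (\<lambda>n. (norm (cinner w (X (e n))))\<^sup>2)" for w
  proof (rule bounded_imp_summable[where B = "(K * norm w)\<^sup>2"])
    fix N
    define S where "S = (\<Sum>n\<le>N. (norm (cinner w (X (e n))))\<^sup>2)"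
    define z where "z = (\<Sum>n\<le>N. cinner w (X (e n)) *\<^sub>C e n)"
    have "norm z \<le> sqrt S"
      using norm_sum_orthogonal_le[OF e, of "{..N}" "\<lambda>n. cinner w (X (e n))"]
      by (intro real_le_rsqrt) (simp add: z_def S_def)
    have "X z = (\<Sum>n\<le>N. cinner w (X (e n)) *\<^sub>C X (e n))"
      unfolding z_def using lin by (simp add: linear_sum bounded_linear.linear)
    then have "cinner w (X z) = complex_of_real S"
      by (simp add: S_def cinner_sum_right cinner_scaleC_right mult.commute flip: complex_norm_square)
    then have "S \<le> norm (cinner w (X z))" by simp
    also have "\<dots> \<le> norm w * norm (X z)" by (rule Cauchy_Schwarz_cinner)
    also have "\<dots> \<le> norm w * (K * sqrt S)"
      using K(2)[of z] \<open>norm z \<le> sqrt S\<close> K(1)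
      by (intro mult_left_mono) (auto intro: order_trans mult_left_mono)
    finally have "S \<le> (K * norm w) * sqrt S" by (simp add: mult_ac)
    then show "(\<Sum>n\<le>N. (norm (cinner w (X (e n))))\<^sup>2) \<le> (K * norm w)\<^sup>2"
      unfolding S_def[symmetric] using K(1)
      by (intro le_square_of_le_mult_sqrt) (auto simp: S_def sum_nonneg)
  qed auto
  have adj: "cinner (X v) w = cinner v (Y w)" for v w
  proof -
    have "(\<lambda>n. cinner v (e n) *\<^sub>C e n) sums v"
      using diag_op_sums[of "\<lambda>n. 1" e e v] e by (simp add: orthonormal_basis_expansion[OF assms(1)])
    then have "(\<lambda>n. cinner (X (cinner v (e n) *\<^sub>C e n)) w) sums cinner (X v) w"
      by (intro bounded_linear.sums[OF bounded_linear_cinner_left] bounded_linear.sums[OF lin(1)])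
    then have 1: "(\<lambda>n. cinner v (e n) * cinner (X (e n)) w) sums cinner (X v) w"
      by (simp add: lin(2) cinner_scaleC_left)
    have "(\<lambda>n. cinner w (X (e n)) *\<^sub>C e n) sums Y w"
      unfolding Y_def by (intro summable_sums Riesz_Fischer e summ)
    then have "(\<lambda>n. cinner v (cinner w (X (e n)) *\<^sub>C e n)) sums cinner v (Y w)"
      by (rule bounded_linear.sums[OF bounded_linear_cinner_right])
    then have 2: "(\<lambda>n. cinner v (e n) * cinner (X (e n)) w) sums cinner v (Y w)"
      by (simp add: cinner_scaleC_right mult.commute cinner_commute[of "X _" w])
    show ?thesis using sums_unique2[OF 1 2] .
  qed
  show thesis by (rule that[OF adjoint_bounded_operators[OF X adj] adj])
qed

section \<open>The min-max bound and compactness\<close>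

text \<open>
  Gaussian elimination: each induction step uses one equation to eliminate one unknown.
\<close>

lemma homogeneous_system_nontrivial_solution:
  fixes a :: "'i \<Rightarrow> 'f \<Rightarrow> 'k::field"
  assumes "finite F" "finite I" "card F < card I"
  shows "\<exists>c. (\<exists>i\<in>I. c i \<noteq> 0) \<and> (\<forall>f\<in>F. (\<Sum>i\<in>I. c i * a i f) = 0)"
  using assms
proof (induction F arbitrary: I a rule: finite_induct)
  case empty
  then obtain i where "i \<in> I" by fastforce
  then show ?case by (intro exI[of _ "\<lambda>_. 1"]) auto
next
  case (insert f F)
  show ?case
  proof (cases "\<forall>i\<in>I. a i f = 0")
    case True
    have "card F < card I" using insert by simp
    then obtain c where "\<exists>i\<in>I. c i \<noteq> 0" "\<forall>g\<in>F. (\<Sum>i\<in>I. c i * a i g) = 0"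
      using insert.IH[OF \<open>finite I\<close>] by blast
    then show ?thesis using True by (intro exI[of _ c]) auto
  next
    case False
    then obtain k where k: "k \<in> I" "a k f \<noteq> 0" by blast
    define J where "J = I - {k}"
    have J: "finite J" "card F < card J" "I = insert k J" "k \<notin> J"
      using insert k by (auto simp: J_def)
    obtain c where c: "\<exists>i\<in>J. c i \<noteq> 0"
      "\<forall>g\<in>F. (\<Sum>i\<in>J. c i * (a i g - a i f / a k f * a k g)) = 0"
      using insert.IH[OF J(1,2), of "\<lambda>i g. a i g - a i f / a k f * a k g"] by blast
    define d where "d = c(k := - (\<Sum>i\<in>J. c i * a i f) / a k f)"
    have d_J: "(\<Sum>i\<in>J. d i * b i) = (\<Sum>i\<in>J. c i * b i)" for b
      using J(4) by (intro sum.cong) (auto simp: d_def)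
    have split: "(\<Sum>i\<in>I. d i * a i g) = d k * a k g + (\<Sum>i\<in>J. c i * a i g)" for g
      using J by (simp add: d_J)
    have "(\<Sum>i\<in>I. d i * a i f) = 0" unfolding split using k(2) by (simp add: d_def)
    moreover have "(\<Sum>i\<in>I. d i * a i g) = 0" if "g \<in> F" for g
    proof -
      have "(\<Sum>i\<in>J. c i * (a i g - a i f / a k f * a k g))
        = (\<Sum>i\<in>J. c i * a i g) - (\<Sum>i\<in>J. c i * a i f) / a k f * a k g"
        by (simp add: right_diff_distrib sum_subtractf sum_divide_distrib sum_distrib_right mult.assoc)
      then show ?thesis unfolding split using c(2) that by (simp add: d_def)
    qed
    moreover have "\<exists>i\<in>I. d i \<noteq> 0" using c(1) J by (auto simp: d_def)
    ultimately show ?thesis by (intro exI[of _ d]) auto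
  qed
qed

text \<open>
  Orthogonality to \<open>F\<close> imposes at most \<open>n\<close> linear equations on the \<open>n + 1\<close> coefficients.
\<close>

lemma orthonormal_span_meets_annihilator:
  fixes v :: "nat \<Rightarrow> 'h::complex_hilbert"
  assumes "orthonormal v" "finite F" "card F \<le> n"
  obtains c where "(\<Sum>i\<le>n. c i *\<^sub>C v i) \<noteq> 0" "\<And>f. f \<in> F \<Longrightarrow> cinner (\<Sum>i\<le>n. c i *\<^sub>C v i) f = 0"
proof -
  obtain c where c: "\<exists>i\<in>{..n}. c i \<noteq> 0" "\<forall>f\<in>F. (\<Sum>i\<in>{..n}. c i * cinner (v i) f) = 0"
    using homogeneous_system_nontrivial_solution[of F "{..n}" "\<lambda>i. cinner (v i)"] assms(2,3) by auto
  have "(norm (\<Sum>i\<le>n. c i *\<^sub>C v i))\<^sup>2 = (\<Sum>i\<le>n. (norm (c i))\<^sup>2)"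
    using norm_sum_orthogonal[OF orthonormal_contractive[OF assms(1)], of "{..n}" c]
    by (simp add: orthonormal_norm[OF assms(1)])
  moreover obtain i where "i \<le> n" "c i \<noteq> 0" using c(1) by auto
  then have "0 < (\<Sum>i\<le>n. (norm (c i))\<^sup>2)" by (intro sum_pos2[of _ i]) auto
  ultimately have "(\<Sum>i\<le>n. c i *\<^sub>C v i) \<noteq> 0" by auto
  then show thesis using c(2) by (intro that) (auto simp: cinner_sum_left cinner_scaleC_left)
qed

text \<open>
  The lower half of the min-max principle. The span of \<open>v\<^sub>0, \<dots>, v\<^sub>n\<close> contains a nonzero vector in the
  annihilator of \<open>F\<close>, and \<open>X\<close> stretches every vector of this span by at least \<open>s\<^sub>n\<close>. The statement asks
  for the action of \<open>X\<close> on the vectors \<open>v\<^sub>i\<close> alone, since it serves to show \<open>s\<^sub>n \<longlonglongrightarrow> 0\<close> before \<open>X\<close> is known to be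
  the sum of its singular value decomposition.
\<close>

lemma singular_value_le:
  fixes v :: "nat \<Rightarrow> 'h::complex_hilbert"
  assumes X: "X \<in> bounded_operators" and v: "orthonormal v" and u: "contractive_orthogonal u"
    and Xv: "\<And>i. X (v i) = complex_of_real (s i) *\<^sub>C u i" and s: "decseq s" "\<And>i. 0 \<le> s i"
    and u1: "\<And>i. s i \<noteq> 0 \<Longrightarrow> norm (u i) = 1"
    and F: "finite F" "card F \<le> n"
    and le: "\<And>x. (\<And>f. f \<in> F \<Longrightarrow> cinner x f = 0) \<Longrightarrow> norm (X x) \<le> C * norm x"
  shows "s n \<le> C"
proof -
  obtain c where c: "(\<Sum>i\<le>n. c i *\<^sub>C v i) \<noteq> 0" "\<And>f. f \<in> F \<Longrightarrow> cinner (\<Sum>i\<le>n. c i *\<^sub>C v i) f = 0"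
    using orthonormal_span_meets_annihilator[OF v F] by blast
  define x where "x = (\<Sum>i\<le>n. c i *\<^sub>C v i)"
  note lin = bounded_operatorsD[OF X]
  have Xx: "X x = (\<Sum>i\<le>n. (c i * complex_of_real (s i)) *\<^sub>C u i)"
    unfolding x_def using lin Xv
    by (simp add: linear_sum bounded_linear.linear scaleC_scaleC)
  have "(s n * norm x)\<^sup>2 = (\<Sum>i\<le>n. (s n)\<^sup>2 * (norm (c i))\<^sup>2)"
    unfolding x_def power_mult_distrib norm_sum_orthogonal[OF orthonormal_contractive[OF v] finite_atMost]
    by (simp add: orthonormal_norm[OF v] sum_distrib_left)
  also have "\<dots> \<le> (\<Sum>i\<le>n. (norm (c i * complex_of_real (s i)))\<^sup>2 * (norm (u i))\<^sup>2)"
  proof (rule sum_mono)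
    fix i assume "i \<in> {..n}"
    then have "s n \<le> s i" using s by (simp add: decseq_def)
    then have "(s n)\<^sup>2 \<le> (s i)\<^sup>2" using s by (intro power_mono) auto
    also have "(s i)\<^sup>2 = (s i)\<^sup>2 * (norm (u i))\<^sup>2" using u1[of i] by (cases "s i = 0") auto
    finally have "(s n)\<^sup>2 * (norm (c i))\<^sup>2 \<le> (s i)\<^sup>2 * (norm (u i))\<^sup>2 * (norm (c i))\<^sup>2"
      by (intro mult_right_mono) auto
    then show "(s n)\<^sup>2 * (norm (c i))\<^sup>2 \<le> (norm (c i * complex_of_real (s i)))\<^sup>2 * (norm (u i))\<^sup>2"
      by (simp add: norm_mult power_mult_distrib mult_ac)
  qed
  also have "\<dots> = (norm (X x))\<^sup>2"
    unfolding Xx by (rule norm_sum_orthogonal[OF u, symmetric]) simp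
  finally have "s n * norm x \<le> norm (X x)" by (rule power2_le_imp_le) simp
  also have "\<dots> \<le> C * norm x" using c(2) by (intro le) (simp add: x_def)
  finally show ?thesis using c(1) by (simp add: x_def)
qed

text \<open>
  Compactness in the form that \<open>X\<close> is small off a finite-dimensional space. Refined to count the vectors
  in \<open>F\<close>, it is the definition of the Gelfand numbers, which makes estimates for sums and products of
  operators immediate; its negation supplies, off any finite set, a unit vector that \<open>X\<close> does not
  shrink below a fixed \<open>\<epsilon>\<close>.
\<close>

definition compact_op :: "('h::complex_hilbert \<Rightarrow> 'h) \<Rightarrow> bool" where
  "compact_op X \<longleftrightarrow>
     (\<forall>\<epsilon>>0. \<exists>F. finite F \<and> (\<forall>x. (\<forall>f\<in>F. cinner x f = 0) \<longrightarrow> norm (X x) \<le> \<epsilon> * norm x))"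

definition singular_value_decomposition ::
    "('h::complex_hilbert \<Rightarrow> 'h) \<Rightarrow> (nat \<Rightarrow> real) \<Rightarrow> (nat \<Rightarrow> 'h) \<Rightarrow> (nat \<Rightarrow> 'h) \<Rightarrow> bool" where
  "singular_value_decomposition X s v u \<longleftrightarrow> s \<in> c0_star \<and> orthonormal v \<and> contractive_orthogonal u \<and>
     (\<forall>n. s n \<noteq> 0 \<longrightarrow> norm (u n) = 1) \<and> X = diag_op s v u"

lemma c0_star_Bseq: "s \<in> c0_star \<Longrightarrow> Bseq s"
  using c0_star_tendsto convergent_imp_Bseq convergentI by blast

lemma diag_op_apply:
  fixes v :: "nat \<Rightarrow> 'h::complex_hilbert"
  assumes "orthonormal v"
  shows "diag_op s v u (v i) = complex_of_real (s i) *\<^sub>C u i"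
proof -
  have "(\<Sum>n. (complex_of_real (s n) * cinner (v i) (v n)) *\<^sub>C u n)
    = (\<Sum>n\<in>{i}. (complex_of_real (s n) * cinner (v i) (v n)) *\<^sub>C u n)"
    using assms by (intro suminf_finite) (auto simp: orthonormal_def)
  then show ?thesis using assms by (simp add: diag_op_def orthonormal_def)
qed

lemma norm_eq_1_if_cinner_self:
  assumes "cinner (x::'h::complex_hilbert) x = 1"
  shows "norm x = 1"
proof -
  have "(norm x)\<^sup>2 = 1" using assms unfolding cinner_self by (simp only: of_real_eq_1_iff)
  then show ?thesis using norm_ge_zero[of x] by (simp add: power2_eq_1_iff)
qed

text \<open>
  Gram-Schmidt, stated through annihilators.
\<close>

lemma orthonormalization:
  fixes F :: "'h::complex_hilbert set"
  assumes "finite F"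
  obtains B where "finite B" "\<And>x y. x \<in> B \<Longrightarrow> y \<in> B \<Longrightarrow> cinner x y = (if x = y then 1 else 0)"
    "\<And>x f. (\<And>b. b \<in> B \<Longrightarrow> cinner x b = 0) \<Longrightarrow> f \<in> F \<Longrightarrow> cinner x f = 0"
proof -
  have "\<exists>B. finite B \<and> (\<forall>x\<in>B. \<forall>y\<in>B. cinner x y = (if x = y then 1 else 0)) \<and>
     (\<forall>x. (\<forall>b\<in>B. cinner x b = 0) \<longrightarrow> (\<forall>f\<in>F. cinner x f = 0))"
    using assms
  proof (induction F rule: finite_induct)
    case empty
    then show ?case by (intro exI[of _ "{}"]) auto
  next
    case (insert f F)
    then obtain B where B: "finite B" "\<forall>x\<in>B. \<forall>y\<in>B. cinner x y = (if x = y then 1 else 0)"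
      "\<forall>x. (\<forall>b\<in>B. cinner x b = 0) \<longrightarrow> (\<forall>f\<in>F. cinner x f = 0)" by blast
    define p where "p = (\<Sum>c\<in>B. cinner f c *\<^sub>C c)"
    define r where "r = f - p"
    define b where "b = complex_of_real (1 / norm r) *\<^sub>C r"
    have "cinner r c = 0" if "c \<in> B" for c
      unfolding r_def p_def using B that by (intro orthogonal_residual) auto
    then have bB: "cinner b c = 0" "cinner c b = 0" if "c \<in> B" for c
      using that cinner_eq_0_commute[of r c] by (auto simp: b_def cinner_scaleC_left cinner_scaleC_right)
    have bb: "cinner b b = 1" if "r \<noteq> 0"
      using that by (simp add: cinner_self) (simp add: b_def norm_scaleC norm_divide)
    have f: "cinner x f = 0" if "\<forall>c\<in>B. cinner x c = 0" "cinner x r = 0" for x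
    proof -
      have "cinner x p = 0" using that(1) by (simp add: p_def cinner_sum_right cinner_scaleC_right)
      then show ?thesis using that(2) by (simp add: r_def cinner_diff_right)
    qed
    show ?case
    proof (cases "r = 0")
      case True
      then show ?thesis using B f by (intro exI[of _ B]) auto
    next
      case False
      have xr: "cinner x r = 0" if "cinner x b = 0" for x
        using that False by (simp add: b_def cinner_scaleC_right)
      have "cinner x y = (if x = y then 1 else 0)" if "x \<in> insert b B" "y \<in> insert b B" for x y
      proof -
        have "b \<notin> B" using bB(1)[of b] bb[OF False] by auto
        then show ?thesis using that B(2) bB bb[OF False] by (cases "x = b"; cases "y = b") auto
      qed
      moreover have "cinner x g = 0" if "\<forall>c\<in>insert b B. cinner x c = 0" "g \<in> insert f F" for x g
        using that B(3) f[of x] xr[of x] by blast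
      ultimately show ?thesis using B(1) by (intro exI[of _ "insert b B"]) blast
    qed
  qed
  then show thesis using that by metis
qed

text \<open>
  By induction it is a sum of the compact sets \<open>{c g(b) | \<bar>c\<bar> \<le> 1}\<close>.
\<close>

lemma compact_bounded_combinations:
  fixes g :: "'b \<Rightarrow> 'h::complex_hilbert"
  assumes "finite B"
  shows "compact {\<Sum>b\<in>B. c b *\<^sub>C g b | c. \<forall>b\<in>B. norm (c b) \<le> 1}"
  using assms
proof (induction B rule: finite_induct)
  case (insert b B)
  let ?K = "\<lambda>B. {\<Sum>b\<in>B. c b *\<^sub>C g b | c. \<forall>b\<in>B. norm (c b) \<le> (1::real)}"
  have "continuous_on A (\<lambda>c::complex. c *\<^sub>C g b)" for A
  proof (rule linear_continuous_on, rule bounded_linear_intro)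
    show "(r *\<^sub>R c) *\<^sub>C g b = r *\<^sub>R (c *\<^sub>C g b)" for r and c :: complex
      by (simp add: scaleR_conv_of_real scaleC_scaleC flip: scaleC_of_real)
    show "norm (c *\<^sub>C g b) \<le> norm c * norm (g b)" for c by (simp add: norm_scaleC)
  qed (rule scaleC_add_left)
  then have "compact ((\<lambda>c. c *\<^sub>C g b) ` cball 0 1)"
    by (intro compact_continuous_image) auto
  then have "compact {x + y | x y. x \<in> (\<lambda>c. c *\<^sub>C g b) ` cball 0 1 \<and> y \<in> ?K B}"
    using insert.IH by (rule compact_sums)
  also have "{x + y | x y. x \<in> (\<lambda>c. c *\<^sub>C g b) ` cball 0 1 \<and> y \<in> ?K B} = ?K (insert b B)"
  proof (intro equalityI subsetI)
    fix z assume "z \<in> {x + y | x y. x \<in> (\<lambda>c. c *\<^sub>C g b) ` cball 0 1 \<and> y \<in> ?K B}"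
    then obtain a c where *: "z = a *\<^sub>C g b + (\<Sum>b\<in>B. c b *\<^sub>C g b)" "norm a \<le> 1" "\<forall>b\<in>B. norm (c b) \<le> 1"
      by auto
    have "(\<Sum>i\<in>B. (c(b := a)) i *\<^sub>C g i) = (\<Sum>i\<in>B. c i *\<^sub>C g i)"
      using insert by (intro sum.cong) auto
    then have "z = (\<Sum>i\<in>insert b B. (c(b := a)) i *\<^sub>C g i)"
      using * insert by simp
    moreover have "\<forall>i\<in>insert b B. norm ((c(b := a)) i) \<le> 1" using * by auto
    ultimately show "z \<in> ?K (insert b B)" by blast
  next
    fix z assume "z \<in> ?K (insert b B)"
    then obtain c where "z = (\<Sum>i\<in>insert b B. c i *\<^sub>C g i)" "\<forall>i\<in>insert b B. norm (c i) \<le> 1"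
      by blast
    then have "z = c b *\<^sub>C g b + (\<Sum>i\<in>B. c i *\<^sub>C g i)" "c b \<in> cball 0 1" "\<forall>i\<in>B. norm (c i) \<le> 1"
      using insert by auto
    then show "z \<in> {x + y | x y. x \<in> (\<lambda>c. c *\<^sub>C g b) ` cball 0 1 \<and> y \<in> ?K B}"
      by blast
  qed
  finally show ?case .
qed simp

text \<open>
  Let \<open>p\<close> be the projection of \<open>x\<close> to a finite-dimensional space off which \<open>X\<close> is small. Then \<open>X x\<close> is close
  to \<open>X p\<close>, which lies in the compact set of bounded combinations of finitely many vectors. Hence the
  image of the unit ball is totally bounded.
\<close>

lemma compact_op_compact_closure:
  fixes X :: "'h::complex_hilbert \<Rightarrow> 'h"
  assumes X: "X \<in> bounded_operators" and comp: "compact_op X"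
  shows "compact (closure (X ` cball 0 1))"
proof -
  note lin = bounded_operatorsD[OF X]
  have "\<exists>k. finite k \<and> closure (X ` cball 0 1) \<subseteq> (\<Union>y\<in>k. ball y \<epsilon>)" if "\<epsilon> > 0" for \<epsilon>
  proof -
    have "\<epsilon> / 8 > 0" using that by simp
    then obtain F where F: "finite F" "\<And>x. (\<forall>f\<in>F. cinner x f = 0) \<Longrightarrow> norm (X x) \<le> \<epsilon> / 8 * norm x"
      using comp unfolding compact_op_def by blast
    obtain B where B: "finite B" "\<And>x y. x \<in> B \<Longrightarrow> y \<in> B \<Longrightarrow> cinner x y = (if x = y then 1 else 0)"
      "\<And>x f. (\<And>b. b \<in> B \<Longrightarrow> cinner x b = 0) \<Longrightarrow> f \<in> F \<Longrightarrow> cinner x f = 0"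
      using orthonormalization[OF F(1)] by blast
    define K where "K = {\<Sum>b\<in>B. c b *\<^sub>C X b | c. \<forall>b\<in>B. norm (c b) \<le> 1}"
    have "compact K" unfolding K_def by (rule compact_bounded_combinations[OF B(1)])
    then have "\<forall>e>0. \<exists>k. finite k \<and> K \<subseteq> (\<Union>y\<in>k. ball y e)"
      by (rule conjunct2[OF iffD1[OF compact_eq_totally_bounded]])
    moreover have "\<epsilon> / 4 > 0" using that by simp
    ultimately obtain k where k: "finite k" "K \<subseteq> (\<Union>y\<in>k. ball y (\<epsilon>/4))" by blast
    have "closure (X ` cball 0 1) \<subseteq> (\<Union>y\<in>k. ball y \<epsilon>)"
    proof
      fix z assume "z \<in> closure (X ` cball 0 1)"
      then obtain x where x: "norm x \<le> 1" "dist (X x) z < \<epsilon> / 4"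
        using \<open>\<epsilon> / 4 > 0\<close> unfolding closure_approachable by (metis imageE mem_cball_0)
      define p where "p = (\<Sum>b\<in>B. cinner x b *\<^sub>C b)"
      have nb: "norm b = 1" if "b \<in> B" for b
        using B(2)[OF that that] by (intro norm_eq_1_if_cinner_self) simp
      have "cinner (x - p) b = 0" if "b \<in> B" for b
        unfolding p_def using B that by (intro orthogonal_residual) auto
      then have "norm (X (x - p)) \<le> \<epsilon> / 8 * norm (x - p)"
        using B(3) by (intro F(2)) blast
      moreover have "cinner (x - p) p = 0"
        using \<open>\<And>b. b \<in> B \<Longrightarrow> cinner (x - p) b = 0\<close>
        by (subst (2) p_def) (simp add: cinner_sum_right cinner_scaleC_right)
      then have "inner (x - p) p = 0" by (simp flip: Re_cinner)
      then have "(norm x)\<^sup>2 = (norm (x - p))\<^sup>2 + (norm p)\<^sup>2"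
        using norm_add_Pythagorean[of "x - p" p] by (simp add: orthogonal_def)
      then have "(norm (x - p))\<^sup>2 \<le> (norm x)\<^sup>2"
        using zero_le_power2[of "norm p"] by linarith
      then have "norm (x - p) \<le> norm x"
        by (rule power2_le_imp_le) simp
      ultimately have "norm (X (x - p)) \<le> \<epsilon> / 8 * 1"
        using x(1) that by (meson half_gt_zero_iff divide_nonneg_nonneg less_imp_le mult_left_mono order_trans zero_le_numeral)
      then have "norm (X x - X p) \<le> \<epsilon> / 8"
        using lin(1) by (simp add: linear_diff bounded_linear.linear)
      moreover have "X p \<in> K"
      proof -
        have "X p = (\<Sum>b\<in>B. cinner x b *\<^sub>C X b)"
          unfolding p_def using lin by (simp add: linear_sum bounded_linear.linear)
        moreover have "norm (cinner x b) \<le> 1" if "b \<in> B" for b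
          using Cauchy_Schwarz_cinner[of x b] x(1) nb[OF that] by simp
        ultimately show ?thesis unfolding K_def by blast
      qed
      then obtain y where y: "y \<in> k" "dist y (X p) < \<epsilon> / 4" using k(2) by (auto simp: mem_ball)
      ultimately have "dist y z < \<epsilon>"
        using x(2) dist_triangle[of y z "X p"] dist_triangle[of "X p" z "X x"] that
        by (simp add: dist_norm norm_minus_commute)
      then show "z \<in> (\<Union>y\<in>k. ball y \<epsilon>)" using y(1) by auto
    qed
    with k(1) show ?thesis by blast
  qed
  then show ?thesis
    unfolding compact_eq_totally_bounded by (simp add: complete_eq_closed)
qed

text \<open>
  Let \<open>L\<close> be the supremum of \<open>\<parallel>X x\<parallel>\<close> over the unit vectors of the annihilator \<open>M\<close> of \<open>F\<close>. On \<open>M\<close> the form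
  \<open>q x = L\<^sup>2 \<parallel>x\<parallel>\<^sup>2 - \<parallel>X x\<parallel>\<^sup>2\<close> is nonnegative, and the parallelogram law gives
  \<open>L\<^sup>2 \<parallel>a - b\<parallel>\<^sup>2 \<le> 2 q a + 2 q b + \<parallel>X a - X b\<parallel>\<^sup>2\<close>. Along a maximizing sequence \<open>q\<close> tends to 0, and by
  compactness the images converge along a subsequence. So this subsequence is itself Cauchy, and its
  limit is a maximizer.
\<close>

lemma compact_op_attains_norm:
  fixes X :: "'h::complex_hilbert \<Rightarrow> 'h"
  assumes X: "X \<in> bounded_operators" and comp: "compact_op X"
    and ne: "\<exists>x. norm x = 1 \<and> (\<forall>f\<in>F. cinner x f = 0)"
  shows "\<exists>v. norm v = 1 \<and> (\<forall>f\<in>F. cinner v f = 0) \<and>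
     (\<forall>x. (\<forall>f\<in>F. cinner x f = 0) \<longrightarrow> norm (X x) \<le> norm (X v) * norm x)"
proof -
  note lin = bounded_operatorsD[OF X]
  define M where "M = {x. \<forall>f\<in>F. cinner x f = 0}"
  define L where "L = (SUP x\<in>{x \<in> M. norm x = 1}. norm (X x))"
  obtain K where K: "0 < K" "\<And>x. norm (X x) \<le> K * norm x"
    using bounded_operators_norm[OF X] by blast
  have bdd: "bdd_above ((\<lambda>x. norm (X x)) ` {x \<in> M. norm x = 1})"
    using K(2) by (intro bdd_aboveI[of _ K]) (auto, metis mult.right_neutral)
  have ne': "{x \<in> M. norm x = 1} \<noteq> {}" using ne by (auto simp: M_def)
  have LM: "norm (X x) \<le> L * norm x" if "x \<in> M" for x
  proof (cases "x = 0")
    case False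
    define y where "y = complex_of_real (1 / norm x) *\<^sub>C x"
    have "y \<in> M" "norm y = 1"
      using that False by (auto simp: M_def y_def cinner_scaleC_left norm_scaleC norm_divide)
    then have "norm (X y) \<le> L" unfolding L_def by (intro cSUP_upper bdd) auto
    moreover have "norm (X y) = norm (X x) / norm x"
      unfolding y_def lin(2) by (simp add: norm_scaleC norm_divide)
    ultimately show ?thesis using False by (simp add: divide_le_eq)
  qed (use lin(1) in \<open>simp add: linear_0 bounded_linear.linear\<close>)
  show ?thesis
  proof (cases "L = 0")
    case True
    then show ?thesis using ne LM by (auto simp: M_def)
  next
    case False
    obtain x0 where "x0 \<in> M" "norm x0 = 1" using ne' by blast
    then have "norm (X x0) \<le> L" using LM[of x0] by simp
    then have "L > 0" using False norm_ge_zero[of "X x0"] by linarith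
    have "\<exists>x. x \<in> M \<and> norm x = 1 \<and> L - 1 / real (Suc n) < norm (X x)" for n
    proof -
      have "L - 1 / real (Suc n) < L" by simp
      then obtain x where "x \<in> {x \<in> M. norm x = 1}" "L - 1 / real (Suc n) < norm (X x)"
        using less_cSUP_iff[OF ne' bdd] unfolding L_def by blast
      then show ?thesis by blast
    qed
    then obtain x where x: "\<And>n. x n \<in> M" "\<And>n. norm (x n) = 1" "\<And>n. L - 1 / real (Suc n) < norm (X (x n))"
      by metis
    have "X (x n) \<in> closure (X ` cball 0 1)" for n
      using x(2) closure_subset by (auto intro!: subsetD[OF closure_subset])
    then have "\<forall>n. (\<lambda>n. X (x n)) n \<in> closure (X ` cball 0 1)" by simp
    then obtain l r where r: "strict_mono r" "((\<lambda>n. X (x n)) \<circ> r) \<longlonglongrightarrow> l"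
      using iffD1[OF compact_def compact_op_compact_closure[OF X comp]] by metis
    define z where "z = x \<circ> r"
    have z: "z n \<in> M" "norm (z n) = 1" for n using x by (auto simp: z_def)
    have Xz: "(\<lambda>n. X (z n)) \<longlonglongrightarrow> l" using r(2) by (simp add: z_def o_def)
    have nX: "(\<lambda>n. norm (X (x n))) \<longlonglongrightarrow> L"
    proof (rule tendsto_sandwich[OF _ _ _ tendsto_const])
      show "\<forall>\<^sub>F n in sequentially. L - 1 / real (Suc n) \<le> norm (X (x n))"
        using x(3) by (auto intro!: always_eventually less_imp_le)
      show "\<forall>\<^sub>F n in sequentially. norm (X (x n)) \<le> L"
        using LM[OF x(1)] x(2) by (auto intro!: always_eventually)
      have "(\<lambda>n. L - 1 / real (Suc n)) \<longlonglongrightarrow> L - 0"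
        by (intro tendsto_diff tendsto_const) (use LIMSEQ_inverse_real_of_nat in \<open>simp add: inverse_eq_divide\<close>)
      then show "(\<lambda>n. L - 1 / real (Suc n)) \<longlonglongrightarrow> L" by simp
    qed
    have nXz: "(\<lambda>n. norm (X (z n))) \<longlonglongrightarrow> L"
      using LIMSEQ_subseq_LIMSEQ[OF nX r(1)] by (simp add: z_def o_def)
    define q where "q y = L\<^sup>2 * (norm y)\<^sup>2 - (norm (X y))\<^sup>2" for y
    have q_nonneg: "0 \<le> q y" if "y \<in> M" for y
      using power_mono[OF LM[OF that], of 2] by (simp add: q_def power_mult_distrib)
    have para: "L\<^sup>2 * (norm (a - b))\<^sup>2 \<le> 2 * q a + 2 * q b + (norm (X a - X b))\<^sup>2" if "a \<in> M" "b \<in> M" for a b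
    proof -
      have "a + b \<in> M" using that by (auto simp: M_def cinner_add_left)
      moreover have pl: "(norm (c + d))\<^sup>2 + (norm (c - d))\<^sup>2 = 2 * (norm c)\<^sup>2 + 2 * (norm d)\<^sup>2" for c d :: 'h
        by (simp add: power2_norm_eq_inner inner_add_left inner_add_right inner_diff_left inner_diff_right inner_commute)
      have "X (a + b) = X a + X b" using lin(1) by (simp add: linear_add bounded_linear.linear)
      ultimately have "(norm (X a + X b))\<^sup>2 \<le> L\<^sup>2 * (norm (a + b))\<^sup>2"
        using q_nonneg[of "a + b"] by (simp add: q_def)
      moreover have "L\<^sup>2 * (norm (a + b))\<^sup>2 + L\<^sup>2 * (norm (a - b))\<^sup>2 = 2 * (L\<^sup>2 * (norm a)\<^sup>2) + 2 * (L\<^sup>2 * (norm b)\<^sup>2)"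
        using arg_cong[OF pl[of a b], of "\<lambda>t. L\<^sup>2 * t"] by (simp add: distrib_left)
      ultimately show ?thesis
        using pl[of "X a" "X b"] unfolding q_def right_diff_distrib[of 2] by linarith
    qed
    have "(\<lambda>n. q (z n)) \<longlonglongrightarrow> L\<^sup>2 * 1\<^sup>2 - L\<^sup>2"
      unfolding q_def z(2) by (intro tendsto_intros nXz)
    then have qz: "(\<lambda>n. q (z n)) \<longlonglongrightarrow> 0" by simp
    have "Cauchy z"
    proof (rule metric_CauchyI)
      fix e :: real assume "e > 0"
      define d where "d = L\<^sup>2 * e\<^sup>2 / 5"
      have "d > 0" using \<open>e > 0\<close> \<open>L > 0\<close> by (simp add: d_def)
      obtain N1 where N1: "\<And>n. n \<ge> N1 \<Longrightarrow> \<bar>q (z n)\<bar> < d"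
        using LIMSEQ_D[OF qz \<open>d > 0\<close>] by auto
      obtain N2 where N2: "\<And>m n. m \<ge> N2 \<Longrightarrow> n \<ge> N2 \<Longrightarrow> dist (X (z m)) (X (z n)) < sqrt d"
        using metric_CauchyD[OF LIMSEQ_imp_Cauchy[OF Xz], of "sqrt d"] \<open>d > 0\<close> by auto
      have "dist (z m) (z n) < e" if "m \<ge> max N1 N2" "n \<ge> max N1 N2" for m n
      proof -
        have "norm (X (z m) - X (z n)) < sqrt d" using N2[of m n] that by (simp add: dist_norm)
        then have "(norm (X (z m) - X (z n)))\<^sup>2 < (sqrt d)\<^sup>2" by (intro power_strict_mono) auto
        then have "(norm (X (z m) - X (z n)))\<^sup>2 < d" using \<open>d > 0\<close> by simp
        then have "L\<^sup>2 * (norm (z m - z n))\<^sup>2 < 5 * d"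
          using para[OF z(1) z(1), of m n] N1[of m] N1[of n] that by (simp add: abs_less_iff)
        then have "(norm (z m - z n))\<^sup>2 < e\<^sup>2" using \<open>L > 0\<close> by (simp add: d_def)
        then show ?thesis using \<open>e > 0\<close> by (simp add: dist_norm power_less_imp_less_base)
      qed
      then show "\<exists>M. \<forall>m\<ge>M. \<forall>n\<ge>M. dist (z m) (z n) < e" by blast
    qed
    then obtain v where v: "z \<longlonglongrightarrow> v" using Cauchy_convergent convergent_def by blast
    have "norm v = 1"
      using LIMSEQ_unique[OF tendsto_norm[OF v]] z(2) by simp
    moreover have "cinner v f = 0" if "f \<in> F" for f
    proof -
      have "(\<lambda>n. cinner (z n) f) \<longlonglongrightarrow> cinner v f"
        by (rule bounded_linear.tendsto[OF bounded_linear_cinner_left v])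
      moreover have "cinner (z n) f = 0" for n using z(1)[of n] that by (simp add: M_def)
      ultimately show ?thesis by (simp add: LIMSEQ_const_iff)
    qed
    moreover have "norm (X v) = L"
      using LIMSEQ_unique[OF tendsto_norm[OF bounded_linear.tendsto[OF lin(1) v]] nXz] .
    ultimately show ?thesis using LM by (auto simp: M_def)
  qed
qed

text \<open>
  At a maximizer \<open>v\<close> the inequality \<open>\<parallel>X (v + t y)\<parallel> \<le> \<parallel>X v\<parallel> \<parallel>v + t y\<parallel>\<close> is an equality for \<open>t = 0\<close>. When
  \<open>v\<close> and \<open>y\<close> are orthogonal, the right side has no linear term in \<open>t\<close>, so the linear term
  \<open>2 t Re \<langle>X v, X y\<rangle>\<close> on the left vanishes too. Replacing \<open>y\<close> by \<open>\<i> y\<close> gives the imaginary part.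
\<close>

lemma maximizer_image_orthogonal:
  fixes X :: "'h::complex_hilbert \<Rightarrow> 'h"
  assumes X: "X \<in> bounded_operators" and v: "norm v = 1" "\<forall>f\<in>F. cinner v f = 0"
    and max: "\<And>x. (\<forall>f\<in>F. cinner x f = 0) \<Longrightarrow> norm (X x) \<le> norm (X v) * norm x"
    and y: "\<forall>f\<in>F. cinner y f = 0" "cinner v y = 0"
  shows "cinner (X v) (X y) = 0"
proof -
  note lin = bounded_operatorsD[OF X]
  have re: "Re (cinner (X v) (X y)) = 0" if y: "\<forall>f\<in>F. cinner y f = 0" "cinner v y = 0" for y
  proof (rule ccontr)
    define b where "b = inner (X v) (X y)"
    define K where "K = (norm (X v) * norm y)\<^sup>2 + 1"
    \<comment> \<open>For \<open>t\<close> of this size the linear term \<open>2 t b\<close> exceeds the quadratic one, which is at most \<open>t\<^sup>2 K\<close>.\<close>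
    define t where "t = b / K"
    assume "Re (cinner (X v) (X y)) \<noteq> 0"
    then have "b \<noteq> 0" by (simp add: b_def Re_cinner)
    have "K > 0" unfolding K_def by (rule add_nonneg_pos) auto
    have "norm (X (v + t *\<^sub>R y)) \<le> norm (X v) * norm (v + t *\<^sub>R y)"
      using y v(2) by (intro max) (auto simp: cinner_add_left cinner_scaleR_left)
    then have "(norm (X v + t *\<^sub>R X y))\<^sup>2 \<le> (norm (X v))\<^sup>2 * (norm (v + t *\<^sub>R y))\<^sup>2"
      using lin(1) power_mono[of "norm (X (v + t *\<^sub>R y))" "norm (X v) * norm (v + t *\<^sub>R y)" 2]
      by (simp add: power_mult_distrib linear_add linear_scale bounded_linear.linear)
    moreover have "(norm (v + t *\<^sub>R y))\<^sup>2 = 1 + t\<^sup>2 * (norm y)\<^sup>2"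
    proof -
      have "inner v y = 0" using y(2) by (simp flip: Re_cinner)
      then show ?thesis
        using v(1) norm_add_Pythagorean[of v "t *\<^sub>R y"] by (simp add: orthogonal_def power_mult_distrib)
    qed
    moreover have "(norm (X v + t *\<^sub>R X y))\<^sup>2 = (norm (X v))\<^sup>2 + 2 * t * b + t\<^sup>2 * (norm (X y))\<^sup>2"
      by (simp add: power2_norm_eq_inner b_def inner_add_left inner_add_right inner_commute algebra_simps)
        (simp add: power2_eq_square)
    ultimately have "2 * t * b + t\<^sup>2 * (norm (X y))\<^sup>2 \<le> t\<^sup>2 * (norm (X v) * norm y)\<^sup>2"
      by (simp add: algebra_simps power_mult_distrib)
    then have "2 * t * b \<le> t\<^sup>2 * (K - 1)"
      by (smt (verit) K_def mult_nonneg_nonneg zero_le_power2)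
    also have "\<dots> \<le> t\<^sup>2 * K" by (simp add: algebra_simps)
    finally have "2 * (b * b / K) \<le> b * b / K"
      using \<open>K > 0\<close> by (simp add: t_def power2_eq_square)
    moreover have "b * b / K > 0" using \<open>b \<noteq> 0\<close> \<open>K > 0\<close>
      by (intro divide_pos_pos) (auto simp: zero_less_mult_iff linorder_neq_iff)
    ultimately show False by linarith
  qed
  have "Re (cinner (X v) (X (\<i> *\<^sub>C y))) = 0"
    using y by (intro re) (auto simp: cinner_scaleC_left cinner_scaleC_right)
  then have "Im (cinner (X v) (X y)) = 0"
    by (simp add: lin(2) cinner_scaleC_right)
  with re[OF y] show ?thesis by (simp add: complex_eq_iff)
qed

section \<open>Singular value decompositions and singular values\<close>

text \<open>
  The right singular vectors are chosen greedily: \<open>v\<^sub>n\<close> maximizes \<open>\<parallel>X x\<parallel>\<close> over the unit vectors orthogonal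
  to \<open>v\<^sub>0, \<dots>, v\<^sub>n\<^sub>-\<^sub>1\<close>, and \<open>s\<^sub>n = \<parallel>X v\<^sub>n\<parallel>\<close>. The images \<open>X v\<^sub>n\<close> are orthogonal by the variational argument
  above, \<open>s\<^sub>n\<close> tends to 0 by compactness and the min-max bound, and \<open>X\<close> has norm at most \<open>s\<^sub>n\<close> on the
  remainder of the expansion of \<open>x\<close> after \<open>n\<close> terms. The sequence \<open>e\<close> makes the space infinite-dimensional,
  so that a next vector always exists.
\<close>

theorem compact_op_has_singular_value_decomposition:
  fixes X :: "'h::complex_hilbert \<Rightarrow> 'h" and e :: "nat \<Rightarrow> 'h"
  assumes X: "X \<in> bounded_operators" and comp: "compact_op X" and e: "orthonormal e"
  obtains s v u where "singular_value_decomposition X s v u"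
proof -
  note lin = bounded_operatorsD[OF X]
  define maximizer where "maximizer F w \<longleftrightarrow> norm w = 1 \<and> (\<forall>f\<in>F. cinner w f = 0) \<and>
     (\<forall>x. (\<forall>f\<in>F. cinner x f = 0) \<longrightarrow> norm (X x) \<le> norm (X w) * norm x)" for F w
  have "\<exists>w. finite F \<longrightarrow> maximizer F w" for F
  proof (cases "finite F")
    case True
    obtain c where c: "(\<Sum>i\<le>card F. c i *\<^sub>C e i) \<noteq> 0" "\<And>f. f \<in> F \<Longrightarrow> cinner (\<Sum>i\<le>card F. c i *\<^sub>C e i) f = 0"
      using orthonormal_span_meets_annihilator[OF e True order_refl] by blast
    define x where "x = (\<Sum>i\<le>card F. c i *\<^sub>C e i)"
    have "norm (complex_of_real (1 / norm x) *\<^sub>C x) = 1"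
      using c(1) by (simp add: norm_scaleC x_def norm_divide)
    moreover have "\<forall>f\<in>F. cinner (complex_of_real (1 / norm x) *\<^sub>C x) f = 0"
      using c(2) by (simp add: cinner_scaleC_left x_def)
    ultimately show ?thesis
      unfolding maximizer_def using compact_op_attains_norm[OF X comp, of F] by blast
  qed auto
  then obtain pick where pick: "\<And>F. finite F \<Longrightarrow> maximizer F (pick F)" by metis
  \<comment> \<open>The recursion carries the set to whose members the next vector must be orthogonal.\<close>
  define S where "S = rec_nat {} (\<lambda>_ F. insert (pick F) F)"
  define v where "v n = pick (S n)" for n
  have S: "S n = v ` {..<n}" for n
    by (induction n) (auto simp: S_def v_def lessThan_Suc)
  have max: "maximizer (v ` {..<n}) (v n)" for n
    unfolding S[symmetric] unfolding v_def[of n] by (rule pick) (simp add: S)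
  have v1: "norm (v n) = 1" for n using max[of n] by (simp add: maximizer_def)
  have v_lt: "cinner (v n) (v i) = 0" if "i < n" for i n
    using max[of n] that by (auto simp: maximizer_def)
  have v_ne: "cinner (v i) (v j) = 0" if "i \<noteq> j" for i j
    using v_lt[of i j] v_lt[of j i] cinner_eq_0_commute that by (cases i j rule: linorder_cases) auto
  have v: "orthonormal v"
    unfolding orthonormal_def using v_ne v1 by (auto simp: cinner_self)
  have le: "norm (X x) \<le> norm (X (v n)) * norm x" if "\<And>i. i < n \<Longrightarrow> cinner x (v i) = 0" for x n
    using max[of n] that by (auto simp: maximizer_def)
  define s where "s n = norm (X (v n))" for n
  have s0: "0 \<le> s n" for n by (simp add: s_def)
  have dec: "decseq s"
    unfolding decseq_Suc_iff s_def
  proof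
    fix n
    show "norm (X (v (Suc n))) \<le> norm (X (v n))"
      using le[of n "v (Suc n)"] v_lt[of _ "Suc n"] v1 by simp
  qed
  have Xorth_lt: "cinner (X (v i)) (X (v j)) = 0" if "i < j" for i j
  proof (rule maximizer_image_orthogonal[OF X, of "v i" "v ` {..<i}"])
    show "norm (X x) \<le> norm (X (v i)) * norm x" if "\<forall>f\<in>v ` {..<i}. cinner x f = 0" for x
      using that by (intro le) auto
  qed (use that v1 v_lt v_ne in auto)
  have Xorth: "cinner (X (v i)) (X (v j)) = 0" if "i \<noteq> j" for i j
    using Xorth_lt[of i j] Xorth_lt[of j i] cinner_eq_0_commute that by (cases i j rule: linorder_cases) auto
  define u where "u n = complex_of_real (1 / s n) *\<^sub>C X (v n)" for n
  have u1: "norm (u n) = 1" if "s n \<noteq> 0" for n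
    using that s0[of n] by (simp add: u_def norm_scaleC norm_divide) (simp add: s_def)
  have u_zero: "u n = 0" if "s n = 0" for n using that by (simp add: u_def s_def)
  have u: "contractive_orthogonal u"
    unfolding contractive_orthogonal_def
  proof (intro conjI allI impI)
    show "cinner (u i) (u j) = 0" if "i \<noteq> j" for i j
      using Xorth[OF that] by (simp add: u_def cinner_scaleC_left cinner_scaleC_right)
    show "norm (u i) \<le> 1" for i using u1[of i] u_zero[of i] by (cases "s i = 0") auto
  qed
  have Xv: "X (v n) = complex_of_real (s n) *\<^sub>C u n" for n
    by (cases "s n = 0") (auto simp: u_def scaleC_scaleC scaleC_one s_def)
  have "s \<longlonglongrightarrow> 0"
  proof (rule LIMSEQ_I)
    fix r :: real assume "r > 0"
    then obtain F where F: "finite F" "\<And>x. (\<forall>f\<in>F. cinner x f = 0) \<Longrightarrow> norm (X x) \<le> r / 2 * norm x"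
      using comp unfolding compact_op_def by (metis half_gt_zero_iff)
    have "s n \<le> r / 2" if "n \<ge> card F" for n
      using singular_value_le[OF X v u Xv dec s0 u1 F(1) that] F(2) by blast
    then have "norm (s n - 0) < r" if "n \<ge> card F" for n
      using that s0[of n] \<open>r > 0\<close> by fastforce
    then show "\<exists>no. \<forall>n\<ge>no. norm (s n - 0) < r" by blast
  qed
  then have s: "s \<in> c0_star" using s0 dec by (simp add: c0_star_def)
  have "X x = diag_op s v u x" for x
  proof -
    define p where "p n = (\<Sum>i<n. cinner x (v i) *\<^sub>C v i)" for n
    have Xp: "X (p n) = (\<Sum>i<n. (complex_of_real (s i) * cinner x (v i)) *\<^sub>C u i)" for n
      unfolding p_def using lin Xv
      by (simp add: linear_sum bounded_linear.linear scaleC_scaleC mult.commute)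
    have bound: "norm (X x - X (p n)) \<le> s n * (2 * norm x)" for n
    proof -
      have "cinner (x - p n) (v i) = 0" if "i < n" for i
      proof -
        have "(\<Sum>j<n. cinner x (v j) * cinner (v j) (v i)) = (\<Sum>j<n. if j = i then cinner x (v i) else 0)"
          using v by (intro sum.cong) (auto simp: orthonormal_def)
        then show ?thesis using that by (simp add: p_def cinner_diff_left cinner_sum_left cinner_scaleC_left)
      qed
      then have "norm (X (x - p n)) \<le> s n * norm (x - p n)" unfolding s_def by (rule le)
      also have "\<dots> \<le> s n * (2 * norm x)"
      proof (rule mult_left_mono[OF _ s0])
        have "(norm (p n))\<^sup>2 \<le> (norm x)\<^sup>2"
          unfolding p_def
          by (rule order_trans[OF norm_sum_orthogonal_le[OF orthonormal_contractive[OF v] finite_lessThan]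
                Bessel_finite[OF orthonormal_contractive[OF v] finite_lessThan]])
        then have "norm (p n) \<le> norm x" by (rule power2_le_imp_le) simp
        then show "norm (x - p n) \<le> 2 * norm x" using norm_triangle_ineq4[of x "p n"] by linarith
      qed
      finally show ?thesis using lin(1) by (simp add: linear_diff bounded_linear.linear)
    qed
    have "(\<lambda>n. X x - X (p n)) \<longlonglongrightarrow> 0"
    proof (rule Lim_null_comparison)
      show "\<forall>\<^sub>F n in sequentially. norm (X x - X (p n)) \<le> s n * (2 * norm x)"
        using bound by (auto intro: always_eventually)
      show "(\<lambda>n. s n * (2 * norm x)) \<longlonglongrightarrow> 0"
        by (rule tendsto_mult_left_zero[OF \<open>s \<longlonglongrightarrow> 0\<close>])
    qed
    then have "(\<lambda>n. X x - (X x - X (p n))) \<longlonglongrightarrow> X x - 0" by (intro tendsto_diff tendsto_const)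
    then have "(\<lambda>n. (complex_of_real (s n) * cinner x (v n)) *\<^sub>C u n) sums X x"
      unfolding sums_def Xp[symmetric] by simp
    then show ?thesis
      using sums_unique2 diag_op_sums[OF c0_star_Bseq[OF s] orthonormal_contractive[OF v] u] by blast
  qed
  then have "singular_value_decomposition X s v u"
    unfolding singular_value_decomposition_def using s v u u1 by auto
  then show thesis by (rule that)
qed

lemma c0_star_level_finite:
  assumes "\<xi> \<in> c0_star" "0 < \<sigma>"
  shows "finite {n. \<xi> n = \<sigma>}"
proof -
  obtain N where "\<And>n. n \<ge> N \<Longrightarrow> \<xi> n < \<sigma>"
    using order_tendstoD(2)[OF c0_star_tendsto[OF assms(1)] assms(2)] by (auto simp: eventually_sequentially)
  then have "{n. \<xi> n = \<sigma>} \<subseteq> {..<N}" by (metis (mono_tags) lessThan_iff mem_Collect_eq not_less order_less_irrefl subsetI)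
  then show ?thesis using finite_subset by blast
qed

text \<open>
  At the first index where the two sequences differ, the larger of the two values is taken more often by
  the sequence that has it there, because the other one has already dropped below it.
\<close>

lemma c0_star_eqI_level_card:
  assumes \<xi>: "\<xi> \<in> c0_star" and \<eta>: "\<eta> \<in> c0_star"
    and card: "\<And>\<sigma>. 0 < \<sigma> \<Longrightarrow> card {n. \<xi> n = \<sigma>} = card {n. \<eta> n = \<sigma>}"
  shows "\<xi> = \<eta>"
proof -
  have no_gap: "\<not> \<eta> n < \<xi> n"
    if \<xi>: "\<xi> \<in> c0_star" and \<eta>: "\<eta> \<in> c0_star" and eq: "\<And>k. k < n \<Longrightarrow> \<xi> k = \<eta> k"
      and card: "\<And>\<sigma>. 0 < \<sigma> \<Longrightarrow> card {n. \<xi> n = \<sigma>} = card {n. \<eta> n = \<sigma>}" for \<xi> \<eta> n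
  proof
    assume lt: "\<eta> n < \<xi> n"
    then have pos: "0 < \<xi> n" using c0_star_nonneg[OF \<eta>, of n] by linarith
    have "{k. \<eta> k = \<xi> n} \<subset> {k. \<xi> k = \<xi> n}"
    proof
      show "{k. \<eta> k = \<xi> n} \<subseteq> {k. \<xi> k = \<xi> n}"
      proof
        fix k assume k: "k \<in> {k. \<eta> k = \<xi> n}"
        then have "k < n" using lt c0_star_antimono[OF \<eta>, of n k] by (cases "k < n") auto
        then show "k \<in> {k. \<xi> k = \<xi> n}" using k eq by simp
      qed
      show "{k. \<eta> k = \<xi> n} \<noteq> {k. \<xi> k = \<xi> n}" using lt by (auto simp: set_eq_iff intro!: exI[of _ n])
    qed
    then have "card {k. \<eta> k = \<xi> n} < card {k. \<xi> k = \<xi> n}"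
      by (rule psubset_card_mono[OF c0_star_level_finite[OF \<xi> pos]])
    then show False using card[OF pos] by simp
  qed
  have "\<xi> n = \<eta> n" for n
  proof (induction n rule: less_induct)
    case (less n)
    have "\<not> \<eta> n < \<xi> n" by (rule no_gap[OF \<xi> \<eta>]) (use less card in auto)
    moreover have "\<not> \<xi> n < \<eta> n" by (rule no_gap[OF \<eta> \<xi>]) (use less card in auto)
    ultimately show ?case by simp
  qed
  then show ?thesis by auto
qed

lemma orthonormal_inj: "orthonormal v \<Longrightarrow> inj v"
  unfolding orthonormal_def inj_def by (metis zero_neq_one)

lemma orthonormal_independent:
  fixes v :: "nat \<Rightarrow> 'h::complex_hilbert"
  assumes "orthonormal v" "finite A"
  shows "cvec.independent (v ` A)"
proof
  assume "cvec.dependent (v ` A)"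
  then obtain c where c: "\<exists>x\<in>v ` A. c x \<noteq> 0" "(\<Sum>x\<in>v ` A. c x *\<^sub>C x) = 0"
    using cvec.dependent_finite[of "v ` A"] assms(2) by auto
  have "c (v i) = 0" if "i \<in> A" for i
  proof -
    have "0 = cinner (\<Sum>x\<in>v ` A. c x *\<^sub>C x) (v i)" by (simp add: c(2))
    also have "\<dots> = (\<Sum>j\<in>A. c (v j) * cinner (v j) (v i))"
      using inj_on_subset[OF orthonormal_inj[OF assms(1)], of A]
      by (simp add: sum.reindex cinner_sum_left cinner_scaleC_left)
    also have "\<dots> = (\<Sum>j\<in>A. if j = i then c (v i) else 0)"
      using assms(1) by (intro sum.cong) (auto simp: orthonormal_def)
    also have "\<dots> = c (v i)" using that assms(2) by simp
    finally show ?thesis by simp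
  qed
  then show False using c(1) by blast
qed

text \<open>
  Here \<open>X\<^sup>* X = \<Sum> s\<^sub>n\<^sup>2 \<langle>\<cdot>, v\<^sub>n\<rangle> v\<^sub>n\<close>. Comparing coefficients, an eigenvector for \<open>\<sigma>\<^sup>2\<close> has components only
  along the \<open>v\<^sub>n\<close> with \<open>s\<^sub>n = \<sigma>\<close>, and since \<open>\<sigma> > 0\<close> it is the sum of these components.
\<close>

lemma singular_eigenspace_diag_op:
  fixes v :: "nat \<Rightarrow> 'h::complex_hilbert"
  assumes svd: "singular_value_decomposition X s v u" and \<sigma>: "0 < \<sigma>"
  shows "singular_eigenspace X \<sigma> = cvec.span (v ` {n. s n = \<sigma>})"
proof -
  have s: "s \<in> c0_star" and v: "orthonormal v" and u: "contractive_orthogonal u"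
    and u1: "\<And>n. s n \<noteq> 0 \<Longrightarrow> norm (u n) = 1" and X: "X = diag_op s v u"
    using svd by (auto simp: singular_value_decomposition_def)
  note Bs = c0_star_Bseq[OF s] and vc = orthonormal_contractive[OF v]
  have adj: "cadjoint X = diag_op s u v"
    unfolding X by (rule cadjoint_eqI) (rule diag_op_adjoint[OF Bs vc u])
  have XX: "cadjoint X (X x) = diag_op (\<lambda>n. (s n)\<^sup>2) v v x" for x
  proof -
    have "diag_op s u v (diag_op s v u x) = diag_op (\<lambda>n. s n * s n) v v x"
      by (rule diag_op_comp[OF Bs vc u]) (use u1 in auto)
    then show ?thesis unfolding adj by (simp add: X power2_eq_square)
  qed
  have Bs2: "Bseq (\<lambda>n. (s n)\<^sup>2)" using Bseq_mult[OF Bs Bs] by (simp add: power2_eq_square)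
  define A where "A = {n. s n = \<sigma>}"
  have A: "finite A" unfolding A_def by (rule c0_star_level_finite[OF s \<sigma>])
  show ?thesis unfolding A_def[symmetric]
  proof (intro equalityI subsetI)
    fix x assume "x \<in> singular_eigenspace X \<sigma>"
    then have ev: "diag_op (\<lambda>n. (s n)\<^sup>2) v v x = complex_of_real (\<sigma>\<^sup>2) *\<^sub>C x"
      by (simp add: singular_eigenspace_def XX)
    have coeff: "cinner x (v n) = 0" if "n \<notin> A" for n
    proof -
      have "complex_of_real ((s n)\<^sup>2) * cinner x (v n) = complex_of_real (\<sigma>\<^sup>2) * cinner x (v n)"
        using cinner_diag_op_component[OF Bs2 vc vc, of x n] orthonormal_norm[OF v, of n]
        by (auto simp: ev cinner_scaleC_left)
      moreover have "(s n)\<^sup>2 \<noteq> \<sigma>\<^sup>2"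
        using that c0_star_nonneg[OF s, of n] \<sigma> by (auto simp: A_def power2_eq_iff)
      then have "complex_of_real ((s n)\<^sup>2) \<noteq> complex_of_real (\<sigma>\<^sup>2)" by (metis of_real_eq_iff)
      ultimately show ?thesis by auto
    qed
    have "complex_of_real (\<sigma>\<^sup>2) *\<^sub>C x = (\<Sum>n\<in>A. (complex_of_real ((s n)\<^sup>2) * cinner x (v n)) *\<^sub>C v n)"
      unfolding ev[symmetric] diag_op_def using A coeff by (intro suminf_finite) auto
    also have "\<dots> \<in> cvec.span (v ` A)"
      by (intro cvec.span_sum cvec.span_scale cvec.span_base) auto
    finally have "complex_of_real (1 / \<sigma>\<^sup>2) *\<^sub>C complex_of_real (\<sigma>\<^sup>2) *\<^sub>C x \<in> cvec.span (v ` A)"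
      by (rule cvec.span_scale)
    then show "x \<in> cvec.span (v ` A)" using \<sigma> by (simp add: scaleC_scaleC scaleC_one)
  next
    fix x assume "x \<in> cvec.span (v ` A)"
    moreover have "v ` A \<subseteq> singular_eigenspace X \<sigma>"
    proof
      fix y assume "y \<in> v ` A"
      then obtain n where "y = v n" "s n = \<sigma>" by (auto simp: A_def)
      then show "y \<in> singular_eigenspace X \<sigma>"
        by (simp add: singular_eigenspace_def XX diag_op_apply[OF v])
    qed
    moreover have "cvec.subspace (singular_eigenspace X \<sigma>)"
    proof (rule cvec.subspaceI)
      note lin = bounded_operatorsD[OF diag_op_bounded_operators[OF Bs2 vc vc]]
      show "0 \<in> singular_eigenspace X \<sigma>"
        using lin(1) by (simp add: singular_eigenspace_def XX linear_0 bounded_linear.linear)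
      show "x + y \<in> singular_eigenspace X \<sigma>" if "x \<in> singular_eigenspace X \<sigma>" "y \<in> singular_eigenspace X \<sigma>" for x y
        using that lin(1) by (simp add: singular_eigenspace_def XX linear_add bounded_linear.linear scaleC_add_right)
      show "c *\<^sub>C x \<in> singular_eigenspace X \<sigma>" if "x \<in> singular_eigenspace X \<sigma>" for c x
        using that lin(2) by (simp add: singular_eigenspace_def XX scaleC_scaleC mult.commute)
    qed
    ultimately show "x \<in> singular_eigenspace X \<sigma>" using cvec.span_minimal by blast
  qed
qed

text \<open>
  The eigenspace for \<open>\<sigma>\<^sup>2\<close> is spanned by the \<open>v\<^sub>n\<close> with \<open>s\<^sub>n = \<sigma>\<close>, so its dimension counts these indices,
  and the counts determine the sequence.
\<close>

theorem s_numbers_eq: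
  assumes svd: "singular_value_decomposition X s v u"
  shows "s_numbers X = s"
proof -
  have s: "s \<in> c0_star" and v: "orthonormal v"
    using svd by (auto simp: singular_value_decomposition_def)
  have dim: "card {n. s n = \<sigma>} = cvec.dim (singular_eigenspace X \<sigma>)" if "0 < \<sigma>" for \<sigma>
  proof -
    have fin: "finite {n. s n = \<sigma>}" by (rule c0_star_level_finite[OF s that])
    have "cvec.dim (singular_eigenspace X \<sigma>) = card (v ` {n. s n = \<sigma>})"
      unfolding singular_eigenspace_diag_op[OF svd that]
      by (rule cvec.dim_span_eq_card_independent[OF orthonormal_independent[OF v fin]])
    also have "\<dots> = card {n. s n = \<sigma>}"
      by (rule card_image) (rule inj_on_subset[OF orthonormal_inj[OF v]], simp)
    finally show ?thesis by simp
  qed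
  show ?thesis
    unfolding s_numbers_def
  proof (rule the_equality)
    show "s \<in> c0_star \<and> (\<forall>\<sigma>>0. card {n. s n = \<sigma>} = cvec.dim (singular_eigenspace X \<sigma>))"
      using s dim by blast
    fix \<xi> assume "\<xi> \<in> c0_star \<and> (\<forall>\<sigma>>0. card {n. \<xi> n = \<sigma>} = cvec.dim (singular_eigenspace X \<sigma>))"
    then show "\<xi> = s" using s dim by (intro c0_star_eqI_level_card) auto
  qed
qed

text \<open>
  The upper half of the min-max principle; the lower half follows it.
\<close>

lemma singular_value_decomposition_norm_le:
  assumes svd: "singular_value_decomposition X s v u" and x: "\<And>i. i < n \<Longrightarrow> cinner x (v i) = 0"
  shows "norm (X x) \<le> s n * norm x"
proof -
  have s: "s \<in> c0_star" and v: "orthonormal v" and u: "contractive_orthogonal u" and X: "X = diag_op s v u"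
    using svd by (auto simp: singular_value_decomposition_def)
  have "\<bar>s k\<bar> \<le> s n \<or> cinner x (v k) = 0" for k
    using x[of k] c0_star_antimono[OF s, of n k] c0_star_nonneg[OF s, of k] by (cases "k < n") auto
  then have "norm (diag_op s v u x) \<le> s n * norm x"
    by (rule norm_diag_op_le[OF c0_star_Bseq[OF s] orthonormal_contractive[OF v] u c0_star_nonneg[OF s]])
  then show ?thesis using X by simp
qed

lemma singular_value_decomposition_le:
  assumes svd: "singular_value_decomposition X s v u" and F: "finite F" "card F \<le> n"
    and le: "\<And>x. (\<And>f. f \<in> F \<Longrightarrow> cinner x f = 0) \<Longrightarrow> norm (X x) \<le> C * norm x"
  shows "s n \<le> C"
proof (rule singular_value_le[OF _ _ _ _ _ _ _ F le])
  have *: "s \<in> c0_star" "orthonormal v" "contractive_orthogonal u" "X = diag_op s v u"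
    using svd by (auto simp: singular_value_decomposition_def)
  show "X \<in> bounded_operators"
    unfolding *(4) by (intro diag_op_bounded_operators c0_star_Bseq orthonormal_contractive *)
  show "orthonormal v" "contractive_orthogonal u" by fact+
  show "X (v i) = complex_of_real (s i) *\<^sub>C u i" for i
    unfolding *(4) by (rule diag_op_apply[OF *(2)])
  show "decseq s" "0 \<le> s i" for i using *(1) by (auto simp: c0_star_def)
  show "norm (u i) = 1" if "s i \<noteq> 0" for i using svd that by (simp add: singular_value_decomposition_def)
qed

section \<open>Compact operators and ring ideals\<close>

definition compact_operators :: "('h::complex_hilbert \<Rightarrow> 'h) set" where
  "compact_operators = {X \<in> bounded_operators. compact_op X}"

lemma compact_operators_bounded: "X \<in> compact_operators \<Longrightarrow> X \<in> bounded_operators"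
  by (simp add: compact_operators_def)

lemma singular_value_decomposition_compact:
  fixes X :: "'h::complex_hilbert \<Rightarrow> 'h"
  assumes svd: "singular_value_decomposition X s v u"
  shows "X \<in> compact_operators"
proof -
  have s: "s \<in> c0_star" using svd by (simp add: singular_value_decomposition_def)
  have "compact_op X"
    unfolding compact_op_def
  proof (intro allI impI)
    fix \<epsilon> :: real assume "\<epsilon> > 0"
    then obtain n where "s n < \<epsilon>"
      using order_tendstoD(2)[OF c0_star_tendsto[OF s], of \<epsilon>] by (auto simp: eventually_sequentially)
    have "norm (X x) \<le> \<epsilon> * norm x" if "\<forall>f\<in>v ` {..<n}. cinner x f = 0" for x
    proof -
      have "norm (X x) \<le> s n * norm x" using singular_value_decomposition_norm_le[OF svd] that by auto
      also have "\<dots> \<le> \<epsilon> * norm x" using \<open>s n < \<epsilon>\<close> by (intro mult_right_mono) auto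
      finally show ?thesis .
    qed
    then show "\<exists>F. finite F \<and> (\<forall>x. (\<forall>f\<in>F. cinner x f = 0) \<longrightarrow> norm (X x) \<le> \<epsilon> * norm x)"
      by (intro exI[of _ "v ` {..<n}"]) auto
  qed
  moreover have "X \<in> bounded_operators"
    using svd unfolding singular_value_decomposition_def
    by (auto intro!: diag_op_bounded_operators c0_star_Bseq orthonormal_contractive)
  ultimately show ?thesis by (simp add: compact_operators_def)
qed

lemma compact_operators_add:
  fixes X :: "'h::complex_hilbert \<Rightarrow> 'h"
  assumes "X \<in> compact_operators" "Y \<in> compact_operators"
  shows "(\<lambda>v. X v + Y v) \<in> compact_operators"
proof -
  have "compact_op (\<lambda>v. X v + Y v)"
    unfolding compact_op_def
  proof (intro allI impI)
    fix \<epsilon> :: real assume "\<epsilon> > 0"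
    then have "\<epsilon> / 2 > 0" by simp
    then obtain F G where F: "finite F" "\<And>x. (\<forall>f\<in>F. cinner x f = 0) \<Longrightarrow> norm (X x) \<le> \<epsilon> / 2 * norm x"
      and G: "finite G" "\<And>x. (\<forall>f\<in>G. cinner x f = 0) \<Longrightarrow> norm (Y x) \<le> \<epsilon> / 2 * norm x"
      using assms unfolding compact_operators_def compact_op_def by blast
    have "norm (X x + Y x) \<le> \<epsilon> * norm x" if "\<forall>f\<in>F \<union> G. cinner x f = 0" for x
      using F(2)[of x] G(2)[of x] that norm_triangle_ineq[of "X x" "Y x"] by auto
    then show "\<exists>F. finite F \<and> (\<forall>x. (\<forall>f\<in>F. cinner x f = 0) \<longrightarrow> norm (X x + Y x) \<le> \<epsilon> * norm x)"
      using F(1) G(1) by (intro exI[of _ "F \<union> G"]) auto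
  qed
  then show ?thesis using assms by (simp add: compact_operators_def bounded_operators_add)
qed

lemma compact_operators_comp_left:
  fixes X :: "'h::complex_hilbert \<Rightarrow> 'h"
  assumes X: "X \<in> compact_operators" and A: "A \<in> bounded_operators"
  shows "A \<circ> X \<in> compact_operators"
proof -
  obtain K where K: "0 < K" "\<And>x. norm (A x) \<le> K * norm x"
    using bounded_operators_norm[OF A] by blast
  have "compact_op (A \<circ> X)"
    unfolding compact_op_def
  proof (intro allI impI)
    fix \<epsilon> :: real assume "\<epsilon> > 0"
    then have "\<epsilon> / K > 0" using K by simp
    then obtain F where F: "finite F" "\<And>x. (\<forall>f\<in>F. cinner x f = 0) \<Longrightarrow> norm (X x) \<le> \<epsilon> / K * norm x"
      using X unfolding compact_operators_def compact_op_def by blast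
    have "norm ((A \<circ> X) x) \<le> \<epsilon> * norm x" if "\<forall>f\<in>F. cinner x f = 0" for x
    proof -
      have "norm ((A \<circ> X) x) \<le> K * (\<epsilon> / K * norm x)"
        using K(2)[of "X x"] mult_left_mono[OF F(2)[OF that], of K] K(1) by simp
      then show ?thesis using K(1) by simp
    qed
    then show "\<exists>F. finite F \<and> (\<forall>x. (\<forall>f\<in>F. cinner x f = 0) \<longrightarrow> norm ((A \<circ> X) x) \<le> \<epsilon> * norm x)"
      using F(1) by blast
  qed
  then show ?thesis using assms by (simp add: compact_operators_def bounded_operators_comp)
qed

lemma BH_ring: "ring (BH :: ('h::complex_hilbert \<Rightarrow> 'h) ring)"
proof (rule ringI)
  show "abelian_group (BH :: ('h \<Rightarrow> 'h) ring)"
  proof (rule abelian_groupI)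
    show "\<exists>y\<in>carrier BH. y \<oplus>\<^bsub>BH\<^esub> x = \<zero>\<^bsub>BH\<^esub>" if "x \<in> carrier BH" for x :: "'h \<Rightarrow> 'h"
      using that by (auto simp: BH_def bounded_operators_uminus intro!: bexI[of _ "\<lambda>v. - x v"])
  qed (auto simp: BH_def bounded_operators_add bounded_operators_zero add_ac)
  show "Group.monoid (BH :: ('h \<Rightarrow> 'h) ring)"
    by (rule Group.monoidI) (auto simp: BH_def bounded_operators_comp bounded_operators_id o_assoc)
  show "(x \<oplus>\<^bsub>BH\<^esub> y) \<otimes>\<^bsub>BH\<^esub> z = x \<otimes>\<^bsub>BH\<^esub> z \<oplus>\<^bsub>BH\<^esub> y \<otimes>\<^bsub>BH\<^esub> z" for x y z :: "'h \<Rightarrow> 'h"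
    by (simp add: BH_def fun_eq_iff)
  show "z \<otimes>\<^bsub>BH\<^esub> (x \<oplus>\<^bsub>BH\<^esub> y) = z \<otimes>\<^bsub>BH\<^esub> x \<oplus>\<^bsub>BH\<^esub> z \<otimes>\<^bsub>BH\<^esub> y"
    if "x \<in> carrier BH" "y \<in> carrier BH" "z \<in> carrier BH" for x y z :: "'h \<Rightarrow> 'h"
    using that by (auto simp: BH_def fun_eq_iff linear_add bounded_linear.linear dest!: bounded_operatorsD(1))
qed

lemma operator_idealI:
  fixes I :: "('h::complex_hilbert \<Rightarrow> 'h) set"
  assumes sub: "I \<subseteq> bounded_operators" and zero: "(\<lambda>v. 0) \<in> I"
    and add: "\<And>X Y. X \<in> I \<Longrightarrow> Y \<in> I \<Longrightarrow> (\<lambda>v. X v + Y v) \<in> I"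
    and left: "\<And>A X. A \<in> bounded_operators \<Longrightarrow> X \<in> I \<Longrightarrow> A \<circ> X \<in> I"
    and right: "\<And>A X. A \<in> bounded_operators \<Longrightarrow> X \<in> I \<Longrightarrow> X \<circ> A \<in> I"
    and proper: "id \<notin> I"
  shows "operator_ideal I"
  unfolding operator_ideal_def
proof
  interpret ring "BH :: ('h \<Rightarrow> 'h) ring" by (rule BH_ring)
  show "ideal I BH"
  proof (rule idealI[OF BH_ring])
    show "subgroup I (add_monoid BH)"
    proof (rule group.subgroupI[OF a_group])
      show "I \<subseteq> carrier (add_monoid BH)" using sub by (simp add: BH_def)
      show "I \<noteq> {}" using zero by blast
      show "X \<otimes>\<^bsub>add_monoid BH\<^esub> Y \<in> I" if "X \<in> I" "Y \<in> I" for X Y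
        using add[OF that] by (simp add: BH_def)
      show "inv\<^bsub>add_monoid BH\<^esub> X \<in> I" if "X \<in> I" for X
      proof -
        have X: "X \<in> bounded_operators" using that sub by blast
        have "(\<lambda>v. - v) \<circ> X \<in> I"
          using left[OF bounded_operators_uminus[OF bounded_operators_id] that] by simp
        then have neg: "(\<lambda>v. - X v) \<in> I" by (simp add: o_def)
        have "\<ominus>\<^bsub>BH\<^esub> X = (\<lambda>v. - X v)"
          using X by (intro minus_equality) (auto simp: BH_def bounded_operators_uminus)
        then show ?thesis using neg by (simp add: a_inv_def)
      qed
    qed
    show "A \<otimes>\<^bsub>BH\<^esub> X \<in> I" "X \<otimes>\<^bsub>BH\<^esub> A \<in> I" if "X \<in> I" "A \<in> carrier BH" for X A
      using left right that by (auto simp: BH_def)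
  qed
  show "I \<noteq> bounded_operators" using proper bounded_operators_id by blast
qed

lemma operator_idealD:
  fixes I :: "('h::complex_hilbert \<Rightarrow> 'h) set"
  assumes "operator_ideal I"
  shows "I \<subseteq> bounded_operators" and "(\<lambda>v. 0) \<in> I"
    and "\<And>X Y. X \<in> I \<Longrightarrow> Y \<in> I \<Longrightarrow> (\<lambda>v. X v + Y v) \<in> I"
    and "\<And>A X. A \<in> bounded_operators \<Longrightarrow> X \<in> I \<Longrightarrow> A \<circ> X \<in> I"
    and "\<And>A X. A \<in> bounded_operators \<Longrightarrow> X \<in> I \<Longrightarrow> X \<circ> A \<in> I"
    and "id \<notin> I"
proof -
  interpret ideal I BH using assms by (simp add: operator_ideal_def)
  show sub: "I \<subseteq> bounded_operators" using a_subset by (simp add: BH_def)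
  show "(\<lambda>v. 0) \<in> I" using additive_subgroup.zero_closed[OF is_additive_subgroup] by (simp add: BH_def)
  show "(\<lambda>v. X v + Y v) \<in> I" if "X \<in> I" "Y \<in> I" for X Y
    using additive_subgroup.a_closed[OF is_additive_subgroup that] by (simp add: BH_def)
  show "A \<circ> X \<in> I" if "A \<in> bounded_operators" "X \<in> I" for A X
    using I_l_closed[of X A] that by (simp add: BH_def)
  show right: "X \<circ> A \<in> I" if "A \<in> bounded_operators" "X \<in> I" for A X
    using I_r_closed[of X A] that by (simp add: BH_def)
  show "id \<notin> I"
  proof
    assume "id \<in> I"
    then have "A \<in> I" if "A \<in> bounded_operators" for A using right[OF that] by fastforce
    then show False using sub assms by (auto simp: operator_ideal_def)
  qed
qed

section \<open>Calkin's correspondence\<close>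

locale hilbert_basis =
  fixes e :: "nat \<Rightarrow> 'h::complex_hilbert"
  assumes basis: "orthonormal_basis e"
begin

lemma orthonormal_e: "orthonormal e" and contractive_e: "contractive_orthogonal e"
  using basis by (auto simp: orthonormal_basis_def orthonormal_contractive)

lemma compact_operator_svd:
  fixes X :: "'h \<Rightarrow> 'h"
  assumes "X \<in> compact_operators"
  obtains v u where "singular_value_decomposition X (s_numbers X) v u"
  using compact_op_has_singular_value_decomposition[of X e] assms orthonormal_e s_numbers_eq
  unfolding compact_operators_def by (metis (no_types, lifting) mem_Collect_eq)

lemma s_numbers_c0_star:
  fixes X :: "'h \<Rightarrow> 'h"
  assumes "X \<in> compact_operators"
  shows "s_numbers X \<in> c0_star"
  using compact_operator_svd[OF assms] by (metis singular_value_decomposition_def)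

lemma s_numbers_le:
  fixes X :: "'h \<Rightarrow> 'h"
  assumes "X \<in> compact_operators" "finite F" "card F \<le> n"
    and "\<And>x. (\<And>f. f \<in> F \<Longrightarrow> cinner x f = 0) \<Longrightarrow> norm (X x) \<le> C * norm x"
  shows "s_numbers X n \<le> C"
  using compact_operator_svd[OF assms(1)] singular_value_decomposition_le[OF _ assms(2-4)] by metis

lemma s_numbers_bound:
  fixes X :: "'h \<Rightarrow> 'h"
  assumes "X \<in> compact_operators"
  obtains F where "finite F" "card F \<le> n"
    "\<And>x. (\<And>f. f \<in> F \<Longrightarrow> cinner x f = 0) \<Longrightarrow> norm (X x) \<le> s_numbers X n * norm x"
proof -
  obtain v u where svd: "singular_value_decomposition X (s_numbers X) v u"
    using compact_operator_svd[OF assms] .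
  show thesis
  proof (rule that[of "v ` {..<n}"])
    show "card (v ` {..<n}) \<le> n" using card_image_le[of "{..<n}" v] by simp
    show "norm (X x) \<le> s_numbers X n * norm x" if "\<And>f. f \<in> v ` {..<n} \<Longrightarrow> cinner x f = 0" for x
      using that by (intro singular_value_decomposition_norm_le[OF svd]) auto
  qed simp
qed

text \<open>
  Off the union of two sets witnessing the singular values of \<open>X\<close> and \<open>Y\<close>, the two bounds add up.
\<close>

lemma s_numbers_add:
  fixes X :: "'h \<Rightarrow> 'h"
  assumes "X \<in> compact_operators" "Y \<in> compact_operators"
  shows "s_numbers (\<lambda>v. X v + Y v) (m + n) \<le> s_numbers X m + s_numbers Y n"
proof -
  obtain F where F: "finite F" "card F \<le> m"
    "\<And>x. (\<And>f. f \<in> F \<Longrightarrow> cinner x f = 0) \<Longrightarrow> norm (X x) \<le> s_numbers X m * norm x"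
    using s_numbers_bound[OF assms(1)] by blast
  obtain G where G: "finite G" "card G \<le> n"
    "\<And>x. (\<And>f. f \<in> G \<Longrightarrow> cinner x f = 0) \<Longrightarrow> norm (Y x) \<le> s_numbers Y n * norm x"
    using s_numbers_bound[OF assms(2)] by blast
  show ?thesis
  proof (rule s_numbers_le[OF compact_operators_add[OF assms], of "F \<union> G"])
    show "card (F \<union> G) \<le> m + n" using card_Un_le[of F G] F(2) G(2) by linarith
    show "norm (X x + Y x) \<le> (s_numbers X m + s_numbers Y n) * norm x"
      if "\<And>f. f \<in> F \<union> G \<Longrightarrow> cinner x f = 0" for x
      using F(3)[of x] G(3)[of x] that norm_triangle_ineq[of "X x" "Y x"] by (simp add: distrib_right)
  qed (use F G in auto)
qed

lemma s_numbers_comp_left: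
  fixes X :: "'h \<Rightarrow> 'h"
  assumes X: "X \<in> compact_operators" and A: "A \<in> bounded_operators"
    and K: "0 < K" "\<And>x. norm (A x) \<le> K * norm x"
  shows "s_numbers (A \<circ> X) n \<le> K * s_numbers X n"
proof -
  obtain F where F: "finite F" "card F \<le> n"
    "\<And>x. (\<And>f. f \<in> F \<Longrightarrow> cinner x f = 0) \<Longrightarrow> norm (X x) \<le> s_numbers X n * norm x"
    using s_numbers_bound[OF X] by blast
  show ?thesis
  proof (rule s_numbers_le[OF compact_operators_comp_left[OF X A] F(1,2)])
    show "norm ((A \<circ> X) x) \<le> K * s_numbers X n * norm x" if "\<And>f. f \<in> F \<Longrightarrow> cinner x f = 0" for x
    proof -
      have "norm (A (X x)) \<le> K * norm (X x)" by (rule K)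
      also have "\<dots> \<le> K * (s_numbers X n * norm x)" using F(3)[OF that] K(1) by (intro mult_left_mono) auto
      finally show ?thesis by (simp add: mult.assoc)
    qed
  qed
qed

lemma comp_right_annihilator:
  fixes A :: "'h \<Rightarrow> 'h"
  assumes A: "A \<in> bounded_operators" and F: "finite F"
  obtains G where "finite G" "card G \<le> card F"
    "\<And>x f. (\<And>g. g \<in> G \<Longrightarrow> cinner x g = 0) \<Longrightarrow> f \<in> F \<Longrightarrow> cinner (A x) f = 0"
proof -
  obtain B where B: "\<And>v w. cinner (A v) w = cinner v (B w)"
    by (rule adjoint_exists[OF basis A]) (rule that)
  show thesis by (rule that[of "B ` F"]) (use F B in \<open>auto simp: card_image_le\<close>)
qed

lemma compact_operators_comp_right:
  fixes X :: "'h \<Rightarrow> 'h"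
  assumes X: "X \<in> compact_operators" and A: "A \<in> bounded_operators"
  shows "X \<circ> A \<in> compact_operators"
proof -
  obtain K where K: "0 < K" "\<And>x. norm (A x) \<le> K * norm x"
    using bounded_operators_norm[OF A] by blast
  have "compact_op (X \<circ> A)"
    unfolding compact_op_def
  proof (intro allI impI)
    fix \<epsilon> :: real assume "\<epsilon> > 0"
    then have "\<epsilon> / K > 0" using K by simp
    then obtain F where F: "finite F" "\<And>x. (\<forall>f\<in>F. cinner x f = 0) \<Longrightarrow> norm (X x) \<le> \<epsilon> / K * norm x"
      using X unfolding compact_operators_def compact_op_def by blast
    obtain G where G: "finite G" "\<And>x f. (\<And>g. g \<in> G \<Longrightarrow> cinner x g = 0) \<Longrightarrow> f \<in> F \<Longrightarrow> cinner (A x) f = 0"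
      using comp_right_annihilator[OF A F(1)] by metis
    have "norm ((X \<circ> A) x) \<le> \<epsilon> * norm x" if "\<forall>g\<in>G. cinner x g = 0" for x
    proof -
      have "norm (X (A x)) \<le> \<epsilon> / K * norm (A x)" using G(2) that by (intro F(2)) auto
      also have "\<dots> \<le> \<epsilon> / K * (K * norm x)" using \<open>\<epsilon> / K > 0\<close> K(2) by (intro mult_left_mono) auto
      finally show ?thesis using K(1) by simp
    qed
    then show "\<exists>F. finite F \<and> (\<forall>x. (\<forall>f\<in>F. cinner x f = 0) \<longrightarrow> norm ((X \<circ> A) x) \<le> \<epsilon> * norm x)"
      using G(1) by blast
  qed
  then show ?thesis using assms by (simp add: compact_operators_def bounded_operators_comp)
qed

lemma s_numbers_comp_right:
  fixes X :: "'h \<Rightarrow> 'h"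
  assumes X: "X \<in> compact_operators" and A: "A \<in> bounded_operators"
    and K: "0 < K" "\<And>x. norm (A x) \<le> K * norm x"
  shows "s_numbers (X \<circ> A) n \<le> K * s_numbers X n"
proof -
  obtain F where F: "finite F" "card F \<le> n"
    "\<And>x. (\<And>f. f \<in> F \<Longrightarrow> cinner x f = 0) \<Longrightarrow> norm (X x) \<le> s_numbers X n * norm x"
    using s_numbers_bound[OF X] by blast
  obtain G where G: "finite G" "card G \<le> card F"
    "\<And>x f. (\<And>g. g \<in> G \<Longrightarrow> cinner x g = 0) \<Longrightarrow> f \<in> F \<Longrightarrow> cinner (A x) f = 0"
    using comp_right_annihilator[OF A F(1)] by metis
  show ?thesis
  proof (rule s_numbers_le[OF compact_operators_comp_right[OF X A] G(1)])
    show "card G \<le> n" using G(2) F(2) by simp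
    show "norm ((X \<circ> A) x) \<le> K * s_numbers X n * norm x" if "\<And>g. g \<in> G \<Longrightarrow> cinner x g = 0" for x
    proof -
      have "norm (X (A x)) \<le> s_numbers X n * norm (A x)" using G(3) that by (intro F(3)) auto
      also have "\<dots> \<le> s_numbers X n * (K * norm x)"
        using c0_star_nonneg[OF s_numbers_c0_star[OF X]] K(2) by (intro mult_left_mono) auto
      finally show ?thesis by (simp add: mult_ac)
    qed
  qed
qed

lemma diag_svd: "\<xi> \<in> c0_star \<Longrightarrow> singular_value_decomposition (diag_op \<xi> e e) \<xi> e e"
  using orthonormal_e contractive_e by (simp add: singular_value_decomposition_def orthonormal_norm)

lemma diag_compact: "\<xi> \<in> c0_star \<Longrightarrow> diag_op \<xi> e e \<in> compact_operators"
  using diag_svd singular_value_decomposition_compact by blast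

lemma s_numbers_diag: "\<xi> \<in> c0_star \<Longrightarrow> s_numbers (diag_op \<xi> e e) = \<xi>"
  using diag_svd s_numbers_eq by blast

lemma id_not_compact: "(id :: 'h \<Rightarrow> 'h) \<notin> compact_operators"
proof
  assume id: "(id :: 'h \<Rightarrow> 'h) \<in> compact_operators"
  have "(0::real) < 1/2" by simp
  then obtain F where F: "finite F" "\<And>x::'h. (\<forall>f\<in>F. cinner x f = 0) \<Longrightarrow> norm (id x) \<le> 1/2 * norm x"
    using id unfolding compact_operators_def compact_op_def by blast
  obtain c where "(\<Sum>i\<le>card F. c i *\<^sub>C e i) \<noteq> 0" "\<And>f. f \<in> F \<Longrightarrow> cinner (\<Sum>i\<le>card F. c i *\<^sub>C e i) f = 0"
    using orthonormal_span_meets_annihilator[OF orthonormal_e F(1) order_refl] by blast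
  then show False using F(2)[of "\<Sum>i\<le>card F. c i *\<^sub>C e i"] by simp
qed

text \<open>
  If \<open>X\<close> is not compact, then for some \<open>\<epsilon> > 0\<close> every finite set is annihilated by a unit vector \<open>x\<close> with
  \<open>\<parallel>X x\<parallel> > \<epsilon>\<close>. Choosing \<open>x\<^sub>n\<close> orthogonal to all earlier \<open>x\<^sub>i\<close> and \<open>X\<^sup>* X x\<^sub>i\<close> makes both the \<open>x\<^sub>n\<close> and
  the \<open>X x\<^sub>n\<close> orthogonal. With \<open>B e\<^sub>n = x\<^sub>n\<close>, and with \<open>A\<close> sending \<open>X x\<^sub>n\<close> back to \<open>e\<^sub>n\<close>, which is bounded by
  \<open>1 / \<epsilon>\<close>, the identity is \<open>A X B\<close>.
\<close>

lemma id_factors_through_noncompact: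
  fixes X :: "'h \<Rightarrow> 'h"
  assumes X: "X \<in> bounded_operators" and nc: "\<not> compact_op X"
  obtains A B where "A \<in> bounded_operators" "B \<in> bounded_operators" "A \<circ> (X \<circ> B) = id"
proof -
  note lin = bounded_operatorsD[OF X]
  obtain K where K: "0 < K" "\<And>x. norm (X x) \<le> K * norm x"
    using bounded_operators_norm[OF X] by blast
  obtain Y where Y: "\<And>v w. cinner (X v) w = cinner v (Y w)"
    by (rule adjoint_exists[OF basis X]) (rule that)
  obtain \<epsilon> where \<epsilon>: "\<epsilon> > 0"
    and big: "\<And>F. finite F \<Longrightarrow> \<exists>x. (\<forall>f\<in>F. cinner x f = 0) \<and> \<epsilon> * norm x < norm (X x)"
    using nc unfolding compact_op_def by (meson not_le)
  have "\<exists>x. norm x = 1 \<and> (\<forall>f\<in>F. cinner x f = 0) \<and> \<epsilon> < norm (X x)" if F: "finite F" for F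
  proof -
    obtain x where x: "\<forall>f\<in>F. cinner x f = 0" "\<epsilon> * norm x < norm (X x)" using big[OF F] by blast
    then have "x \<noteq> 0" using K(2)[of x] by auto
    define y where "y = complex_of_real (1 / norm x) *\<^sub>C x"
    have "norm y = 1" "\<forall>f\<in>F. cinner y f = 0"
      using \<open>x \<noteq> 0\<close> x(1) by (auto simp: y_def norm_scaleC norm_divide cinner_scaleC_left)
    moreover have "norm (X y) = norm (X x) / norm x"
      unfolding y_def lin(2) by (simp add: norm_scaleC norm_divide)
    then have "\<epsilon> < norm (X y)" using x(2) \<open>x \<noteq> 0\<close> by (simp add: less_divide_eq)
    ultimately show ?thesis by blast
  qed
  then obtain pick where pick: "\<And>F. finite F \<Longrightarrow> norm (pick F) = 1"
    "\<And>F f. finite F \<Longrightarrow> f \<in> F \<Longrightarrow> cinner (pick F) f = 0" "\<And>F. finite F \<Longrightarrow> \<epsilon> < norm (X (pick F))"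
    by metis
  \<comment> \<open>The recursion carries the set to whose members the next vector must be orthogonal.\<close>
  define S where "S = rec_nat {} (\<lambda>_ F. insert (pick F) (insert (Y (X (pick F))) F))"
  define x where "x n = pick (S n)" for n
  have S_Suc: "S (Suc n) = insert (x n) (insert (Y (X (x n))) (S n))" for n
    by (simp add: S_def x_def)
  have fin: "finite (S n)" for n by (induction n) (simp_all add: S_Suc, simp add: S_def)
  have S_mem: "x i \<in> S n \<and> Y (X (x i)) \<in> S n" if "i < n" for i n
    using that by (induction n) (auto simp: S_Suc less_Suc_eq)
  have x1: "norm (x n) = 1" and big_x: "\<epsilon> < norm (X (x n))" for n
    using pick(1,3)[OF fin] by (auto simp: x_def)
  have lt: "cinner (x n) (x i) = 0 \<and> cinner (X (x n)) (X (x i)) = 0" if "i < n" for i n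
    using pick(2)[OF fin, of _ n] S_mem[OF that] by (simp add: Y flip: x_def)
  have orth: "cinner (x i) (x j) = 0 \<and> cinner (X (x i)) (X (x j)) = 0" if "i \<noteq> j" for i j
    using lt[of i j] lt[of j i] that cinner_eq_0_commute by (cases i j rule: linorder_cases) auto
  have x: "orthonormal x"
    unfolding orthonormal_def using orth x1 by (auto simp: cinner_self)
  define t where "t n = norm (X (x n))" for n
  have t_pos: "t n > 0" "t n > \<epsilon>" for n using big_x[of n] \<epsilon> by (auto simp: t_def)
  define w where "w n = complex_of_real (1 / t n) *\<^sub>C X (x n)" for n
  have w1: "norm (w n) = 1" for n
    using t_pos[of n] by (simp add: w_def norm_scaleC norm_divide) (simp add: t_def)
  have w: "contractive_orthogonal w"
    unfolding contractive_orthogonal_def using orth w1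
    by (auto simp: w_def cinner_scaleC_left cinner_scaleC_right)
  have Xx: "X (x n) = complex_of_real (t n) *\<^sub>C w n" for n
    using t_pos[of n] by (simp add: w_def scaleC_scaleC scaleC_one)
  have t_le: "t n \<le> K" for n using K(2)[of "x n"] x1 by (simp add: t_def)
  have Bt: "Bseq t" by (rule BseqI'[of _ K]) (use t_le t_pos in \<open>simp add: less_imp_le\<close>)
  have Bt': "Bseq (\<lambda>n. 1 / t n)"
    by (rule BseqI'[of _ "1 / \<epsilon>"]) (use t_pos \<epsilon> in \<open>auto simp: frac_le less_imp_le\<close>)
  define A where "A = diag_op (\<lambda>n. 1 / t n) w e"
  define B where "B = diag_op (\<lambda>n. 1) e x"
  have A: "A \<in> bounded_operators" unfolding A_def by (rule diag_op_bounded_operators[OF Bt' w contractive_e])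
  have B: "B \<in> bounded_operators"
    unfolding B_def by (rule diag_op_bounded_operators[OF _ contractive_e orthonormal_contractive[OF x]]) simp
  have "X (B y) = diag_op t e w y" for y
  proof -
    have "(\<lambda>n. X ((complex_of_real 1 * cinner y (e n)) *\<^sub>C x n)) sums X (B y)"
      unfolding B_def
      by (intro bounded_linear.sums[OF lin(1)] diag_op_sums contractive_e orthonormal_contractive[OF x]) simp
    then have "(\<lambda>n. (complex_of_real (t n) * cinner y (e n)) *\<^sub>C w n) sums X (B y)"
      by (simp add: lin(2) Xx scaleC_scaleC mult.commute)
    then show ?thesis using sums_unique2 diag_op_sums[OF Bt contractive_e w] by blast
  qed
  then have "A (X (B y)) = y" for y
  proof -
    have "A (X (B y)) = diag_op (\<lambda>n. 1 / t n) w e (diag_op t e w y)"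
      using \<open>\<And>y. X (B y) = diag_op t e w y\<close> by (simp add: A_def)
    also have "\<dots> = diag_op (\<lambda>n. 1 / t n * t n) e e y"
      by (rule diag_op_comp[OF Bt contractive_e w]) (rule w1)
    also have "(\<lambda>n. 1 / t n * t n) = (\<lambda>n. 1)"
      using t_pos(1) by (simp add: fun_eq_iff less_imp_neq[symmetric])
    also have "diag_op (\<lambda>n. 1) e e y = y" by (rule orthonormal_basis_expansion[OF basis])
    finally show ?thesis .
  qed
  then have "A \<circ> (X \<circ> B) = id" by (simp add: fun_eq_iff)
  with A B show thesis by (rule that)
qed

lemma operator_ideal_compact:
  fixes I :: "('h \<Rightarrow> 'h) set"
  assumes I: "operator_ideal I"
  shows "I \<subseteq> compact_operators"
proof
  fix X assume "X \<in> I"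
  then have X: "X \<in> bounded_operators" using operator_idealD(1)[OF I] by blast
  have "compact_op X"
  proof (rule ccontr)
    assume "\<not> compact_op X"
    then obtain A B where AB: "A \<in> bounded_operators" "B \<in> bounded_operators" "A \<circ> (X \<circ> B) = id"
      using id_factors_through_noncompact[OF X] by blast
    then have "id \<in> I" using operator_idealD(4,5)[OF I] \<open>X \<in> I\<close> by metis
    then show False using operator_idealD(6)[OF I] by blast
  qed
  then show "X \<in> compact_operators" using X by (simp add: compact_operators_def)
qed

text \<open>
  A singular value decomposition says that \<open>X\<close> and the diagonal operator of its singular values are
  obtained from each other by multiplication with partial isometries. Hence an ideal is determined by
  the diagonal operators in it.
\<close>

lemma operator_ideal_mem_iff_diag:
  fixes I :: "('h \<Rightarrow> 'h) set"
  assumes I: "operator_ideal I" and X: "X \<in> compact_operators"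
  shows "X \<in> I \<longleftrightarrow> diag_op (s_numbers X) e e \<in> I"
proof -
  obtain v u where svd: "singular_value_decomposition X (s_numbers X) v u"
    using compact_operator_svd[OF X] .
  define s where "s = s_numbers X"
  have s: "Bseq s" "\<And>n. s n \<noteq> 0 \<Longrightarrow> norm (u n) = 1" and v: "orthonormal v" and u: "contractive_orthogonal u"
    and X_eq: "X = diag_op s v u"
    using svd c0_star_Bseq unfolding singular_value_decomposition_def s_def by auto
  note vc = orthonormal_contractive[OF v]
  have B1: "Bseq (\<lambda>n. 1 :: real)" by simp
  have "X = diag_op (\<lambda>n. 1) e u \<circ> (diag_op s e e \<circ> diag_op (\<lambda>n. 1) v e)"
    unfolding X_eq fun_eq_iff comp_apply
    by (simp add: diag_op_comp[OF B1 vc contractive_e] diag_op_comp[OF s(1) vc contractive_e] orthonormal_norm[OF orthonormal_e])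
  moreover have "diag_op s e e = diag_op (\<lambda>n. 1) u e \<circ> (X \<circ> diag_op (\<lambda>n. 1) e v)"
    unfolding X_eq fun_eq_iff comp_apply
    by (simp add: diag_op_comp[OF B1 contractive_e vc] diag_op_comp[OF s(1) contractive_e u] orthonormal_norm[OF v] s(2))
  moreover have "diag_op (\<lambda>n. 1) e u \<in> bounded_operators" "diag_op (\<lambda>n. 1) v e \<in> bounded_operators"
    "diag_op (\<lambda>n. 1) u e \<in> bounded_operators" "diag_op (\<lambda>n. 1) e v \<in> bounded_operators"
    by (intro diag_op_bounded_operators B1 contractive_e vc u)+
  ultimately show ?thesis unfolding s_def[symmetric] using operator_idealD(4,5)[OF I] by metis
qed

lemma char_set_eq_diag:
  fixes I :: "('h \<Rightarrow> 'h) set"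
  assumes I: "operator_ideal I"
  shows "char_set I = {\<xi> \<in> c0_star. diag_op \<xi> e e \<in> I}"
proof (intro equalityI subsetI)
  fix \<xi> assume "\<xi> \<in> char_set I"
  then obtain X where "X \<in> I" "\<xi> = s_numbers X" by (auto simp: char_set_def)
  then show "\<xi> \<in> {\<xi> \<in> c0_star. diag_op \<xi> e e \<in> I}"
    using operator_ideal_compact[OF I] operator_ideal_mem_iff_diag[OF I, of X] s_numbers_c0_star by auto
next
  fix \<xi> assume "\<xi> \<in> {\<xi> \<in> c0_star. diag_op \<xi> e e \<in> I}"
  then show "\<xi> \<in> char_set I"
    unfolding char_set_def using s_numbers_diag by (metis (mono_tags) imageI mem_Collect_eq)
qed

lemma operator_ideal_eq:
  fixes I :: "('h \<Rightarrow> 'h) set"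
  assumes I: "operator_ideal I"
  shows "I = {X \<in> compact_operators. s_numbers X \<in> char_set I}"
  using operator_ideal_compact[OF I] operator_ideal_mem_iff_diag[OF I] s_numbers_c0_star
  unfolding char_set_eq_diag[OF I] by auto

lemma operator_ideal_subset_iff:
  fixes I J :: "('h \<Rightarrow> 'h) set"
  assumes "operator_ideal I" "operator_ideal J"
  shows "I \<subseteq> J \<longleftrightarrow> char_set I \<subseteq> char_set J"
proof
  show "char_set I \<subseteq> char_set J" if "I \<subseteq> J" using that by (auto simp: char_set_def)
  show "I \<subseteq> J" if "char_set I \<subseteq> char_set J"
    using that operator_ideal_eq[OF assms(1)] operator_ideal_eq[OF assms(2)] by blast
qed

text \<open>
  Sorting the indices of the basis by their remainder modulo \<open>m\<close> splits the ampliated diagonal operator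
  into \<open>m\<close> copies of the original one, each living on its own part of the basis.
\<close>

lemma diag_op_ampliation:
  assumes "\<xi> \<in> c0_star" "m \<ge> 1"
  shows "diag_op (ampliation m \<xi>) e e x
    = (\<Sum>j<m. diag_op \<xi> (\<lambda>n. e (n * m + j)) (\<lambda>n. e (n * m + j)) x)"
proof -
  have inj: "inj (\<lambda>n. n * m + j)" for j using assms(2) by (simp add: inj_def)
  have cj: "contractive_orthogonal (\<lambda>n. e (n * m + j))" for j
    by (rule orthonormal_contractive[OF orthonormal_compose[OF orthonormal_e inj]])
  define f where "f n = (complex_of_real (ampliation m \<xi> n) * cinner x (e n)) *\<^sub>C e n" for n
  have "f sums diag_op (ampliation m \<xi>) e e x"
    unfolding f_def by (intro diag_op_sums c0_star_Bseq ampliation_c0_star assms contractive_e)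
  then have 1: "(\<lambda>n. sum f {n * m..<n * m + m}) sums diag_op (ampliation m \<xi>) e e x"
    using assms(2) by (intro sums_group) auto
  have f_block: "f (n * m + j) = (complex_of_real (\<xi> n) * cinner x (e (n * m + j))) *\<^sub>C e (n * m + j)"
    if "j < m" for n j
    using that by (simp add: f_def ampliation_def)
  have "sum f {n * m..<n * m + m} = (\<Sum>j<m. (complex_of_real (\<xi> n) * cinner x (e (n * m + j))) *\<^sub>C e (n * m + j))" for n
  proof -
    have "sum f {n * m..<n * m + m} = (\<Sum>j<m. f (n * m + j))"
      by (rule sum.reindex_bij_witness[of _ "\<lambda>j. n * m + j" "\<lambda>k. k - n * m"]) auto
    then show ?thesis using f_block by simp
  qed
  then have "(\<lambda>n. \<Sum>j<m. (complex_of_real (\<xi> n) * cinner x (e (n * m + j))) *\<^sub>C e (n * m + j))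
      sums diag_op (ampliation m \<xi>) e e x" using 1 by simp
  moreover have "(\<lambda>n. \<Sum>j<m. (complex_of_real (\<xi> n) * cinner x (e (n * m + j))) *\<^sub>C e (n * m + j))
      sums (\<Sum>j<m. diag_op \<xi> (\<lambda>n. e (n * m + j)) (\<lambda>n. e (n * m + j)) x)"
    by (intro sums_sum diag_op_sums c0_star_Bseq assms cj)
  ultimately show ?thesis by (rule sums_unique2)
qed

text \<open>
  All closure properties are read off from diagonal operators: sums are sums, hereditariness is
  multiplication by the bounded diagonal operator of quotients, and an ampliation is a sum of \<open>m\<close>
  operators each of which is a product of the given one with partial isometries.
\<close>

theorem characteristic_set_char_set:
  fixes I :: "('h \<Rightarrow> 'h) set"
  assumes I: "operator_ideal I"
  shows "characteristic_set (char_set I)"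
proof -
  note D = operator_idealD[OF I]
  define d where "d \<xi> = diag_op \<xi> e e" for \<xi>
  have "d (\<lambda>n. 0) \<in> I"
  proof -
    have "d (\<lambda>n. 0) = (\<lambda>v. 0)" by (simp add: d_def diag_op_def fun_eq_iff)
    then show ?thesis using D(2) by simp
  qed
  moreover have "d (\<lambda>n. \<xi> n + \<eta> n) \<in> I" if "\<xi> \<in> c0_star" "\<eta> \<in> c0_star" "d \<xi> \<in> I" "d \<eta> \<in> I" for \<xi> \<eta>
  proof -
    have "d (\<lambda>n. \<xi> n + \<eta> n) = (\<lambda>x. d \<xi> x + d \<eta> x)"
      unfolding d_def using that by (intro ext diag_op_add c0_star_Bseq contractive_e) auto
    then show ?thesis using D(3) that by simp
  qed
  moreover have "d \<eta> \<in> I" if \<xi>: "\<xi> \<in> c0_star" and \<eta>: "\<eta> \<in> c0_star" and d\<xi>: "d \<xi> \<in> I" and O: "big_O \<eta> \<xi>" for \<xi> \<eta>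
  proof -
    obtain C where C: "0 < C" "\<And>n. \<eta> n \<le> C * \<xi> n"
      using big_OE_pos[OF O c0_star_nonneg[OF \<xi>]] by blast
    \<comment> \<open>Where \<open>\<xi>\<close> vanishes so does \<open>\<eta>\<close>, and the quotient takes the default value 0.\<close>
    define t where "t n = \<eta> n / \<xi> n" for n
    have t: "\<bar>t n\<bar> \<le> C" "t n * \<xi> n = \<eta> n" for n
      using C(2)[of n] c0_star_nonneg[OF \<xi>, of n] c0_star_nonneg[OF \<eta>, of n] C(1)
      by (cases "\<xi> n = 0"; simp add: t_def field_simps)+
    have Bt: "Bseq t" by (rule BseqI'[of _ C]) (use t in simp)
    have "d \<eta> = diag_op t e e \<circ> d \<xi>"
      unfolding d_def fun_eq_iff comp_apply
      by (simp add: diag_op_comp[OF c0_star_Bseq[OF \<xi>] contractive_e contractive_e] orthonormal_norm[OF orthonormal_e] t(2))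
    moreover have "diag_op t e e \<in> bounded_operators" by (rule diag_op_bounded_operators[OF Bt contractive_e contractive_e])
    ultimately show ?thesis using D(4) d\<xi> by simp
  qed
  moreover have "d (ampliation m \<xi>) \<in> I" if "\<xi> \<in> c0_star" "m \<ge> 1" "d \<xi> \<in> I" for m \<xi>
  proof -
    have B1: "Bseq (\<lambda>n. 1 :: real)" by simp
    define b where "b j = (\<lambda>n. e (n * m + j))" for j
    have b: "orthonormal (b j)" for j
      unfolding b_def using \<open>m \<ge> 1\<close> by (intro orthonormal_compose[OF orthonormal_e]) (simp add: inj_def)
    note bc = orthonormal_contractive[OF b]
    have block: "diag_op \<xi> (b j) (b j) \<in> I" for j
    proof -
      have "diag_op \<xi> (b j) (b j) = diag_op (\<lambda>n. 1) e (b j) \<circ> (d \<xi> \<circ> diag_op (\<lambda>n. 1) (b j) e)"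
        unfolding d_def fun_eq_iff comp_apply
        by (simp add: diag_op_comp[OF B1 bc contractive_e] diag_op_comp[OF c0_star_Bseq[OF that(1)] bc contractive_e]
            orthonormal_norm[OF orthonormal_e])
      then show ?thesis
        using D(4,5) that(3) diag_op_bounded_operators[OF B1 contractive_e bc] diag_op_bounded_operators[OF B1 bc contractive_e]
        by metis
    qed
    have "(\<lambda>x. \<Sum>j<k. diag_op \<xi> (b j) (b j) x) \<in> I" for k
    proof (induction k)
      case 0
      then show ?case using D(2) by simp
    next
      case (Suc k)
      then show ?case using D(3)[OF Suc block[of k]] by simp
    qed
    then show ?thesis
      unfolding d_def diag_op_ampliation[OF that(1,2), abs_def] b_def by simp
  qed
  ultimately show ?thesis
    unfolding characteristic_set_def char_set_eq_diag[OF I] d_def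
    by (auto simp: c0_star_zero c0_star_add ampliation_c0_star)
qed

text \<open>
  Stability under sums is the inequality \<open>s\<^sub>2\<^sub>n(X + Y) \<le> s\<^sub>n(X) + s\<^sub>n(Y)\<close>, which bounds the singular values
  of the sum by \<open>D\<^sub>2 (s(X) + s(Y))\<close>; stability under products is
  \<open>s\<^sub>n(A X B) \<le> \<parallel>A\<parallel> s\<^sub>n(X) \<parallel>B\<parallel>\<close>.
\<close>

theorem Calkin:
  assumes S: "characteristic_set S"
  defines "I \<equiv> {X :: 'h \<Rightarrow> 'h. X \<in> compact_operators \<and> s_numbers X \<in> S}"
  shows "operator_ideal I" "char_set I = S"
proof -
  have Sc: "S \<subseteq> c0_star" using S by (simp add: characteristic_set_def)
  have hered: "s_numbers Y \<in> S" if "Y \<in> compact_operators" "\<xi> \<in> S" "big_O (s_numbers Y) \<xi>" for Y :: "'h \<Rightarrow> 'h" and \<xi>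
    using S that s_numbers_c0_star[OF that(1)] by (simp add: characteristic_set_def)
  show "operator_ideal I"
  proof (rule operator_idealI)
    show "I \<subseteq> bounded_operators" by (auto simp: I_def compact_operators_bounded)
    show "(\<lambda>v. 0) \<in> I"
    proof -
      have "(\<lambda>v. 0) = diag_op (\<lambda>n. 0) e e" by (simp add: diag_op_def fun_eq_iff)
      then show ?thesis
        using S diag_compact[OF c0_star_zero] s_numbers_diag[OF c0_star_zero]
        by (simp add: I_def characteristic_set_def)
    qed
    show "(\<lambda>v. X v + Y v) \<in> I" if "X \<in> I" "Y \<in> I" for X Y
    proof -
      have X: "X \<in> compact_operators" "s_numbers X \<in> S" and Y: "Y \<in> compact_operators" "s_numbers Y \<in> S"
        using that by (auto simp: I_def)
      define \<xi> where "\<xi> = ampliation 2 (\<lambda>n. s_numbers X n + s_numbers Y n)"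
      have "\<xi> \<in> S" using S X(2) Y(2) by (simp add: characteristic_set_def \<xi>_def)
      note XY = compact_operators_add[OF X(1) Y(1)]
      have "s_numbers (\<lambda>v. X v + Y v) n \<le> \<xi> n" for n
      proof -
        have "s_numbers (\<lambda>v. X v + Y v) n \<le> s_numbers (\<lambda>v. X v + Y v) (n div 2 + n div 2)"
          by (rule c0_star_antimono[OF s_numbers_c0_star[OF XY]]) linarith
        also have "\<dots> \<le> \<xi> n"
          unfolding \<xi>_def ampliation_def by (rule s_numbers_add[OF X(1) Y(1)])
        finally show ?thesis .
      qed
      then have "s_numbers (\<lambda>v. X v + Y v) \<in> S"
        by (intro hered[OF XY \<open>\<xi> \<in> S\<close>] big_O_le)
      then show ?thesis using XY by (simp add: I_def)
    qed
    fix A X :: "'h \<Rightarrow> 'h" assume A: "A \<in> bounded_operators" and "X \<in> I"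
    then have X: "X \<in> compact_operators" "s_numbers X \<in> S" by (auto simp: I_def)
    obtain K where K: "0 < K" "\<And>x. norm (A x) \<le> K * norm x"
      using bounded_operators_norm[OF A] by blast
    have "big_O (s_numbers (A \<circ> X)) (s_numbers X)" "big_O (s_numbers (X \<circ> A)) (s_numbers X)"
      unfolding big_O_def using s_numbers_comp_left[OF X(1) A K] s_numbers_comp_right[OF X(1) A K] by blast+
    then show "A \<circ> X \<in> I" "X \<circ> A \<in> I"
      using hered[OF _ X(2)] compact_operators_comp_left[OF X(1) A] compact_operators_comp_right[OF X(1) A]
      by (auto simp: I_def)
  next
    show "id \<notin> I" using id_not_compact by (simp add: I_def)
  qed
  show "char_set I = S"
  proof (intro equalityI subsetI)
    fix \<xi> assume "\<xi> \<in> S"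
    then have "\<xi> \<in> c0_star" using Sc by blast
    then have "diag_op \<xi> e e \<in> I" "s_numbers (diag_op \<xi> e e) = \<xi>"
      using \<open>\<xi> \<in> S\<close> by (auto simp: I_def diag_compact s_numbers_diag)
    then show "\<xi> \<in> char_set I" unfolding char_set_def by (metis imageI)
  qed (auto simp: char_set_def I_def)
qed

text \<open>
  Existence is Calkin's construction. For uniqueness, an ideal consists of the compact operators whose
  singular values lie in its characteristic set.
\<close>

lemma ideal_of_characteristic_set:
  assumes S: "characteristic_set S"
  shows "operator_ideal (ideal_of S :: ('h \<Rightarrow> 'h) set)" "char_set (ideal_of S :: ('h \<Rightarrow> 'h) set) = S"
proof -
  have "\<exists>!I :: ('h \<Rightarrow> 'h) set. operator_ideal I \<and> char_set I = S"
  proof (rule ex_ex1I)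
    show "\<exists>I :: ('h \<Rightarrow> 'h) set. operator_ideal I \<and> char_set I = S" using Calkin[OF S] by blast
    show "I = J" if "operator_ideal I \<and> char_set I = S" "operator_ideal J \<and> char_set J = S"
      for I J :: "('h \<Rightarrow> 'h) set"
      using that operator_ideal_eq[of I] operator_ideal_eq[of J] by simp
  qed
  from theI'[OF this] show "operator_ideal (ideal_of S :: ('h \<Rightarrow> 'h) set)" "char_set (ideal_of S :: ('h \<Rightarrow> 'h) set) = S"
    unfolding ideal_of_def by auto
qed

section \<open>Arithmetic mean ideals\<close>

lemma char_set_am_ideal:
  fixes I :: "('h \<Rightarrow> 'h) set"
  assumes "operator_ideal I"
  shows "operator_ideal (am_ideal I)" "char_set (am_ideal I) = {\<xi> \<in> c0_star. \<exists>\<eta>\<in>char_set I. big_O \<xi> (am \<eta>)}"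
  unfolding am_ideal_def
  by (rule ideal_of_characteristic_set[OF characteristic_set_am[OF characteristic_set_char_set[OF assms]]])+

lemma char_set_am_ideal_twice:
  fixes I :: "('h \<Rightarrow> 'h) set"
  assumes I: "operator_ideal I"
  shows "char_set (am_ideal (am_ideal I)) = {\<xi> \<in> c0_star. \<exists>\<eta>\<in>char_set I. big_O \<xi> (am (am \<eta>))}"
  unfolding char_set_am_ideal(2)[OF char_set_am_ideal(1)[OF I]] char_set_am_ideal(2)[OF I]
  using characteristic_set_char_set[OF I] by (intro am_am_set_eq) (simp add: characteristic_set_def)

lemma char_set_principal_ideal:
  assumes "\<xi> \<in> c0_star"
  shows "operator_ideal (principal_ideal \<xi> :: ('h \<Rightarrow> 'h) set)"
    "char_set (principal_ideal \<xi> :: ('h \<Rightarrow> 'h) set) = {\<eta> \<in> c0_star. \<exists>m\<ge>1. big_O \<eta> (ampliation m \<xi>)}"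
  unfolding principal_ideal_def
  by (rule ideal_of_characteristic_set[OF characteristic_set_principal[OF assms]])+

text \<open>
  Both parts of the theorem are instances. Passing to characteristic sets, each \<open>\<mu>\<close> in \<open>\<Sigma>(J)\<close> has its
  second mean bounded by that of some \<open>\<nu>\<close> in \<open>\<Sigma>(I)\<close>, hence by that of an \<open>\<eta>\<close> in \<open>\<Sigma>(I)\<close> whose ratio of
  regularity is equivalent to a monotone sequence, and \<open>\<eta>\<close> permits cancellation. For a general ideal \<open>\<eta>\<close>
  is a termwise majorant of \<open>\<nu>\<close>; for a principal ideal it is the generator itself, whose mean dominates
  the means of all its ampliations.
\<close>

lemma am_ideal_cancellation:
  fixes I J :: "('h \<Rightarrow> 'h) set"
  assumes I: "operator_ideal I" and J: "operator_ideal J"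
    and sub: "am_ideal (am_ideal J) \<subseteq> am_ideal (am_ideal I)"
    and dom: "\<And>\<mu>. \<mu> \<in> char_set I \<Longrightarrow> \<exists>\<eta>\<in>char_set I. \<eta> \<noteq> (\<lambda>n. 0) \<and>
       big_O (am (am \<mu>)) (am (am \<eta>)) \<and> equiv_to_monotone (regularity_ratio (am \<eta>))"
  shows "am_ideal J \<subseteq> am_ideal I"
proof -
  have Ic: "char_set I \<subseteq> c0_star" and Jc: "char_set J \<subseteq> c0_star"
    using characteristic_set_char_set I J by (auto simp: characteristic_set_def)
  have nn: "0 \<le> am (am \<eta>) n" if "\<eta> \<in> c0_star" for \<eta> n
    using that by (simp add: am_nonneg c0_star_nonneg)
  have sub': "char_set (am_ideal (am_ideal J)) \<subseteq> char_set (am_ideal (am_ideal I))"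
    using sub by (auto simp: char_set_def)
  have "\<exists>\<eta>\<in>char_set I. big_O (am \<mu>) (am \<eta>)" if \<mu>: "\<mu> \<in> char_set J" for \<mu>
  proof -
    have "\<mu> \<in> c0_star" using \<mu> Jc by blast
    then have "am (am \<mu>) \<in> char_set (am_ideal (am_ideal J))"
      unfolding char_set_am_ideal_twice[OF J] using \<mu> am_c0_star by (auto intro!: bexI[of _ \<mu>] big_O_le)
    then obtain \<nu> where \<nu>: "\<nu> \<in> char_set I" "big_O (am (am \<mu>)) (am (am \<nu>))"
      using sub' unfolding char_set_am_ideal_twice[OF I] by blast
    obtain \<eta> where \<eta>: "\<eta> \<in> char_set I" "\<eta> \<noteq> (\<lambda>n. 0)" "big_O (am (am \<nu>)) (am (am \<eta>))"
      "equiv_to_monotone (regularity_ratio (am \<eta>))"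
      using dom[OF \<nu>(1)] by blast
    have "big_O (am (am \<mu>)) (am (am \<eta>))"
      using \<nu> \<eta>(3) nn Ic by (blast intro: big_O_trans)
    then have "big_O (am \<mu>) (am \<eta>)"
      using first_order_cancellation \<eta> Ic \<open>\<mu> \<in> c0_star\<close> by blast
    then show ?thesis using \<eta>(1) by blast
  qed
  moreover have "0 \<le> am \<mu> n" if "\<mu> \<in> char_set J" for \<mu> n
    using that Jc by (auto intro!: am_nonneg intro: c0_star_nonneg)
  ultimately have "char_set (am_ideal J) \<subseteq> char_set (am_ideal I)"
    unfolding char_set_am_ideal(2)[OF I] char_set_am_ideal(2)[OF J] by (blast intro: big_O_trans)
  then show ?thesis using operator_ideal_subset_iff[OF char_set_am_ideal(1)[OF J] char_set_am_ideal(1)[OF I]] by blast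
qed

end

theorem theorem4p5:
  assumes "separable_space (euclidean :: 'h::complex_hilbert topology)"
    and "infinite_dimensional (UNIV :: 'h set)"
  shows
    "(\<forall>\<eta> \<in> c0_star. \<eta> \<noteq> (\<lambda>n. 0) \<longrightarrow> equiv_to_monotone (regularity_ratio (am \<eta>)) \<longrightarrow>
        (\<forall>J :: ('h \<Rightarrow> 'h) set. operator_ideal J \<longrightarrow>
           am_ideal (am_ideal J) \<subseteq> am_ideal (am_ideal (principal_ideal \<eta>)) \<longrightarrow>
           am_ideal J \<subseteq> am_ideal (principal_ideal \<eta>)))
     \<and>
     (\<forall>I :: ('h \<Rightarrow> 'h) set. operator_ideal I \<longrightarrow>
        (\<forall>\<mu> \<in> char_set I. \<exists>\<eta> \<in> char_set I.
            \<eta> \<noteq> (\<lambda>n. 0) \<and> (\<forall>n. \<mu> n \<le> \<eta> n) \<and> equiv_to_monotone (regularity_ratio (am \<eta>))) \<longrightarrow>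
        (\<forall>J :: ('h \<Rightarrow> 'h) set. operator_ideal J \<longrightarrow>
           am_ideal (am_ideal J) \<subseteq> am_ideal (am_ideal I) \<longrightarrow>
           am_ideal J \<subseteq> am_ideal I))"
proof -
  obtain e :: "nat \<Rightarrow> 'h" where "orthonormal_basis e"
    using orthonormal_basis_exists[OF assms] .
  then interpret hilbert_basis e by unfold_locales
  show ?thesis
  proof (intro conjI ballI allI impI)
    fix \<eta> and J :: "('h \<Rightarrow> 'h) set"
    assume \<eta>: "\<eta> \<in> c0_star" "\<eta> \<noteq> (\<lambda>n. 0)" "equiv_to_monotone (regularity_ratio (am \<eta>))"
      and J: "operator_ideal J" "am_ideal (am_ideal J) \<subseteq> am_ideal (am_ideal (principal_ideal \<eta>))"
    show "am_ideal J \<subseteq> am_ideal (principal_ideal \<eta>)"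
    proof (rule am_ideal_cancellation[OF char_set_principal_ideal(1)[OF \<eta>(1)] J])
      fix \<mu> assume "\<mu> \<in> char_set (principal_ideal \<eta> :: ('h \<Rightarrow> 'h) set)"
      then obtain m where m: "m \<ge> 1" "big_O \<mu> (ampliation m \<eta>)"
        unfolding char_set_principal_ideal(2)[OF \<eta>(1)] by blast
      have "0 \<le> am (ampliation m \<eta>) n" for n
        using \<eta>(1) by (intro am_nonneg) (simp add: ampliation_def c0_star_nonneg)
      then have "big_O (am \<mu>) (am \<eta>)"
        using big_O_trans[OF am_big_O[OF m(2)] big_O_am_ampliation[OF \<eta>(1) m(1)]] by blast
      then have "big_O (am (am \<mu>)) (am (am \<eta>))" by (rule am_big_O)
      moreover have "\<eta> \<in> char_set (principal_ideal \<eta> :: ('h \<Rightarrow> 'h) set)"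
        unfolding char_set_principal_ideal(2)[OF \<eta>(1)] using \<eta>(1)
        by (auto simp: ampliation_def intro!: exI[of _ 1] big_O_le)
      ultimately show "\<exists>\<eta>\<in>char_set (principal_ideal \<eta> :: ('h \<Rightarrow> 'h) set). \<eta> \<noteq> (\<lambda>n. 0) \<and>
          big_O (am (am \<mu>)) (am (am \<eta>)) \<and> equiv_to_monotone (regularity_ratio (am \<eta>))"
        using \<eta> by blast
    qed
  next
    fix I J :: "('h \<Rightarrow> 'h) set"
    assume I: "operator_ideal I" and J: "operator_ideal J" "am_ideal (am_ideal J) \<subseteq> am_ideal (am_ideal I)"
      and dom: "\<forall>\<mu> \<in> char_set I. \<exists>\<eta> \<in> char_set I.
            \<eta> \<noteq> (\<lambda>n. 0) \<and> (\<forall>n. \<mu> n \<le> \<eta> n) \<and> equiv_to_monotone (regularity_ratio (am \<eta>))"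
    show "am_ideal J \<subseteq> am_ideal I"
    proof (rule am_ideal_cancellation[OF I J])
      fix \<mu> assume "\<mu> \<in> char_set I"
      then obtain \<eta> where \<eta>: "\<eta> \<in> char_set I" "\<eta> \<noteq> (\<lambda>n. 0)" "\<And>n. \<mu> n \<le> \<eta> n"
        "equiv_to_monotone (regularity_ratio (am \<eta>))" using dom by blast
      then have "big_O (am (am \<mu>)) (am (am \<eta>))" by (intro am_big_O big_O_le)
      then show "\<exists>\<eta>\<in>char_set I. \<eta> \<noteq> (\<lambda>n. 0) \<and>
          big_O (am (am \<mu>)) (am (am \<eta>)) \<and> equiv_to_monotone (regularity_ratio (am \<eta>))"
        using \<eta> by blast
    qed
  qed
qed

end
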